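(* There is a universal constant $\Delta$ such that the following holds. If $I\ge1$, $f:\mathcal X\times\mathcal Y\to\{0,1\}$ is a Boolean function, and $p(xym)$ is a protocol distribution for computing $f^{\oplus n}$ (with inputs $x\in\mathcal X^n$, $y\in\mathcal Y^n$) satisfying $p(xy)=\prod_{i=1}^n p(x_iy_i)$, then for some $i\in\{1,\dots,n\}$ there is a protocol distribution $p_i$ for computing $f$ (with inputs $x_iy_i\in\mathcal X\times\mathcal Y$) such that $p_i(x_iy_i)=p(x_iy_i)$, $p_i$ has the same number of messages as $p$, for $j>1$ the support of the $j$-th message $m_j$ is identical in $p_i$ and $p$, and moreover $$\mathsf M_I(p_i,f)\ \le\ \frac{\mathsf M_I(p,f^{\oplus n})}{n}+\Delta I\cdot\Big(1+\log\frac{\mathsf M_I(p,f^{\oplus n})}{n\cdot I}\Big).$$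
   Context: All sets are finite, $xy$ means $(x,y)$, logs are base 2. $f^{\oplus n}(xy)=f(x_1y_1)\oplus\cdots\oplus f(x_ny_n)$ for $x\in\mathcal X^n,y\in\mathcal Y^n$. For a joint distribution we write e.g. $p(x_iy_i)$, $q(xy|m)$, $q(x|ym)$ for marginals and conditionals. Protocol distribution: a distribution $p(xym)$ on inputs $xy$ and $m=(m_0,m_1,m_2,\dots)$, where $m_0$ is the public randomness and $m_1,m_2,\dots$ are the messages (odd ones sent by Alice, even ones by Bob), such that $$p(xym)=p(xy)\cdot p(m_0)\cdot\prod_{i=1,3,5,\dots}p(m_i|xm_{<i})\cdot p(m_{i+1}|ym_{\le i}).$$ The "support" of a message $m_j$ means the alphabet, i.e. the set in which $m_j$ takes values. A distribution $q(xym)$ is rectangular with respect to $\mu(xy)$ if $q(xym)=\mu(xy)\cdot A(xm)\cdot B(ym)$ for some functions $A,B$. Marginal information: for $I\ge1$, $\delta=1/15$ and a Boolean function $h$ of the inputs, $$\mathsf M_I(p,h)=\inf_q\sup_{xym}\log\Big(\frac{q(x|ym)}{p(x|y)}\cdot\frac{q(y|xm)}{p(y|x)}\cdot\Big(\frac{q(xym)}{p(xym)}\Big)^I\cdot\Big|\mathbb E_{q(xy|m)}[(-1)^{h(xy)}]\Big|^{-12I/\delta}\Big),$$ where the infimum is over all distributions $q$ rectangular with respect to $p(xy)$, and the supremum is over all $xym$ in the support of $q$. (Division by $0$, or a negative power of $0$, is read as $+\infty$.)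
   Formalization: The term log(M/(nI)) in the bound is replaced by log max(1, M/(nI)), since the printed bound fails when M is about nI/2 or less; finite sets and alphabets are taken as sets of naturals, and protocols have at least one message. *)

theory Defs
  imports "HOL-Probability.Probability"
begin

text \<open>
  Throughout, a distribution on inputs and transcripts is a \<^verbatim>\<open>pmf\<close> on triples
  \<open>(x, y, m)\<close>, where \<open>m\<close> is the list \<open>[m\<^sub>0, m\<^sub>1, \<dots>]\<close>: entry 0 is the public randomness and the
  entries from 1 on are the messages.  Hence \<open>m\<^bsub><j\<^esub>\<close> is \<open>take j m\<close>.
\<close>

definition words :: "nat \<Rightarrow> 'a set \<Rightarrow> 'a list set" where
  "words n X = {xs. set xs \<subseteq> X \<and> length xs = n}"

definition xor_power :: "('a \<Rightarrow> 'b \<Rightarrow> bool) \<Rightarrow> 'a list \<Rightarrow> 'b list \<Rightarrow> bool" where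
  "xor_power f xs ys = foldr (\<noteq>) (map2 f xs ys) False"

definition inputs :: "('x \<times> 'y \<times> 'm list) pmf \<Rightarrow> ('x \<times> 'y) pmf" where
  "inputs p = map_pmf (\<lambda>(x, y, m). (x, y)) p"

definition coord_inputs ::
  "nat \<Rightarrow> ('a list \<times> 'b list \<times> 'm list) pmf \<Rightarrow> ('a \<times> 'b) pmf" where
  "coord_inputs i p = map_pmf (\<lambda>(x, y, m). (x ! i, y ! i)) p"

text \<open>
  \<open>As\<close> lists the alphabets of \<open>m\<^sub>0, m\<^sub>1, \<dots>\<close>, so there are \<open>length As - 1\<close> messages; a protocol has
  at least one.  Conditioning on a null event yields 0.  This is harmless in the
  factorization: at the first prefix of \<open>m\<close> whose probability together with \<open>x\<close> and \<open>y\<close>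
  vanishes, the product already contains a well-defined factor 0.
\<close>

definition protocol_dist ::
  "'x set \<Rightarrow> 'y set \<Rightarrow> 'm set list \<Rightarrow> ('x \<times> 'y \<times> 'm list) pmf \<Rightarrow> bool" where
  "protocol_dist X Y As p \<longleftrightarrow>
     2 \<le> length As \<and> (\<forall>A \<in> set As. finite A) \<and>
     set_pmf p \<subseteq> X \<times> Y \<times> listset As \<and>
     (\<forall>x \<in> X. \<forall>y \<in> Y. \<forall>m \<in> listset As.
        pmf p (x, y, m) =
          pmf (inputs p) (x, y) *
          \<P>(w in p. snd (snd w) ! 0 = m ! 0) *
          (\<Prod>j = 1..<length As.
             if odd j
             then \<P>(w in p. snd (snd w) ! j = m ! j \<bar> fst w = x \<and> take j (snd (snd w)) = take j m)
             else \<P>(w in p. snd (snd w) ! j = m ! j \<bar> fst (snd w) = y \<and> take j (snd (snd w)) = take j m)))"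

definition rectangular :: "('x \<times> 'y) pmf \<Rightarrow> ('x \<times> 'y \<times> 'm list) pmf \<Rightarrow> bool" where
  "rectangular \<mu> q \<longleftrightarrow>
     (\<exists>(A :: 'x \<Rightarrow> 'm list \<Rightarrow> real) (B :: 'y \<Rightarrow> 'm list \<Rightarrow> real).
        \<forall>x y m. pmf q (x, y, m) = pmf \<mu> (x, y) * A x m * B y m)"

definition marginal_delta :: real where
  "marginal_delta = 1 / 15"

definition cond_bias ::
  "('x \<times> 'y \<times> 'm list) pmf \<Rightarrow> ('x \<Rightarrow> 'y \<Rightarrow> bool) \<Rightarrow> 'm list \<Rightarrow> real" where
  "cond_bias q h m =
     \<bar>measure_pmf.expectation (cond_pmf q {w. snd (snd w) = m})
        (\<lambda>(x, y, _). (- 1) ^ (of_bool (h x y) :: nat))\<bar>"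

text \<open>
  The first case is the convention that division by 0, or a negative power of 0, is \<open>+\<infinity>\<close>;
  on the support of \<open>q\<close> all the numerators are positive.
\<close>

definition marginal_cost ::
  "real \<Rightarrow> ('x \<times> 'y \<times> 'm list) pmf \<Rightarrow> ('x \<Rightarrow> 'y \<Rightarrow> bool) \<Rightarrow> ('x \<times> 'y \<times> 'm list) pmf
     \<Rightarrow> 'x \<Rightarrow> 'y \<Rightarrow> 'm list \<Rightarrow> ereal" where
  "marginal_cost I p h q x y m =
     (let px = \<P>(w in p. fst w = x \<bar> fst (snd w) = y);
          py = \<P>(w in p. fst (snd w) = y \<bar> fst w = x);
          qx = \<P>(w in q. fst w = x \<bar> fst (snd w) = y \<and> snd (snd w) = m);
          qy = \<P>(w in q. fst (snd w) = y \<bar> fst w = x \<and> snd (snd w) = m);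
          e = cond_bias q h m
      in if px = 0 \<or> py = 0 \<or> pmf p (x, y, m) = 0 \<or> e = 0 then \<infinity>
         else ereal (log 2 (qx / px * (qy / py) *
                (pmf q (x, y, m) / pmf p (x, y, m)) powr I *
                e powr (- 12 * I / marginal_delta))))"

text \<open>
  The infimum need not be restricted to \<open>q\<close> whose transcripts use the alphabets of \<open>p\<close>:
  elsewhere \<open>p\<close> vanishes, so any other \<open>q\<close> contributes \<open>\<infinity>\<close>.
\<close>

definition marginal_info ::
  "real \<Rightarrow> ('x \<times> 'y \<times> 'm list) pmf \<Rightarrow> ('x \<Rightarrow> 'y \<Rightarrow> bool) \<Rightarrow> ereal" where
  "marginal_info I p h =
     (INF q \<in> {q. rectangular (inputs p) q}.
        SUP (x, y, m) \<in> set_pmf q. marginal_cost I p h q x y m)"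

text \<open>
  The error term \<open>1 + log (M / (n I))\<close> of the direct sum theorem, where \<open>M\<close> is a marginal information,
  needs the logarithm to be truncated at 0.  Without truncation the bound fails: for \<open>n = 2\<close>,
  \<open>I = 1\<close>, \<open>x\<close> uniform on pairs of bits, \<open>y\<close> constant, \<open>f(x, y) = x\<close> and the single message
  \<open>x\<^sub>1 \<oplus> x\<^sub>2\<close>, one has \<open>M \<le> 1\<close> (take \<open>q = p\<close>), so the untruncated bound is at most 1/2 for
  every nonnegative constant, whereas every protocol for \<open>f\<close> has marginal information close to 1
  or larger.
\<close>

definition log2_plus :: "real \<Rightarrow> real" where
  "log2_plus z = log 2 (max 1 z)"

end

theory Submission
  imports Defs
begin

text \<open>
  Split the coordinates into two halves, \<open>x = (x1, x2)\<close> and \<open>y = (y1, y2)\<close>.  A protocol with a rectangular \<open>q\<close>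
  of cost \<open>M\<close> for the exclusive or of all coordinates induces protocols for the two halves, in which the unused
  inputs \<open>y2\<close> and \<open>x1\<close> are simulated by Alice and by public randomness according to \<open>q\<close>, and the corresponding
  marginals of \<open>q\<close> are again rectangular.  The information costs add up, and the bias of the exclusive or is
  an average of products of the biases of the halves.  Restricting both marginals to boxes on which these
  biases and costs are essentially constant gives costs \<open>t1\<close> and \<open>t2\<close> with
  \<open>t1 + t2 \<le> M + O(I (1 + log (M / I)))\<close>.  Recursing into a half of
  smaller cost per coordinate, the losses per coordinate form a convergent series.
\<close>

section \<open>Costs and boxes\<close>

text \<open>Marginal information is a supremum, so averages over \<open>(x1, y2)\<close> do not
  suffice: each split must end in distributions whose cost is bounded at every support point.
  Restricting to a box of mass \<open>tm\<close> raises the cost by about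
  \<open>(I + 2) * log 2 (1 / tm)\<close>. The large exponent of the bias pays for this: the box is
  chosen so that its bias grows like \<open>tm\<close> to the power -1/4, which returns
  \<open>45 * I * log 2 (1 / tm)\<close>. The logarithm in the error comes from pigeonholing. The
  logarithms of the biases and the cost in units of \<open>I\<close> lie in intervals whose length
  is linear in \<open>max 1 (Mb / I)\<close>, and the number of classes enters through its
  logarithm. This needs costs bounded below, which holds outside a set of exponentially small mass.
  Splitting off single coordinates would lose a term of order log n in each of n steps. With halves,
  a block of length k loses per coordinate only order log k / k, besides order 1 / k times the
  truncated logarithm. The words \<open>x1\<close> and \<open>y2\<close> stay in the transcripts
  because rectangularity makes \<open>x2\<close> and \<open>y1\<close> independent only when both
  are fixed. They fit into the public randomness and the first message, so the later alphabets
  survive.\<close>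

definition sg :: "bool \<Rightarrow> real" where "sg b = (if b then -1 else 1)"

lemma abs_sg [simp]: "\<bar>sg b\<bar> = 1"
  by (auto simp: sg_def)

lemma finite_argmax:
  fixes f :: "'a \<Rightarrow> real"
  assumes "finite S" "S \<noteq> {}"
  shows "\<exists>x\<in>S. \<forall>y\<in>S. f y \<le> f x"
proof -
  have "Max (f ` S) \<in> f ` S" using assms by (intro Max_in) auto
  then obtain x where "x \<in> S" "f x = Max (f ` S)" by auto
  then show ?thesis using assms by (metis Max_ge finite_imageI imageI)
qed

type_synonym ('i, 'j, 'w) weight = "'i \<Rightarrow> 'j \<Rightarrow> 'w \<Rightarrow> real"

text \<open>The logarithm of the first three factors of the marginal cost, the bias factor being
  kept apart. Conditionals are quotients of sums of \<open>q\<close> itself, so the label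
  \<open>w\<close> may be a transcript together with an extra input word.\<close>

definition info_cost ::
  "real \<Rightarrow> 'i set \<Rightarrow> 'j set \<Rightarrow> ('i \<Rightarrow> 'j \<Rightarrow> real) \<Rightarrow> ('i, 'j, 'w) weight \<Rightarrow> ('i, 'j, 'w) weight
     \<Rightarrow> 'i \<Rightarrow> 'j \<Rightarrow> 'w \<Rightarrow> real" where
  "info_cost I X Y \<mu> P q x y w =
     log 2 (q x y w / (\<Sum>x'\<in>X. q x' y w) / (\<mu> x y / (\<Sum>x'\<in>X. \<mu> x' y))) +
     log 2 (q x y w / (\<Sum>y'\<in>Y. q x y' w) / (\<mu> x y / (\<Sum>y'\<in>Y. \<mu> x y'))) +
     I * log 2 (q x y w / P x y w)"

definition bias :: "'i set \<Rightarrow> 'j set \<Rightarrow> ('i \<Rightarrow> 'j \<Rightarrow> bool) \<Rightarrow> ('i, 'j, 'w) weight \<Rightarrow> 'w \<Rightarrow> real" where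
  "bias X Y h q w =
     \<bar>\<Sum>x\<in>X. \<Sum>y\<in>Y. q x y w * sg (h x y)\<bar> / (\<Sum>x\<in>X. \<Sum>y\<in>Y. q x y w)"

text \<open>The factor 180 is \<open>12 / \<delta>\<close> for \<open>\<delta> = 1 / 15\<close>.\<close>

definition cheap ::
  "real \<Rightarrow> 'i set \<Rightarrow> 'j set \<Rightarrow> 'w set \<Rightarrow> ('i \<Rightarrow> 'j \<Rightarrow> real) \<Rightarrow> ('i \<Rightarrow> 'j \<Rightarrow> bool) \<Rightarrow> ('i, 'j, 'w) weight
     \<Rightarrow> ('i, 'j, 'w) weight \<Rightarrow> real \<Rightarrow> bool" where
  "cheap I X Y W \<mu> h P q t \<longleftrightarrow>
     (\<forall>x\<in>X. \<forall>y\<in>Y. \<forall>w\<in>W. 0 < q x y w \<longrightarrow>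
        0 < P x y w \<and> 0 < bias X Y h q w \<and>
        info_cost I X Y \<mu> P q x y w - 180 * I * log 2 (bias X Y h q w) \<le> t)"

text \<open>The mass of \<open>P\<close> is bounded rather than fixed because all that is drawn from
  it is an upper bound on the mass of points with very negative cost.\<close>

definition admissible ::
  "'i set \<Rightarrow> 'j set \<Rightarrow> 'w set \<Rightarrow> ('i \<Rightarrow> 'j \<Rightarrow> real) \<Rightarrow> ('i, 'j, 'w) weight \<Rightarrow> ('i, 'j, 'w) weight \<Rightarrow> bool" where
  "admissible X Y W \<mu> P q \<longleftrightarrow> finite X \<and> finite Y \<and> finite W \<and>
     (\<forall>x y w. 0 \<le> q x y w) \<and> (\<Sum>x\<in>X. \<Sum>y\<in>Y. \<Sum>w\<in>W. q x y w) = 1 \<and> (\<forall>x y. 0 \<le> \<mu> x y) \<and>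
     (\<forall>x\<in>X. \<forall>y\<in>Y. \<forall>w\<in>W. 0 \<le> P x y w \<and> (0 < q x y w \<longrightarrow> 0 < \<mu> x y \<and> 0 < P x y w)) \<and>
     (\<Sum>x\<in>X. \<Sum>y\<in>Y. \<Sum>w\<in>W. P x y w) \<le> 1"

lemma admissibleD:
  assumes "admissible X Y W \<mu> P q"
  shows "finite X" "finite Y" "finite W" "0 \<le> q x y w" "(\<Sum>x\<in>X. \<Sum>y\<in>Y. \<Sum>w\<in>W. q x y w) = 1" "0 \<le> \<mu> x y"
    "x \<in> X \<Longrightarrow> y \<in> Y \<Longrightarrow> w \<in> W \<Longrightarrow> 0 < q x y w \<Longrightarrow> 0 < \<mu> x y"
    "x \<in> X \<Longrightarrow> y \<in> Y \<Longrightarrow> w \<in> W \<Longrightarrow> 0 < q x y w \<Longrightarrow> 0 < P x y w"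
    "x \<in> X \<Longrightarrow> y \<in> Y \<Longrightarrow> w \<in> W \<Longrightarrow> 0 \<le> P x y w"
    "(\<Sum>x\<in>X. \<Sum>y\<in>Y. \<Sum>w\<in>W. P x y w) \<le> 1"
  using assms unfolding admissible_def by blast+

lemma admissible_swap:
  "admissible X Y W \<mu> P q \<Longrightarrow> admissible Y X W (\<lambda>y x. \<mu> x y) (\<lambda>y x. P x y) (\<lambda>y x. q x y)"
  unfolding admissible_def sum.swap[of _ X Y] by blast

text \<open>The box consists of sets of pairs \<open>(x, w)\<close> and \<open>(y, w)\<close>, so it
  may differ from label to label. Its indicator splits into a factor of \<open>(x, w)\<close> and
  one of \<open>(y, w)\<close>, hence the restricted and normalized weight keeps the form prior
  times \<open>A\<close> times \<open>B\<close>.\<close>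

definition cheap_box ::
  "real \<Rightarrow> 'i set \<Rightarrow> 'j set \<Rightarrow> 'w set \<Rightarrow> ('i \<Rightarrow> 'j \<Rightarrow> real) \<Rightarrow> ('i \<Rightarrow> 'j \<Rightarrow> bool) \<Rightarrow> ('i, 'j, 'w) weight
     \<Rightarrow> ('i, 'j, 'w) weight \<Rightarrow> real \<Rightarrow> bool" where
  "cheap_box I X Y W \<mu> h P l t \<longleftrightarrow> (\<exists>S T c. 0 < c \<and>
    (\<Sum>x\<in>X. \<Sum>y\<in>Y. \<Sum>w\<in>W. l x y w * of_bool ((x, w) \<in> S) * of_bool ((y, w) \<in> T) / c) = 1 \<and>
    cheap I X Y W \<mu> h P (\<lambda>x y w. l x y w * of_bool ((x, w) \<in> S) * of_bool ((y, w) \<in> T) / c) t)"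

lemma info_cost_swap: "info_cost I Y X (\<lambda>y x. \<mu> x y) (\<lambda>y x. P x y) (\<lambda>y x. q x y) y x w = info_cost I X Y \<mu> P q x y w"
  by (simp add: info_cost_def)

lemma bias_swap: "bias Y X (\<lambda>y x. h x y) (\<lambda>y x. q x y) w = bias X Y h q w"
proof -
  have "(\<Sum>y\<in>Y. \<Sum>x\<in>X. q x y w * sg (h x y)) = (\<Sum>x\<in>X. \<Sum>y\<in>Y. q x y w * sg (h x y))"
    "(\<Sum>y\<in>Y. \<Sum>x\<in>X. q x y w) = (\<Sum>x\<in>X. \<Sum>y\<in>Y. q x y w)"
    by (rule sum.swap)+
  then show ?thesis unfolding bias_def by simp
qed

lemma cheap_swap:
  assumes "cheap I Y X W (\<lambda>y x. \<mu> x y) (\<lambda>y x. h x y) (\<lambda>y x. P x y) (\<lambda>y x. q x y) t"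
  shows "cheap I X Y W \<mu> h P q t"
  unfolding cheap_def
proof (intro ballI impI)
  fix x y w assume "x \<in> X" "y \<in> Y" "w \<in> W" "0 < q x y w"
  with assms have "0 < P x y w \<and> 0 < bias Y X (\<lambda>y x. h x y) (\<lambda>y x. q x y) w \<and>
        info_cost I Y X (\<lambda>y x. \<mu> x y) (\<lambda>y x. P x y) (\<lambda>y x. q x y) y x w
          - 180 * I * log 2 (bias Y X (\<lambda>y x. h x y) (\<lambda>y x. q x y) w) \<le> t"
    unfolding cheap_def by blast
  moreover note info_cost_swap[of I Y X \<mu> P q y x w] bias_swap[of Y X h q w]
  ultimately show "0 < P x y w \<and> 0 < bias X Y h q w \<and>
        info_cost I X Y \<mu> P q x y w - 180 * I * log 2 (bias X Y h q w) \<le> t"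
    by simp
qed

text \<open>The box extraction wants a bias on every row \<open>(x, w)\<close>. In the second half
  the bias is known for every \<open>(y, w)\<close> instead, so there it is run with the players
  exchanged and carried back.\<close>

lemma cheap_box_swap:
  assumes "cheap_box I Y X W (\<lambda>y x. \<mu> x y) (\<lambda>y x. h x y) (\<lambda>y x. P x y) (\<lambda>y x. l x y) t"
  shows "cheap_box I X Y W \<mu> h P l t"
proof -
  obtain S T c where c: "0 < c"
    and one: "(\<Sum>y\<in>Y. \<Sum>x\<in>X. \<Sum>w\<in>W. l x y w * of_bool ((y, w) \<in> S) * of_bool ((x, w) \<in> T) / c) = 1"
    and ch: "cheap I Y X W (\<lambda>y x. \<mu> x y) (\<lambda>y x. h x y) (\<lambda>y x. P x y)
      (\<lambda>y x w. l x y w * of_bool ((y, w) \<in> S) * of_bool ((x, w) \<in> T) / c) t"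
    using assms unfolding cheap_box_def by blast
  have comm: "l x y w * of_bool ((x, w) \<in> T) * of_bool ((y, w) \<in> S) / c = l x y w * of_bool ((y, w) \<in> S) * of_bool ((x, w) \<in> T) / c" for x y w
    by simp
  have "(\<Sum>x\<in>X. \<Sum>y\<in>Y. \<Sum>w\<in>W. l x y w * of_bool ((x, w) \<in> T) * of_bool ((y, w) \<in> S) / c) = 1"
    unfolding comm using one by (subst sum.swap)
  moreover have "cheap I X Y W \<mu> h P (\<lambda>x y w. l x y w * of_bool ((x, w) \<in> T) * of_bool ((y, w) \<in> S) / c) t"
    unfolding comm by (rule cheap_swap) (rule ch)
  ultimately show ?thesis unfolding cheap_box_def using c by blast
qed

definition box :: "'i set \<Rightarrow> 'j set \<Rightarrow> 'w set \<Rightarrow> ('i, 'j, 'w) weight \<Rightarrow> ('j \<times> 'w) set \<Rightarrow> ('i \<times> 'w) set \<Rightarrow> real" where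
  "box X Y W g T S = (\<Sum>x\<in>X. \<Sum>y\<in>Y. \<Sum>w\<in>W. g x y w * of_bool ((x, w) \<in> S) * of_bool ((y, w) \<in> T))"

lemma box_diff_left:
  assumes "T' \<subseteq> T"
  shows "box X Y W g T S = box X Y W g T' S + box X Y W g (T - T') S"
  unfolding box_def sum.distrib[symmetric]
proof (intro sum.cong refl)
  fix x y w
  have "of_bool ((y, w) \<in> T) = (of_bool ((y, w) \<in> T') + of_bool ((y, w) \<in> T - T') :: real)"
    using assms by (cases "(y, w) \<in> T'") auto
  then show "g x y w * of_bool ((x, w) \<in> S) * of_bool ((y, w) \<in> T) =
      g x y w * of_bool ((x, w) \<in> S) * of_bool ((y, w) \<in> T') + g x y w * of_bool ((x, w) \<in> S) * of_bool ((y, w) \<in> T - T')"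
    by (simp only: distrib_left)
qed

lemma box_diff_right:
  assumes "S' \<subseteq> S"
  shows "box X Y W g T S = box X Y W g T S' + box X Y W g T (S - S')"
  unfolding box_def sum.distrib[symmetric]
proof (intro sum.cong refl)
  fix x y w
  have "of_bool ((x, w) \<in> S) = (of_bool ((x, w) \<in> S') + of_bool ((x, w) \<in> S - S') :: real)"
    using assms by (cases "(x, w) \<in> S'") auto
  then show "g x y w * of_bool ((x, w) \<in> S) * of_bool ((y, w) \<in> T) =
      g x y w * of_bool ((x, w) \<in> S') * of_bool ((y, w) \<in> T) + g x y w * of_bool ((x, w) \<in> S - S') * of_bool ((y, w) \<in> T)"
    by (simp only: distrib_left distrib_right)
qed

lemma box_nonneg: "(\<And>x y w. 0 \<le> g x y w) \<Longrightarrow> 0 \<le> box X Y W g T S"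
  unfolding box_def by (intro sum_nonneg) auto

lemma box_mono:
  assumes "\<And>x y w. g x y w \<le> g' x y w"
  shows "box X Y W g T S \<le> box X Y W g' T S"
  unfolding box_def by (intro sum_mono mult_right_mono assms) auto

lemma box_restrict:
  "box X Y W g (T \<inter> UNIV \<times> B) (S \<inter> UNIV \<times> B) = box X Y W (\<lambda>x y w. g x y w * of_bool (w \<in> B)) T S"
  unfolding box_def by (intro sum.cong refl) (auto simp: of_bool_def)

lemma box_single_left:
  assumes "finite Y" "finite W" "y \<in> Y" "w \<in> W"
  shows "box X Y W g {(y, w)} S = (\<Sum>x\<in>X. g x y w * of_bool ((x, w) \<in> S))"
proof -
  have "box X Y W g {(y, w)} S =
      (\<Sum>x\<in>X. \<Sum>y'\<in>Y. \<Sum>w'\<in>W. if w' = w then (if y' = y then g x y w * of_bool ((x, w) \<in> S) else 0) else 0)"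
    unfolding box_def by (intro sum.cong refl) auto
  then show ?thesis using assms by (simp add: sum.delta)
qed

lemma box_single_right:
  assumes "finite X" "finite W" "x \<in> X" "w \<in> W"
  shows "box X Y W g T {(x, w)} = (\<Sum>y\<in>Y. g x y w * of_bool ((y, w) \<in> T))"
proof -
  have "box X Y W g T {(x, w)} =
      (\<Sum>x'\<in>X. \<Sum>y\<in>Y. \<Sum>w'\<in>W. if w' = w then (if x' = x then g x y w * of_bool ((y, w) \<in> T) else 0) else 0)"
    unfolding box_def by (intro sum.cong refl) auto
  also have "\<dots> = (\<Sum>x'\<in>X. if x' = x then (\<Sum>y\<in>Y. g x y w * of_bool ((y, w) \<in> T)) else 0)"
    using assms by (intro sum.cong refl) (auto simp: sum.delta)
  finally show ?thesis using assms by (simp add: sum.delta)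
qed

lemma box_mono_sets:
  assumes "\<And>x y w. 0 \<le> g x y w" "T \<subseteq> T'" "S \<subseteq> S'"
  shows "box X Y W g T S \<le> box X Y W g T' S'"
  unfolding box_def
proof (intro sum_mono)
  fix x y w
  have "of_bool ((x, w) \<in> S) \<le> (of_bool ((x, w) \<in> S') :: real)"
    "of_bool ((y, w) \<in> T) \<le> (of_bool ((y, w) \<in> T') :: real)"
    using assms(2,3) by auto
  then show "g x y w * of_bool ((x, w) \<in> S) * of_bool ((y, w) \<in> T) \<le> g x y w * of_bool ((x, w) \<in> S') * of_bool ((y, w) \<in> T')"
    by (intro mult_mono assms(1)) (simp_all add: assms(1))
qed

section \<open>Extracting a cheap box\<close>

lemma box_w: "box X Y W g T S =
  (\<Sum>w\<in>W. \<Sum>x\<in>X. \<Sum>y\<in>Y. g x y w * of_bool ((x, w) \<in> S) * of_bool ((y, w) \<in> T))"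
proof -
  have "box X Y W g T S =
    (\<Sum>x\<in>X. \<Sum>w\<in>W. \<Sum>y\<in>Y. g x y w * of_bool ((x, w) \<in> S) * of_bool ((y, w) \<in> T))"
    unfolding box_def by (intro sum.cong refl sum.swap)
  also have "\<dots> = (\<Sum>w\<in>W. \<Sum>x\<in>X. \<Sum>y\<in>Y. g x y w * of_bool ((x, w) \<in> S) * of_bool ((y, w) \<in> T))"
    by (rule sum.swap)
  finally show ?thesis .
qed

text \<open>Applied with \<open>b\<close> a full row or column sum and \<open>c\<close> its part
  inside a box: if a fraction \<open>e\<close> survives, the conditional probability grows by a
  factor of at most \<open>1 / e\<close>.\<close>

lemma log_ratio_le:
  fixes a b c d e :: real
  assumes "0 < a" "0 < b" "0 < e" "0 < d" "e * b \<le> c"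
  shows "log 2 (a / c / d) \<le> log 2 (a / b / d) + log 2 (1 / e)"
proof -
  have eb: "0 < e * b" using assms(2,3) by simp
  have c: "0 < c" by (rule less_le_trans[OF eb assms(5)])
  have "log 2 (e * b) \<le> log 2 c" using eb c assms(5) by (subst log_le_cancel_iff) simp_all
  then show ?thesis using assms c by (simp add: log_divide log_mult)
qed

text \<open>
  Among the sub-boxes of \<open>D\<close> take one maximizing signed mass divided by mass to the power \<open>3/4\<close>; no
  part of it of relative mass \<open>1/16\<close> then carries more than \<open>1/8\<close> of its signed mass, so rows and
  columns of small relative mass, and afterwards the labels \<open>w\<close> of small bias, can be discarded.
\<close>

lemma exists_cheap_box:
  fixes lam :: "'i \<Rightarrow> 'j \<Rightarrow> 'w \<Rightarrow> real"
  assumes adm: "admissible X Y W \<mu> P lam" and I: "1 \<le> I"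
    and D: "D \<subseteq> X \<times> W" and sgn: "\<sigma> = 1 \<or> \<sigma> = -1" and beta: "0 < \<beta>"
    and H: "\<And>x w. (x, w) \<in> D \<Longrightarrow>
      \<beta> * (\<Sum>y\<in>Y. lam x y w) \<le> \<sigma> * (\<Sum>y\<in>Y. lam x y w * sg (h x y))"
    and tau: "\<tau> = (\<Sum>x\<in>X. \<Sum>w\<in>W. of_bool ((x, w) \<in> D) * (\<Sum>y\<in>Y. lam x y w))" "0 < \<tau>"
    and v: "\<And>x y w. (x, w) \<in> D \<Longrightarrow> y \<in> Y \<Longrightarrow> 0 < lam x y w \<Longrightarrow> info_cost I X Y \<mu> P lam x y w \<le> v"
  shows "cheap_box I X Y W \<mu> h P lam (v + 180 * I * log 2 (1 / \<beta>) + 45 * I * log 2 (1 / \<tau>) + 372 * I)"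
proof -
  note fin = admissibleD(1-3)[OF adm] and lam = admissibleD(4)[OF adm] and total = admissibleD(5)[OF adm]
    and mu = admissibleD(6)[OF adm] and mu_pos = admissibleD(7)[OF adm] and P = admissibleD(8)[OF adm]
  define mass where "mass = box X Y W lam"
  define sig where "sig = box X Y W (\<lambda>x y w. lam x y w * (\<sigma> * sg (h x y)))"
  have ssg: "\<sigma> * sg b \<le> 1" for b using sgn by (auto simp: sg_def)
  have mass_nn: "0 \<le> mass T S" for T S unfolding mass_def by (rule box_nonneg[OF lam])
  have mass_mono: "mass T S \<le> mass T' S'" if "T \<subseteq> T'" "S \<subseteq> S'" for T S T' S'
    unfolding mass_def using that by (intro box_mono_sets lam)
  have sig_le: "sig T S \<le> mass T S" for T S
    unfolding sig_def mass_def using lam ssg by (intro box_mono mult_left_le) auto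
  have mass_le1: "mass T S \<le> 1" for T S
  proof -
    have "mass T S \<le> mass UNIV UNIV" by (rule mass_mono) auto
    also have "\<dots> = 1" unfolding mass_def box_def using total by simp
    finally show ?thesis .
  qed
  have mass0: "mass (Y \<times> W) D = \<tau>"
    unfolding mass_def box_def tau(1)
  proof (intro sum.cong refl)
    fix x assume "x \<in> X"
    have "(\<Sum>y\<in>Y. \<Sum>w\<in>W. lam x y w * of_bool ((x, w) \<in> D) * of_bool ((y, w) \<in> Y \<times> W)) =
       (\<Sum>y\<in>Y. \<Sum>w\<in>W. of_bool ((x, w) \<in> D) * lam x y w)"
      by (intro sum.cong refl) auto
    also have "\<dots> = (\<Sum>w\<in>W. \<Sum>y\<in>Y. of_bool ((x, w) \<in> D) * lam x y w)" by (rule sum.swap)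
    finally show "(\<Sum>y\<in>Y. \<Sum>w\<in>W. lam x y w * of_bool ((x, w) \<in> D) * of_bool ((y, w) \<in> Y \<times> W)) =
       (\<Sum>w\<in>W. of_bool ((x, w) \<in> D) * (\<Sum>y\<in>Y. lam x y w))" by (simp add: sum_distrib_left)
  qed
  have sig0: "\<beta> * \<tau> \<le> sig (Y \<times> W) D"
  proof -
    have "sig (Y \<times> W) D = (\<Sum>x\<in>X. \<Sum>w\<in>W. of_bool ((x, w) \<in> D) * (\<sigma> * (\<Sum>y\<in>Y. lam x y w * sg (h x y))))"
      unfolding sig_def box_def
    proof (intro sum.cong refl)
      fix x assume "x \<in> X"
      have "(\<Sum>y\<in>Y. \<Sum>w\<in>W. lam x y w * (\<sigma> * sg (h x y)) * of_bool ((x, w) \<in> D) * of_bool ((y, w) \<in> Y \<times> W)) =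
         (\<Sum>y\<in>Y. \<Sum>w\<in>W. of_bool ((x, w) \<in> D) * (\<sigma> * (lam x y w * sg (h x y))))"
        by (intro sum.cong refl) auto
      also have "\<dots> = (\<Sum>w\<in>W. \<Sum>y\<in>Y. of_bool ((x, w) \<in> D) * (\<sigma> * (lam x y w * sg (h x y))))" by (rule sum.swap)
      finally show "(\<Sum>y\<in>Y. \<Sum>w\<in>W. lam x y w * (\<sigma> * sg (h x y)) * of_bool ((x, w) \<in> D) * of_bool ((y, w) \<in> Y \<times> W)) =
         (\<Sum>w\<in>W. of_bool ((x, w) \<in> D) * (\<sigma> * (\<Sum>y\<in>Y. lam x y w * sg (h x y))))" by (simp add: sum_distrib_left)
    qed
    moreover have "(\<Sum>x\<in>X. \<Sum>w\<in>W. of_bool ((x, w) \<in> D) * (\<beta> * (\<Sum>y\<in>Y. lam x y w)))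
        \<le> (\<Sum>x\<in>X. \<Sum>w\<in>W. of_bool ((x, w) \<in> D) * (\<sigma> * (\<Sum>y\<in>Y. lam x y w * sg (h x y))))"
      using H by (intro sum_mono) (auto simp: of_bool_def)
    moreover have "\<beta> * \<tau> = (\<Sum>x\<in>X. \<Sum>w\<in>W. of_bool ((x, w) \<in> D) * (\<beta> * (\<Sum>y\<in>Y. lam x y w)))"
      unfolding tau(1) by (simp add: sum_distrib_left mult.left_commute)
    ultimately show ?thesis by simp
  qed

  \<comment> \<open>Signed mass maximized against a power of the mass\<close>
  define Fam where "Fam = {(T, S). T \<subseteq> Y \<times> W \<and> S \<subseteq> D \<and> 0 < mass T S}"
  have finD: "finite D" using D fin by (meson finite_SigmaI finite_subset)
  have "Fam \<subseteq> Pow (Y \<times> W) \<times> Pow D" unfolding Fam_def by auto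
  then have "finite Fam" using fin finD by (meson finite_Pow_iff finite_SigmaI finite_subset)
  moreover have "(Y \<times> W, D) \<in> Fam" unfolding Fam_def using mass0 tau(2) by auto
  ultimately obtain z where z: "z \<in> Fam"
    "\<And>z'. z' \<in> Fam \<Longrightarrow> (case z' of (T, S) \<Rightarrow> sig T S / mass T S powr (3/4)) \<le> (case z of (T, S) \<Rightarrow> sig T S / mass T S powr (3/4))"
    using finite_argmax[of Fam "\<lambda>(T, S). sig T S / mass T S powr (3/4)"] by blast
  obtain Ts Ss where zz: "z = (Ts, Ss)" by force
  define sm where "sm = sig Ts Ss"
  define tm where "tm = mass Ts Ss"
  have Ts: "Ts \<subseteq> Y \<times> W" "Ss \<subseteq> D" "0 < tm" using z(1) unfolding zz Fam_def tm_def by auto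
  have tm1: "tm \<le> 1" unfolding tm_def by (rule mass_le1)
  have zmax: "sig T S / mass T S powr (3/4) \<le> sm / tm powr (3/4)" if "(T, S) \<in> Fam" for T S
    using z(2)[OF that] unfolding zz sm_def tm_def by simp
  \<comment> \<open>The whole of \<open>D\<close> is one of the competitors, with mass
    \<open>\<tau>\<close> and signed mass at least \<open>\<beta> * \<tau>\<close>.\<close>
  have base: "\<beta> * \<tau> powr (1/4) \<le> sm / tm powr (3/4)"
  proof -
    have "\<beta> * \<tau> powr (1/4) = \<beta> * \<tau> / \<tau> powr (3/4)"
      using tau(2) by (simp add: field_simps powr_add[symmetric])
    also have "\<dots> \<le> sig (Y \<times> W) D / mass (Y \<times> W) D powr (3/4)"
      unfolding mass0 using sig0 by (intro divide_right_mono) auto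
    also have "\<dots> \<le> sm / tm powr (3/4)" by (rule zmax) fact
    finally show ?thesis .
  qed
  have "0 < \<beta> * \<tau> powr (1/4)" using beta tau(2) by simp
  then have "0 < sm / tm powr (3/4)" using base by linarith
  then have sm: "0 < sm" using Ts(3) by (simp add: zero_less_divide_iff)
  have maxp: "sig T S \<le> sm * (mass T S / tm) powr (3/4)" if "T \<subseteq> Ts" "S \<subseteq> Ss" for T S
  proof (cases "mass T S = 0")
    case True then show ?thesis using sig_le[of T S] by simp
  next
    case False
    then have m: "0 < mass T S" using mass_nn[of T S] by linarith
    then have "(T, S) \<in> Fam" unfolding Fam_def using that Ts by auto
    from zmax[OF this] have "sig T S \<le> sm / tm powr (3/4) * mass T S powr (3/4)"
      using m by (simp add: divide_le_eq)
    then show ?thesis using m Ts(3) by (simp add: powr_divide)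
  qed

  \<comment> \<open>Pruning rows and columns\<close>
  define \<eta> where "\<eta> = tm / 32"
  have eta: "0 < \<eta>" unfolding \<eta>_def using Ts by simp
  \<comment> \<open>Each chosen row and column is charged \<open>\<eta>\<close> times its full mass.
    At a maximum no single removal raises \<open>F\<close>, so every row and column that remains
    keeps at least an \<open>\<eta>\<close> fraction of its full mass inside the box.\<close>
  define F where "F = (\<lambda>(T, S). mass T S - \<eta> * (mass T UNIV + mass UNIV S))"
  have finTs: "finite Ts" "finite Ss" using Ts fin finD by (meson finite_SigmaI finite_subset)+
  have "\<exists>z\<in>Pow Ts \<times> Pow Ss. \<forall>z'\<in>Pow Ts \<times> Pow Ss. F z' \<le> F z"
    using finTs by (intro finite_argmax) auto
  then obtain T1 S1 where T1: "T1 \<subseteq> Ts" "S1 \<subseteq> Ss" and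
    F1: "\<And>T S. T \<subseteq> Ts \<Longrightarrow> S \<subseteq> Ss \<Longrightarrow> F (T, S) \<le> F (T1, S1)" by fastforce
  \<comment> \<open>The charge for \<open>(Ts, Ss)\<close> is at most
    \<open>2 * \<eta> = tm / 16\<close>, so the pruning removes no more mass than that.\<close>
  have m1: "tm - 2 * \<eta> \<le> mass T1 S1"
  proof -
    have "\<eta> * (mass Ts UNIV + mass UNIV Ss) \<le> \<eta> * 2"
      using mass_le1[of Ts UNIV] mass_le1[of UNIV Ss] eta by (intro mult_left_mono) auto
    then have "tm - 2 * \<eta> \<le> F (Ts, Ss)" unfolding F_def tm_def by simp
    also have "\<dots> \<le> F (T1, S1)" by (rule F1) auto
    also have "\<dots> \<le> mass T1 S1" unfolding F_def using eta mass_nn[of T1 UNIV] mass_nn[of UNIV S1] by simp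
    finally show ?thesis .
  qed
  have degT: "\<eta> * (\<Sum>x\<in>X. lam x y w) \<le> (\<Sum>x\<in>X. lam x y w * of_bool ((x, w) \<in> S1))"
    if "(y, w) \<in> T1" for y w
  proof -
    have yw: "y \<in> Y" "w \<in> W" using that T1 Ts by auto
    have "F (T1 - {(y, w)}, S1) \<le> F (T1, S1)" using T1 by (intro F1) auto
    moreover have "T1 - (T1 - {(y, w)}) = {(y, w)}" using that by auto
    then have "mass T1 S1 = mass (T1 - {(y, w)}) S1 + mass {(y, w)} S1"
      "mass T1 UNIV = mass (T1 - {(y, w)}) UNIV + mass {(y, w)} UNIV"
      unfolding mass_def using box_diff_left[of "T1 - {(y, w)}" T1 X Y W lam] by auto
    ultimately have "\<eta> * mass {(y, w)} UNIV \<le> mass {(y, w)} S1"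
      unfolding F_def by (simp add: algebra_simps)
    then show ?thesis unfolding mass_def by (simp add: box_single_left[OF fin(2,3) yw])
  qed
  have degS: "\<eta> * (\<Sum>y\<in>Y. lam x y w) \<le> (\<Sum>y\<in>Y. lam x y w * of_bool ((y, w) \<in> T1))"
    if "(x, w) \<in> S1" for x w
  proof -
    have xw: "x \<in> X" "w \<in> W" using that T1 Ts D by auto
    have "F (T1, S1 - {(x, w)}) \<le> F (T1, S1)" using T1 by (intro F1) auto
    moreover have "S1 - (S1 - {(x, w)}) = {(x, w)}" using that by auto
    then have "mass T1 S1 = mass T1 (S1 - {(x, w)}) + mass T1 {(x, w)}"
      "mass UNIV S1 = mass UNIV (S1 - {(x, w)}) + mass UNIV {(x, w)}"
      unfolding mass_def using box_diff_right[of "S1 - {(x, w)}" S1 X Y W lam] by auto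
    ultimately have "\<eta> * mass UNIV {(x, w)} \<le> mass T1 {(x, w)}"
      unfolding F_def by (simp add: algebra_simps)
    then show ?thesis unfolding mass_def by (simp add: box_single_right[OF fin(1,3) xw])
  qed
  have p16: "(1/16::real) powr (3/4) = 1/8"
  proof -
    have "(1/16::real) powr (3/4) = (2 powr (-4)) powr (3/4)" by (simp add: powr_minus)
    also have "\<dots> = 2 powr (-3)" by (subst powr_powr) simp
    also have "\<dots> = 1/8" by (simp add: powr_minus)
    finally show ?thesis .
  qed
  have small: "sig T S \<le> sm / 8" if "T \<subseteq> Ts" "S \<subseteq> Ss" "mass T S \<le> 2 * \<eta>" for T S
  proof -
    have "mass T S / tm \<le> 1/16" using that(3) Ts(3) unfolding \<eta>_def by (simp add: divide_le_eq)
    then have "(mass T S / tm) powr (3/4) \<le> (1/16) powr (3/4)"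
      using mass_nn[of T S] Ts(3) by (intro powr_mono2) auto
    then have "sm * (mass T S / tm) powr (3/4) \<le> sm * (1/8)" using sm p16 by (intro mult_left_mono) auto
    then show ?thesis using maxp[OF that(1,2)] by simp
  qed
  \<comment> \<open>The removed part is the union of two boxes, each of mass at most
    \<open>2 * \<eta>\<close> and hence of signed mass at most \<open>sm / 8\<close>.\<close>
  have sig1: "3/4 * sm \<le> sig T1 S1"
  proof -
    have "tm = mass T1 S1 + mass T1 (Ss - S1) + mass (Ts - T1) Ss"
      unfolding tm_def mass_def using box_diff_left[OF T1(1)] box_diff_right[OF T1(2)] by metis
    then have a: "mass T1 (Ss - S1) \<le> 2 * \<eta>" "mass (Ts - T1) Ss \<le> 2 * \<eta>"
      using m1 mass_nn[of T1 "Ss - S1"] mass_nn[of "Ts - T1" Ss] by linarith+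
    have "sm = sig T1 S1 + sig T1 (Ss - S1) + sig (Ts - T1) Ss"
      unfolding sm_def sig_def using box_diff_left[OF T1(1)] box_diff_right[OF T1(2)] by metis
    moreover have "sig T1 (Ss - S1) \<le> sm / 8" "sig (Ts - T1) Ss \<le> sm / 8"
      using T1 a by (intro small; auto)+
    ultimately show ?thesis by linarith
  qed

  \<comment> \<open>Pruning labels of small bias\<close>
  define mw where "mw w = (\<Sum>x\<in>X. \<Sum>y\<in>Y. lam x y w * of_bool ((x, w) \<in> S1) * of_bool ((y, w) \<in> T1))" for w
  define sw where "sw w = (\<Sum>x\<in>X. \<Sum>y\<in>Y. lam x y w * (\<sigma> * sg (h x y)) * of_bool ((x, w) \<in> S1) * of_bool ((y, w) \<in> T1))" for w
  \<comment> \<open>Labels whose bias lies below this threshold carry together at most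
    \<open>\<theta> * tm = sm / 4\<close> of the signed mass.\<close>
  define \<theta> where "\<theta> = sm / (4 * tm)"
  have theta: "0 < \<theta>" unfolding \<theta>_def using sm Ts by simp
  define B where "B = {w. \<theta> * mw w \<le> sw w}"
  define T2 where "T2 = T1 \<inter> UNIV \<times> B"
  define S2 where "S2 = S1 \<inter> UNIV \<times> B"
  have mw_nn: "0 \<le> mw w" for w unfolding mw_def using lam by (intro sum_nonneg) auto
  have sig2: "sm / 2 \<le> sig T2 S2"
  proof -
    have a: "sig T1 S1 = (\<Sum>w\<in>W. sw w)" unfolding sig_def box_w sw_def ..
    have b: "sig T2 S2 = (\<Sum>w\<in>W. sw w * of_bool (w \<in> B))"
      unfolding sig_def T2_def S2_def box_restrict box_w sw_def sum_distrib_right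
      by (intro sum.cong refl) (simp add: mult_ac)
    have "sw w - sw w * of_bool (w \<in> B) \<le> \<theta> * mw w" for w
      using mw_nn[of w] theta by (cases "w \<in> B") (auto simp: B_def)
    then have "(\<Sum>w\<in>W. sw w - sw w * of_bool (w \<in> B)) \<le> (\<Sum>w\<in>W. \<theta> * mw w)" by (intro sum_mono)
    also have "\<dots> = \<theta> * mass T1 S1" unfolding mass_def box_w mw_def by (simp add: sum_distrib_left)
    also have "\<dots> \<le> \<theta> * tm" unfolding tm_def using theta T1 by (intro mult_left_mono mass_mono) auto
    also have "\<dots> = sm / 4" unfolding \<theta>_def using Ts(3) by simp
    finally show ?thesis using a b sig1 by (simp add: sum_subtractf)
  qed
  define c where "c = mass T2 S2"
  \<comment> \<open>A box of relative mass below 1/4 would by maximality carry less than half of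
    \<open>sm\<close>, since 1/4 to the power 3/4 is below 1/2.\<close>
  have c: "tm / 4 \<le> c"
  proof (rule ccontr)
    assume "\<not> tm / 4 \<le> c"
    then have "c / tm \<le> 1/4" using Ts(3) by (simp add: divide_le_eq)
    then have "(c / tm) powr (3/4) \<le> (1/4) powr (3/4)"
      using mass_nn[of T2 S2] Ts(3) unfolding c_def by (intro powr_mono2) auto
    also have "(1/4::real) powr (3/4) < 1/2"
    proof -
      have "(1/4::real) powr (3/4) = (2 powr (-2)) powr (3/4)" by (simp add: powr_minus)
      also have "\<dots> = 2 powr (-3/2)" by (subst powr_powr) simp
      also have "\<dots> < 2 powr (-1)" by (intro powr_less_mono) auto
      finally show ?thesis by (simp add: powr_minus)
    qed
    finally have "sm * (c / tm) powr (3/4) < sm * (1/2)" using sm by (intro mult_strict_left_mono) auto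
    moreover have "sig T2 S2 \<le> sm * (c / tm) powr (3/4)"
      unfolding c_def using T1 by (intro maxp) (auto simp: T2_def S2_def)
    ultimately show False using sig2 by linarith
  qed
  then have c0: "0 < c" using Ts(3) by linarith

  \<comment> \<open>Cost of the normalized restriction\<close>
  let ?q = "\<lambda>x y w. lam x y w * of_bool ((x, w) \<in> S2) * of_bool ((y, w) \<in> T2) / c"
  have one: "(\<Sum>x\<in>X. \<Sum>y\<in>Y. \<Sum>w\<in>W. ?q x y w) = 1"
    using c0 unfolding sum_divide_distrib[symmetric] c_def mass_def box_def by simp
  have ch: "cheap I X Y W \<mu> h P ?q (v + 180 * I * log 2 (1 / \<beta>) + 45 * I * log 2 (1 / \<tau>) + 372 * I)"
    unfolding cheap_def
  proof (intro ballI impI)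
    fix x y w assume xyw: "x \<in> X" "y \<in> Y" "w \<in> W" and q0: "0 < ?q x y w"
    have "?q x y w \<noteq> 0" using q0 by linarith
    then have l0: "(x, w) \<in> S2" "(y, w) \<in> T2" "lam x y w \<noteq> 0" by auto
    then have l: "0 < lam x y w" "w \<in> B" "(x, w) \<in> S1" "(y, w) \<in> T1" "(x, w) \<in> D"
      using lam[of x y w] T1 Ts unfolding S2_def T2_def by auto
    \<comment> \<open>Labels are kept or removed as a whole, so on a kept label the rows and columns
      are those of \<open>S1\<close> and \<open>T1\<close>, for which \<open>degS\<close> and
      \<open>degT\<close> hold.\<close>
    have iS: "of_bool ((x', w) \<in> S2) = (of_bool ((x', w) \<in> S1) :: real)" for x' using l(2) by (simp add: S2_def)
    have iT: "of_bool ((y', w) \<in> T2) = (of_bool ((y', w) \<in> T1) :: real)" for y' using l(2) by (simp add: T2_def)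
    have qe: "?q x y w = lam x y w / c" using l0 by simp
    have mu0: "0 < \<mu> x y" using mu_pos xyw l by blast
    have muX: "0 < (\<Sum>x'\<in>X. \<mu> x' y)" "0 < (\<Sum>y'\<in>Y. \<mu> x y')"
      using mu mu0 xyw fin by (auto intro!: sum_pos2)
    have lX: "0 < (\<Sum>x'\<in>X. lam x' y w)" "0 < (\<Sum>y'\<in>Y. lam x y' w)"
      using lam l(1) xyw fin by (auto intro!: sum_pos2)
    have sX: "(\<Sum>x'\<in>X. ?q x' y w) = (\<Sum>x'\<in>X. lam x' y w * of_bool ((x', w) \<in> S1)) / c"
      using l0 unfolding sum_divide_distrib iS by simp
    have sY: "(\<Sum>y'\<in>Y. ?q x y' w) = (\<Sum>y'\<in>Y. lam x y' w * of_bool ((y', w) \<in> T1)) / c"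
      using l0 unfolding sum_divide_distrib iT by simp
    have cc: "a / c / (b / c) = a / b" for a b using c0 by simp
    have t1: "log 2 (?q x y w / (\<Sum>x'\<in>X. ?q x' y w) / (\<mu> x y / (\<Sum>x'\<in>X. \<mu> x' y)))
       \<le> log 2 (lam x y w / (\<Sum>x'\<in>X. lam x' y w) / (\<mu> x y / (\<Sum>x'\<in>X. \<mu> x' y))) + log 2 (1 / \<eta>)"
      unfolding sX qe cc by (rule log_ratio_le[OF l(1) lX(1) eta _ degT[OF l(4)]]) (use mu0 muX in simp)
    have t2: "log 2 (?q x y w / (\<Sum>y'\<in>Y. ?q x y' w) / (\<mu> x y / (\<Sum>y'\<in>Y. \<mu> x y')))
       \<le> log 2 (lam x y w / (\<Sum>y'\<in>Y. lam x y' w) / (\<mu> x y / (\<Sum>y'\<in>Y. \<mu> x y'))) + log 2 (1 / \<eta>)"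
      unfolding sY qe cc by (rule log_ratio_le[OF l(1) lX(2) eta _ degS[OF l(3)]]) (use mu0 muX in simp)
    have P0: "0 < P x y w" using P xyw l by blast
    have t3: "log 2 (?q x y w / P x y w) = log 2 (lam x y w / P x y w) + log 2 (1 / c)"
      unfolding qe using l(1) P0 c0 by (simp add: log_divide log_mult)
    have "info_cost I X Y \<mu> P ?q x y w \<le> info_cost I X Y \<mu> P lam x y w + 2 * log 2 (1 / \<eta>) + I * log 2 (1 / c)"
      using t1 t2 unfolding info_cost_def t3 by (simp add: distrib_left)
    then have k1: "info_cost I X Y \<mu> P ?q x y w \<le> v + 2 * log 2 (1 / \<eta>) + I * log 2 (1 / c)"
      using v[OF l(5) xyw(2) l(1)] by linarith
    have mwpos: "0 < mw w"
    proof -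
      have "0 < lam x y w * of_bool ((x, w) \<in> S1) * of_bool ((y, w) \<in> T1)" using l by simp
      also have "\<dots> \<le> (\<Sum>y\<in>Y. lam x y w * of_bool ((x, w) \<in> S1) * of_bool ((y, w) \<in> T1))"
        using lam xyw fin by (intro member_le_sum) auto
      also have "\<dots> \<le> mw w" unfolding mw_def
        using lam xyw fin by (intro member_le_sum[of x]) (auto intro!: sum_nonneg)
      finally show ?thesis .
    qed
    have bias: "\<theta> \<le> bias X Y h ?q w"
    proof -
      have a: "(\<Sum>x\<in>X. \<Sum>y\<in>Y. ?q x y w) = mw w / c"
        unfolding mw_def iS iT sum_divide_distrib ..
      have "sw w = \<sigma> * (\<Sum>x\<in>X. \<Sum>y\<in>Y. lam x y w * sg (h x y) * of_bool ((x, w) \<in> S1) * of_bool ((y, w) \<in> T1))"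
        unfolding sw_def sum_distrib_left by (intro sum.cong refl) (simp add: mult_ac)
      moreover have "(\<Sum>x\<in>X. \<Sum>y\<in>Y. lam x y w * sg (h x y) * of_bool ((x, w) \<in> S1) * of_bool ((y, w) \<in> T1))
         = c * (\<Sum>x\<in>X. \<Sum>y\<in>Y. ?q x y w * sg (h x y))"
        unfolding sum_distrib_left iS iT using c0 by (intro sum.cong refl) (simp add: mult_ac)
      ultimately have "sw w \<le> \<bar>c * (\<Sum>x\<in>X. \<Sum>y\<in>Y. ?q x y w * sg (h x y))\<bar>" using sgn by auto
      then have "\<theta> * mw w \<le> c * \<bar>\<Sum>x\<in>X. \<Sum>y\<in>Y. ?q x y w * sg (h x y)\<bar>"
        using l(2) c0 unfolding B_def by (simp add: abs_mult)
      then show ?thesis unfolding bias_def a using mwpos c0 by (simp add: field_simps)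
    qed
    \<comment> \<open>\<open>\<theta>\<close> is at least
      \<open>\<beta> * \<tau> powr (1/4) * tm powr (-1/4) / 4\<close>; the negative power of
      \<open>tm\<close> is what the exponent 3/4 was chosen for.\<close>
    have lt: "log 2 \<beta> + 1/4 * log 2 \<tau> - 1/4 * log 2 tm - 2 \<le> log 2 (bias X Y h ?q w)"
    proof -
      have "\<beta> * \<tau> powr (1/4) * tm powr (3/4) \<le> sm" using base Ts(3) by (simp add: pos_le_divide_eq)
      then have "\<beta> * \<tau> powr (1/4) * tm powr (3/4) / (4 * tm) \<le> \<theta>"
        unfolding \<theta>_def using Ts(3) by (intro divide_right_mono) auto
      then have "log 2 (\<beta> * \<tau> powr (1/4) * tm powr (3/4) / (4 * tm)) \<le> log 2 (bias X Y h ?q w)"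
        using bias theta beta tau(2) Ts(3) by (subst log_le_cancel_iff) auto
      moreover have "log 2 (4::real) = 2" using log_pow_cancel[of "2::real" 2] by simp
      ultimately show ?thesis using beta tau(2) Ts(3)
        by (simp add: log_divide log_mult log_powr)
    qed
    define L where "L = log 2 tm"
    have L0: "L \<le> 0" unfolding L_def using tm1 Ts(3) by simp
    have "log 2 (1 / \<eta>) = 5 - L"
      unfolding \<eta>_def L_def using Ts(3) log_pow_cancel[of "2::real" 5] by (simp add: log_divide)
    moreover have "I * log 2 (1 / c) \<le> I * (2 - L)"
    proof (intro mult_left_mono)
      have "log 2 (tm / 4) \<le> log 2 c" using c Ts(3) c0 by simp
      moreover have "log 2 (4::real) = 2" using log_pow_cancel[of "2::real" 2] by simp
      ultimately show "log 2 (1 / c) \<le> 2 - L"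
        using Ts(3) c0 unfolding L_def by (simp add: log_divide)
    qed (use I in auto)
    moreover have "180 * I * (log 2 \<beta> + 1/4 * log 2 \<tau> - 1/4 * L - 2) \<le> 180 * I * log 2 (bias X Y h ?q w)"
      using lt I unfolding L_def by (intro mult_left_mono) auto
    \<comment> \<open>Here \<open>L = log 2 tm\<close> is at most 0. The bias contributes
      \<open>180 / 4 = 45\<close> times \<open>I * L\<close>, against \<open>- I * L\<close> from
      the normalization and \<open>- 2 * L\<close> from the two conditionals. The remaining 10,
      \<open>2 * I\<close> and \<open>360 * I\<close> add up to at most
      \<open>372 * I\<close>.\<close>
    moreover have "45 * (I * L) - I * L - 2 * L \<le> 0"
    proof -
      have "1 * (- L) \<le> I * (- L)" using I L0 by (intro mult_right_mono) auto
      then have "I * L \<le> L" by simp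
      then show ?thesis using L0 by linarith
    qed
    ultimately have "info_cost I X Y \<mu> P ?q x y w - 180 * I * log 2 (bias X Y h ?q w)
       \<le> v + 180 * I * log 2 (1 / \<beta>) + 45 * I * log 2 (1 / \<tau>) + 372 * I"
      using k1 I beta tau(2) by (simp add: log_divide algebra_simps)
    moreover have "0 < bias X Y h ?q w" using bias theta by linarith
    ultimately show "0 < P x y w \<and> 0 < bias X Y h ?q w \<and>
       info_cost I X Y \<mu> P ?q x y w - 180 * I * log 2 (bias X Y h ?q w)
       \<le> v + 180 * I * log 2 (1 / \<beta>) + 45 * I * log 2 (1 / \<tau>) + 372 * I" using P0 by blast
  qed
  show ?thesis unfolding cheap_box_def by (intro exI[of _ T2] exI[of _ S2] exI[of _ c] conjI c0 one ch)
qed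

section \<open>Lower tail of the cost\<close>

lemma powr_lt_of_log: "0 < a \<Longrightarrow> log 2 a < s \<Longrightarrow> a < 2 powr s"
  by (simp add: log_less_iff)

text \<open>The cost adds up the logarithms of three densities of \<open>lam\<close>, with respect
  to its marginal on \<open>(y, w)\<close> times the prior of \<open>x\<close> given
  \<open>y\<close>, its marginal on \<open>(x, w)\<close> times the prior of \<open>y\<close> given
  \<open>x\<close>, and \<open>P\<close>. Each reference has mass at most 1, so the set where its
  density is below a number has at most that mass; a total below \<open>- s\<close> forces one of
  the three terms below \<open>- s / 3\<close>.\<close>

lemma cost_lower_tail:
  fixes lam :: "'i \<Rightarrow> 'j \<Rightarrow> 'w \<Rightarrow> real"
  assumes adm: "admissible X Y W \<mu> P lam" and I: "1 \<le> I" and s: "0 \<le> s"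
  shows "(\<Sum>x\<in>X. \<Sum>y\<in>Y. \<Sum>w\<in>W. lam x y w * of_bool (0 < lam x y w \<and> info_cost I X Y \<mu> P lam x y w < - s))
     \<le> 3 * 2 powr (- s / (3 * I))"
proof -
  note fin = admissibleD(1-3)[OF adm] and lam = admissibleD(4)[OF adm] and total = admissibleD(5)[OF adm]
    and mu = admissibleD(6)[OF adm] and mu_pos = admissibleD(7)[OF adm] and P = admissibleD(8)[OF adm]
    and Pnn = admissibleD(9)[OF adm] and Ptotal = admissibleD(10)[OF adm]
  define e where "e = 2 powr (- s / (3 * I))"
  have e0: "0 < e" by (simp add: e_def)
  have s3: "2 powr (- s / 3) \<le> e"
  proof -
    have "s / (3 * I) \<le> s / 3" using s I by (intro divide_left_mono) auto
    then show ?thesis unfolding e_def by (intro powr_mono) auto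
  qed
  define LX where "LX y w = (\<Sum>x\<in>X. lam x y w)" for y w
  define LY where "LY x w = (\<Sum>y\<in>Y. lam x y w)" for x w
  define MX where "MX y = (\<Sum>x\<in>X. \<mu> x y)" for y
  define MY where "MY x = (\<Sum>y\<in>Y. \<mu> x y)" for x
  have nn: "0 \<le> LX y w" "0 \<le> LY x w" "0 \<le> MX y" "0 \<le> MY x" for x y w
    unfolding LX_def LY_def MX_def MY_def using lam mu by (auto intro!: sum_nonneg)
  have pt: "lam x y w * of_bool (0 < lam x y w \<and> info_cost I X Y \<mu> P lam x y w < - s)
      \<le> e * (LX y w * (\<mu> x y / MX y) + LY x w * (\<mu> x y / MY x) + P x y w)"
    if xyw: "x \<in> X" "y \<in> Y" "w \<in> W" for x y w
  proof (cases "0 < lam x y w \<and> info_cost I X Y \<mu> P lam x y w < - s")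
    case False
    then show ?thesis using e0 nn mu Pnn[OF xyw] by (auto intro!: mult_nonneg_nonneg add_nonneg_nonneg)
  next
    case True
    have m0: "0 < \<mu> x y" "0 < P x y w" using mu_pos P xyw True by blast+
    have M0: "0 < MX y" "0 < MY x" "0 < LX y w" "0 < LY x w"
      unfolding MX_def MY_def LX_def LY_def using mu lam m0 xyw fin True by (auto intro!: sum_pos2)
    define a where "a = lam x y w / LX y w / (\<mu> x y / MX y)"
    define b where "b = lam x y w / LY x w / (\<mu> x y / MY x)"
    define c where "c = lam x y w / P x y w"
    have abc: "0 < a" "0 < b" "0 < c" unfolding a_def b_def c_def using m0 M0 True by auto
    have "log 2 a + log 2 b + I * log 2 c < - s"
      using True unfolding info_cost_def a_def b_def c_def LX_def LY_def MX_def MY_def by auto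
    then consider "log 2 a < - s / 3" | "log 2 b < - s / 3" | "I * log 2 c < - s / 3" by linarith
    then have "a < e \<or> b < e \<or> c < e"
    proof cases
      case 1 then show ?thesis using powr_lt_of_log[OF abc(1)] s3 by force
    next
      case 2 then show ?thesis using powr_lt_of_log[OF abc(2)] s3 by force
    next
      case 3
      then have "log 2 c < - s / (3 * I)" using I by (simp add: field_simps)
      then show ?thesis using powr_lt_of_log[OF abc(3)] by (simp add: e_def)
    qed
    then have "lam x y w \<le> e * (LX y w * (\<mu> x y / MX y)) \<or> lam x y w \<le> e * (LY x w * (\<mu> x y / MY x)) \<or>
        lam x y w \<le> e * P x y w"
      unfolding a_def b_def c_def using m0 M0 by (auto simp: field_simps)
    moreover have "0 \<le> e * (LX y w * (\<mu> x y / MX y))" "0 \<le> e * (LY x w * (\<mu> x y / MY x))" "0 \<le> e * P x y w"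
      using e0 m0 M0 by auto
    ultimately show ?thesis using True by (simp add: distrib_left) linarith
  qed
  have muX: "(\<Sum>x\<in>X. \<mu> x y / MX y) \<le> 1" for y unfolding sum_divide_distrib[symmetric] MX_def[symmetric] by simp
  have muY: "(\<Sum>y\<in>Y. \<mu> x y / MY x) \<le> 1" for x unfolding sum_divide_distrib[symmetric] MY_def[symmetric] by simp
  have a: "(\<Sum>x\<in>X. \<Sum>y\<in>Y. \<Sum>w\<in>W. LX y w * (\<mu> x y / MX y)) \<le> 1"
  proof -
    have "(\<Sum>x\<in>X. \<Sum>y\<in>Y. \<Sum>w\<in>W. LX y w * (\<mu> x y / MX y)) = (\<Sum>y\<in>Y. \<Sum>x\<in>X. (\<Sum>w\<in>W. LX y w) * (\<mu> x y / MX y))"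
      unfolding sum_distrib_right by (rule sum.swap)
    also have "\<dots> = (\<Sum>y\<in>Y. (\<Sum>w\<in>W. LX y w) * (\<Sum>x\<in>X. \<mu> x y / MX y))" by (simp add: sum_distrib_left)
    also have "\<dots> \<le> (\<Sum>y\<in>Y. \<Sum>w\<in>W. LX y w)"
      using nn muX by (intro sum_mono mult_left_le sum_nonneg) auto
    also have "\<dots> = (\<Sum>y\<in>Y. \<Sum>x\<in>X. \<Sum>w\<in>W. lam x y w)" unfolding LX_def by (intro sum.cong refl sum.swap)
    also have "\<dots> = (\<Sum>x\<in>X. \<Sum>y\<in>Y. \<Sum>w\<in>W. lam x y w)" by (rule sum.swap)
    finally show ?thesis using total by linarith
  qed
  have b: "(\<Sum>x\<in>X. \<Sum>y\<in>Y. \<Sum>w\<in>W. LY x w * (\<mu> x y / MY x)) \<le> 1"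
  proof -
    have "(\<Sum>x\<in>X. \<Sum>y\<in>Y. \<Sum>w\<in>W. LY x w * (\<mu> x y / MY x)) = (\<Sum>x\<in>X. (\<Sum>w\<in>W. LY x w) * (\<Sum>y\<in>Y. \<mu> x y / MY x))"
      by (simp add: sum_product) (intro sum.cong refl sum.swap)
    also have "\<dots> \<le> (\<Sum>x\<in>X. \<Sum>w\<in>W. LY x w)"
      using nn muY by (intro sum_mono mult_left_le sum_nonneg) auto
    also have "\<dots> = (\<Sum>x\<in>X. \<Sum>y\<in>Y. \<Sum>w\<in>W. lam x y w)" unfolding LY_def by (intro sum.cong refl sum.swap)
    finally show ?thesis using total by linarith
  qed
  have "(\<Sum>x\<in>X. \<Sum>y\<in>Y. \<Sum>w\<in>W. lam x y w * of_bool (0 < lam x y w \<and> info_cost I X Y \<mu> P lam x y w < - s))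
     \<le> (\<Sum>x\<in>X. \<Sum>y\<in>Y. \<Sum>w\<in>W. e * (LX y w * (\<mu> x y / MX y) + LY x w * (\<mu> x y / MY x) + P x y w))"
    using pt by (intro sum_mono) auto
  also have "\<dots> = e * ((\<Sum>x\<in>X. \<Sum>y\<in>Y. \<Sum>w\<in>W. LX y w * (\<mu> x y / MX y)) +
       (\<Sum>x\<in>X. \<Sum>y\<in>Y. \<Sum>w\<in>W. LY x w * (\<mu> x y / MY x)) + (\<Sum>x\<in>X. \<Sum>y\<in>Y. \<Sum>w\<in>W. P x y w))"
    by (simp only: sum_distrib_left[symmetric] sum.distrib)
  also have "\<dots> \<le> e * 3" using a b Ptotal e0 by (intro mult_left_mono) auto
  finally show ?thesis unfolding e_def by simp
qed

text \<open>Where the upper bound \<open>v\<close> over all \<open>y\<close> lies below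
  \<open>- s\<close>, the whole row \<open>(x, w)\<close> belongs to the tail.\<close>

lemma cost_lower_tail_bound:
  assumes adm: "admissible X Y W \<mu> P l" and I: "1 \<le> I" and s: "0 \<le> s"
    and v: "\<And>x y w. y \<in> Y \<Longrightarrow> 0 < l x y w \<Longrightarrow> info_cost I X Y \<mu> P l x y w \<le> v x w"
  shows "(\<Sum>x\<in>X. \<Sum>w\<in>W. (\<Sum>y\<in>Y. l x y w) * of_bool (v x w < - s)) \<le> 3 * 2 powr (- s / (3 * I))"
proof -
  have "(\<Sum>x\<in>X. \<Sum>w\<in>W. (\<Sum>y\<in>Y. l x y w) * of_bool (v x w < - s)) \<le>
     (\<Sum>x\<in>X. \<Sum>w\<in>W. \<Sum>y\<in>Y. l x y w * of_bool (0 < l x y w \<and> info_cost I X Y \<mu> P l x y w < - s))"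
    unfolding sum_distrib_right
  proof (intro sum_mono)
    fix x y w assume y: "y \<in> Y"
    show "l x y w * of_bool (v x w < - s) \<le> l x y w * of_bool (0 < l x y w \<and> info_cost I X Y \<mu> P l x y w < - s)"
      using v[OF y, of x w] admissibleD(4)[OF adm, of x y w] by (cases "l x y w = 0") (auto simp: of_bool_def)
  qed
  also have "\<dots> = (\<Sum>x\<in>X. \<Sum>y\<in>Y. \<Sum>w\<in>W. l x y w * of_bool (0 < l x y w \<and> info_cost I X Y \<mu> P l x y w < - s))"
    by (intro sum.cong refl sum.swap)
  also have "\<dots> \<le> 3 * 2 powr (- s / (3 * I))" by (rule cost_lower_tail[OF adm I s])
  finally show ?thesis .
qed

section \<open>Splitting a rectangular distribution\<close>

text \<open>
  Given \<open>(x1, y2, m)\<close> the inputs \<open>x2\<close> and \<open>y1\<close> are independent under \<open>q\<close>, so the bias of the exclusive or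
  at \<open>m\<close> is the average over \<open>(x1, y2)\<close> of a product \<open>H * G\<close> of two conditional biases.  Reweighting by
  \<open>\<bar>H * G\<bar> / eps m\<close> and rounding the logarithms of \<open>eps m\<close>, \<open>H\<close>, \<open>G\<close> and the cost of the first half, one of
  polynomially many (in \<open>Mb / I\<close>) classes carries enough weight; on it \<open>exists_cheap_box\<close> applies to both halves.
\<close>

lemma cheap_box_split:
  fixes q :: "'a \<Rightarrow> 'b \<Rightarrow> 'c \<Rightarrow> 'd \<Rightarrow> 'm \<Rightarrow> real"
  assumes fin: "finite X1" "finite X2" "finite Y1" "finite Y2" "finite M" and I: "1 \<le> I"
    and q: "\<And>x1 x2 y1 y2 m. 0 \<le> q x1 x2 y1 y2 m"
    and l1: "\<And>x1 y1 y2 m. l1 x1 y1 (y2, m) = (\<Sum>x2\<in>X2. q x1 x2 y1 y2 m)"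
    and l2: "\<And>x1 x2 y2 m. l2 x2 y2 (x1, m) = (\<Sum>y1\<in>Y1. q x1 x2 y1 y2 m)"
    and V: "\<And>x1 y2 m. V x1 y2 m = (\<Sum>x2\<in>X2. \<Sum>y1\<in>Y1. q x1 x2 y1 y2 m)"
    and CI: "\<And>x1 x2 y1 y2 m. x1 \<in> X1 \<Longrightarrow> x2 \<in> X2 \<Longrightarrow> y1 \<in> Y1 \<Longrightarrow> y2 \<in> Y2 \<Longrightarrow> m \<in> M \<Longrightarrow>
       q x1 x2 y1 y2 m * V x1 y2 m = l1 x1 y1 (y2, m) * l2 x2 y2 (x1, m)"
    and adm1: "admissible X1 Y1 (Y2 \<times> M) \<mu>1 P1 l1" and adm2: "admissible X2 Y2 (X1 \<times> M) \<mu>2 P2 l2"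
    and qm: "\<And>m. qm m = (\<Sum>x1\<in>X1. \<Sum>y2\<in>Y2. V x1 y2 m)"
    and eps: "\<And>m. eps m = \<bar>\<Sum>x1\<in>X1. \<Sum>y2\<in>Y2. \<Sum>x2\<in>X2. \<Sum>y1\<in>Y1.
        q x1 x2 y1 y2 m * (sg (h1 x1 y1) * sg (h2 x2 y2))\<bar> / qm m"
    and cost: "\<And>x1 x2 y1 y2 m. x1 \<in> X1 \<Longrightarrow> x2 \<in> X2 \<Longrightarrow> y1 \<in> Y1 \<Longrightarrow> y2 \<in> Y2 \<Longrightarrow> m \<in> M \<Longrightarrow>
       0 < q x1 x2 y1 y2 m \<Longrightarrow> 0 < eps m \<and>
       info_cost I X1 Y1 \<mu>1 P1 l1 x1 y1 (y2, m) + info_cost I X2 Y2 \<mu>2 P2 l2 x2 y2 (x1, m) - 180 * I * log 2 (eps m) \<le> Mb"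
  shows "\<exists>t1 t2. cheap_box I X1 Y1 (Y2 \<times> M) \<mu>1 h1 P1 l1 t1 \<and> cheap_box I X2 Y2 (X1 \<times> M) \<mu>2 h2 P2 l2 t2 \<and>
    t1 + t2 \<le> Mb + 5000 * I * (1 + log2_plus (Mb / I))"
proof -

  \<comment> \<open>Factoring the bias given \<open>x1\<close>, \<open>y2\<close> and the
    transcript\<close>
  define C1 where "C1 x1 y1 y2 m = info_cost I X1 Y1 \<mu>1 P1 l1 x1 y1 (y2, m)" for x1 y1 y2 m
  define C2 where "C2 x1 x2 y2 m = info_cost I X2 Y2 \<mu>2 P2 l2 x2 y2 (x1, m)" for x1 x2 y2 m
  define H where "H x1 y2 m = (\<Sum>y1\<in>Y1. l1 x1 y1 (y2, m) * sg (h1 x1 y1)) / V x1 y2 m" for x1 y2 m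
  define G where "G x1 y2 m = (\<Sum>x2\<in>X2. l2 x2 y2 (x1, m) * sg (h2 x2 y2)) / V x1 y2 m" for x1 y2 m
  note l1nn = admissibleD(4)[OF adm1] and l2nn = admissibleD(4)[OF adm2]
  have V1: "V x1 y2 m = (\<Sum>y1\<in>Y1. l1 x1 y1 (y2, m))" for x1 y2 m
    unfolding V l1 by (rule sum.swap)
  have V2: "V x1 y2 m = (\<Sum>x2\<in>X2. l2 x2 y2 (x1, m))" for x1 y2 m
    unfolding V l2 ..
  have Vnn: "0 \<le> V x1 y2 m" for x1 y2 m unfolding V1 using l1nn by (intro sum_nonneg) auto
  have qmnn: "0 \<le> qm m" for m unfolding qm using Vnn by (intro sum_nonneg) auto
  have wsum: "\<bar>\<Sum>i\<in>A. f i * sg (b i)\<bar> \<le> (\<Sum>i\<in>A. f i)" if "\<And>i. 0 \<le> f i" for A and f :: "'z \<Rightarrow> real" and b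
  proof -
    have "\<bar>\<Sum>i\<in>A. f i * sg (b i)\<bar> \<le> (\<Sum>i\<in>A. \<bar>f i * sg (b i)\<bar>)" by (rule sum_abs)
    also have "\<dots> = (\<Sum>i\<in>A. f i)" using that by (intro sum.cong refl) (simp add: abs_mult)
    finally show ?thesis .
  qed
  have H1: "\<bar>H x1 y2 m\<bar> \<le> 1" for x1 y2 m
    using wsum[of "\<lambda>y1. l1 x1 y1 (y2, m)" "h1 x1" Y1] l1nn Vnn[of x1 y2 m]
    unfolding H_def V1[symmetric] by (auto simp: divide_le_eq_1 abs_divide)
  have G1: "\<bar>G x1 y2 m\<bar> \<le> 1" for x1 y2 m
    using wsum[of "\<lambda>x2. l2 x2 y2 (x1, m)" "\<lambda>x2. h2 x2 y2" X2] l2nn Vnn[of x1 y2 m]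
    unfolding G_def V2[symmetric] by (auto simp: divide_le_eq_1 abs_divide)
  have qV: "q x1 x2 y1 y2 m \<le> V x1 y2 m" if "x2 \<in> X2" "y1 \<in> Y1" for x1 x2 y1 y2 m
  proof -
    have "q x1 x2 y1 y2 m \<le> (\<Sum>y1\<in>Y1. q x1 x2 y1 y2 m)" using that q fin by (intro member_le_sum) auto
    also have "\<dots> \<le> V x1 y2 m" unfolding V using that q fin by (intro member_le_sum[of x2]) (auto intro!: sum_nonneg)
    finally show ?thesis .
  qed
  have VHG: "(\<Sum>x2\<in>X2. \<Sum>y1\<in>Y1. q x1 x2 y1 y2 m * (sg (h1 x1 y1) * sg (h2 x2 y2))) = V x1 y2 m * (H x1 y2 m * G x1 y2 m)"
    if "x1 \<in> X1" "y2 \<in> Y2" "m \<in> M" for x1 y2 m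
  proof (cases "V x1 y2 m = 0")
    case True
    then have "q x1 x2 y1 y2 m = 0" if "x2 \<in> X2" "y1 \<in> Y1" for x2 y1
      using qV[OF that, of x1 y2 m] q[of x1 x2 y1 y2 m] by linarith
    then show ?thesis using True by simp
  next
    case False
    have "(\<Sum>x2\<in>X2. \<Sum>y1\<in>Y1. q x1 x2 y1 y2 m * (sg (h1 x1 y1) * sg (h2 x2 y2)))
      = (\<Sum>x2\<in>X2. \<Sum>y1\<in>Y1. (l2 x2 y2 (x1, m) * sg (h2 x2 y2)) * (l1 x1 y1 (y2, m) * sg (h1 x1 y1)) / V x1 y2 m)"
    proof (intro sum.cong refl)
      fix x2 y1 assume "x2 \<in> X2" "y1 \<in> Y1"
      then have "q x1 x2 y1 y2 m = l1 x1 y1 (y2, m) * l2 x2 y2 (x1, m) / V x1 y2 m"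
        using CI[OF that(1) _ _ that(2,3)] False by (simp add: field_simps)
      then show "q x1 x2 y1 y2 m * (sg (h1 x1 y1) * sg (h2 x2 y2)) =
        (l2 x2 y2 (x1, m) * sg (h2 x2 y2)) * (l1 x1 y1 (y2, m) * sg (h1 x1 y1)) / V x1 y2 m" by simp
    qed
    also have "\<dots> = (\<Sum>x2\<in>X2. l2 x2 y2 (x1, m) * sg (h2 x2 y2)) * (\<Sum>y1\<in>Y1. l1 x1 y1 (y2, m) * sg (h1 x1 y1)) / V x1 y2 m"
      unfolding sum_product sum_divide_distrib ..
    finally show ?thesis unfolding H_def G_def using False by (simp add: field_simps)
  qed
  have epsVHG: "eps m = \<bar>\<Sum>x1\<in>X1. \<Sum>y2\<in>Y2. V x1 y2 m * (H x1 y2 m * G x1 y2 m)\<bar> / qm m" if "m \<in> M" for m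
    unfolding eps using VHG that by simp
  have HG1: "\<bar>H x1 y2 m * G x1 y2 m\<bar> \<le> 1" for x1 y2 m
    using H1[of x1 y2 m] G1[of x1 y2 m] by (simp add: abs_mult mult_le_one)
  have eps_abs: "\<bar>\<Sum>x1\<in>X1. \<Sum>y2\<in>Y2. V x1 y2 m * (H x1 y2 m * G x1 y2 m)\<bar>
      \<le> (\<Sum>x1\<in>X1. \<Sum>y2\<in>Y2. V x1 y2 m * \<bar>H x1 y2 m * G x1 y2 m\<bar>)" for m
  proof -
    have "\<bar>\<Sum>x1\<in>X1. \<Sum>y2\<in>Y2. V x1 y2 m * (H x1 y2 m * G x1 y2 m)\<bar>
      \<le> (\<Sum>x1\<in>X1. \<Sum>y2\<in>Y2. \<bar>V x1 y2 m * (H x1 y2 m * G x1 y2 m)\<bar>)"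
      by (intro order_trans[OF sum_abs] sum_mono) simp
    then show ?thesis using Vnn by (simp only: abs_mult abs_of_nonneg)
  qed
  have epsnn: "0 \<le> eps m" for m unfolding eps using qmnn by auto
  have eps1: "eps m \<le> 1" if "m \<in> M" for m
  proof -
    have "(\<Sum>x1\<in>X1. \<Sum>y2\<in>Y2. V x1 y2 m * \<bar>H x1 y2 m * G x1 y2 m\<bar>) \<le> qm m"
      unfolding qm using HG1 Vnn by (intro sum_mono mult_left_le) auto
    then show ?thesis using eps_abs[of m] qmnn[of m] unfolding epsVHG[OF that]
      by (auto simp: divide_le_eq_1)
  qed

  \<comment> \<open>Masses, biases and worst costs as functions of
    \<open>(x1, y2, m)\<close>\<close>
  define Z where "Z = X1 \<times> Y2 \<times> M"
  have finZ: "finite Z" unfolding Z_def using fin by simp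
  define Vz where "Vz = (\<lambda>(x1, y2, m). V x1 y2 m)"
  define Hz where "Hz = (\<lambda>(x1, y2, m). H x1 y2 m)"
  define Gz where "Gz = (\<lambda>(x1, y2, m). G x1 y2 m)"
  define ez where "ez = (\<lambda>(x1::'a, y2::'d, m). eps m)"
  define c1z where "c1z = (\<lambda>(x1, y2, m). Max ((\<lambda>y1. C1 x1 y1 y2 m) ` {y1 \<in> Y1. 0 < l1 x1 y1 (y2, m)}))"
  define c2z where "c2z = (\<lambda>(x1, y2, m). Max ((\<lambda>x2. C2 x1 x2 y2 m) ` {x2 \<in> X2. 0 < l2 x2 y2 (x1, m)}))"
  note zdefs = Vz_def Hz_def Gz_def ez_def c1z_def c2z_def
  have Z3: "(\<Sum>z\<in>Z. f z) = (\<Sum>x1\<in>X1. \<Sum>w\<in>Y2 \<times> M. f (x1, w))" for f :: "_ \<Rightarrow> real"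
    unfolding Z_def by (rule sum.cartesian_product')
  have Z1: "(\<Sum>z\<in>Z. f z) = (\<Sum>x1\<in>X1. \<Sum>y2\<in>Y2. \<Sum>m\<in>M. f (x1, y2, m))" for f :: "_ \<Rightarrow> real"
    unfolding Z3 by (simp add: sum.cartesian_product')
  have Z2: "(\<Sum>z\<in>Z. f z) = (\<Sum>m\<in>M. \<Sum>x1\<in>X1. \<Sum>y2\<in>Y2. f (x1, y2, m))" for f :: "_ \<Rightarrow> real"
  proof -
    have "(\<Sum>z\<in>Z. f z) = (\<Sum>x1\<in>X1. \<Sum>m\<in>M. \<Sum>y2\<in>Y2. f (x1, y2, m))"
      unfolding Z1 by (intro sum.cong refl sum.swap)
    also have "\<dots> = (\<Sum>m\<in>M. \<Sum>x1\<in>X1. \<Sum>y2\<in>Y2. f (x1, y2, m))" by (rule sum.swap)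
    finally show ?thesis .
  qed
  have Z4: "(\<Sum>z\<in>Z. f z) = (\<Sum>y2\<in>Y2. \<Sum>w\<in>X1 \<times> M. f (fst w, y2, snd w))" for f :: "_ \<Rightarrow> real"
    unfolding Z1 by (subst sum.swap) (simp add: sum.cartesian_product')
  have V1w: "Vz (x1, w) = (\<Sum>y1\<in>Y1. l1 x1 y1 w)" for x1 w
    unfolding Vz_def by (cases w) (simp add: V1)
  have V2w: "Vz (fst w, y2, snd w) = (\<Sum>x2\<in>X2. l2 x2 y2 w)" for y2 w
    unfolding Vz_def by (cases w) (simp add: V2)
  have "(\<Sum>x\<in>X1. \<Sum>y\<in>Y1. \<Sum>w\<in>Y2 \<times> M. l1 x y w) = (\<Sum>x\<in>X1. \<Sum>w\<in>Y2 \<times> M. \<Sum>y\<in>Y1. l1 x y w)"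
    by (intro sum.cong refl sum.swap)
  then have VZ1: "(\<Sum>z\<in>Z. Vz z) = 1" using admissibleD(5)[OF adm1] unfolding Z3 V1w by simp
  then have qmtotal: "(\<Sum>m\<in>M. qm m) = 1" unfolding Z2 qm Vz_def by simp
  have c1ge: "C1 x1 y1 y2 m \<le> c1z (x1, y2, m)" if "y1 \<in> Y1" "0 < l1 x1 y1 (y2, m)" for x1 y1 y2 m
    unfolding c1z_def using that fin by (auto intro!: Max_ge)
  have c2ge: "C2 x1 x2 y2 m \<le> c2z (x1, y2, m)" if "x2 \<in> X2" "0 < l2 x2 y2 (x1, m)" for x1 x2 y2 m
    unfolding c2z_def using that fin by (auto intro!: Max_ge)
  have low1: "(\<Sum>z\<in>Z. Vz z * of_bool (c1z z < - s)) \<le> 3 * 2 powr (- s / (3 * I))" if "0 \<le> s" for s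
    unfolding Z3 V1w
  proof (rule cost_lower_tail_bound[OF adm1 I that])
    show "info_cost I X1 Y1 \<mu>1 P1 l1 x y w \<le> c1z (x, w)" if "y \<in> Y1" "0 < l1 x y w" for x y w
      using c1ge[of y x "fst w" "snd w"] that unfolding C1_def by simp
  qed
  have low2: "(\<Sum>z\<in>Z. Vz z * of_bool (c2z z < - s)) \<le> 3 * 2 powr (- s / (3 * I))" if "0 \<le> s" for s
    unfolding Z4 V2w
  proof (rule cost_lower_tail_bound[OF admissible_swap[OF adm2] I that])
    show "info_cost I Y2 X2 (\<lambda>y x. \<mu>2 x y) (\<lambda>y x. P2 x y) (\<lambda>y x. l2 x y) y x w \<le> c2z (fst w, y, snd w)"
      if "x \<in> X2" "0 < l2 x y w" for x y w
      using c2ge[of x y "fst w" "snd w"] that info_cost_swap[of I Y2 X2 \<mu>2 P2 l2 y x w] unfolding C2_def by simp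
  qed
  \<comment> \<open>By \<open>CI\<close> the support of \<open>q\<close> at fixed
    \<open>(x1, y2, m)\<close> is a full product, so the costliest \<open>y1\<close> and the
    costliest \<open>x2\<close> occur together in one support point. Hence the two maxima obey the
    joint bound.\<close>
  have csum: "0 < ez z \<and> c1z z + c2z z - 180 * I * log 2 (ez z) \<le> Mb" if "z \<in> Z" "0 < Vz z" for z
  proof -
    obtain x1 y2 m where z: "z = (x1, y2, m)" by (cases z)
    have xs: "x1 \<in> X1" "y2 \<in> Y2" "m \<in> M" using that z Z_def by auto
    have V0: "0 < V x1 y2 m" using that z Vz_def by simp
    have "\<exists>y1\<in>Y1. 0 < l1 x1 y1 (y2, m)" using V0 l1nn unfolding V1
      by (metis less_eq_real_def not_less sum_nonpos)
    then have "Max ((\<lambda>y1. C1 x1 y1 y2 m) ` {y1 \<in> Y1. 0 < l1 x1 y1 (y2, m)}) \<in> (\<lambda>y1. C1 x1 y1 y2 m) ` {y1 \<in> Y1. 0 < l1 x1 y1 (y2, m)}"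
      using fin by (intro Max_in) auto
    then obtain y1 where y1: "y1 \<in> Y1" "0 < l1 x1 y1 (y2, m)" "c1z z = C1 x1 y1 y2 m" unfolding z c1z_def by auto
    have "\<exists>x2\<in>X2. 0 < l2 x2 y2 (x1, m)" using V0 l2nn unfolding V2
      by (metis less_eq_real_def not_less sum_nonpos)
    then have "Max ((\<lambda>x2. C2 x1 x2 y2 m) ` {x2 \<in> X2. 0 < l2 x2 y2 (x1, m)}) \<in> (\<lambda>x2. C2 x1 x2 y2 m) ` {x2 \<in> X2. 0 < l2 x2 y2 (x1, m)}"
      using fin by (intro Max_in) auto
    then obtain x2 where x2: "x2 \<in> X2" "0 < l2 x2 y2 (x1, m)" "c2z z = C2 x1 x2 y2 m" unfolding z c2z_def by auto
    have "0 < q x1 x2 y1 y2 m * V x1 y2 m" using CI[OF xs(1) x2(1) y1(1) xs(2,3)] y1 x2 by simp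
    then have "0 < q x1 x2 y1 y2 m" using V0 by (simp add: zero_less_mult_iff)
    from cost[OF xs(1) x2(1) y1(1) xs(2,3) this] show ?thesis
      unfolding x2 y1 C1_def C2_def unfolding z ez_def by simp
  qed

  \<comment> \<open>Cutting off very negative costs and reweighting by the bias\<close>
  define low where "low = (\<lambda>s. {z. c1z z < - s \<or> c2z z < - s})"
  have lowm: "(\<Sum>z\<in>Z. Vz z * of_bool (z \<in> low s)) \<le> 6 * 2 powr (- s / (3 * I))" if "0 \<le> s" for s
  proof -
    have "(\<Sum>z\<in>Z. Vz z * of_bool (z \<in> low s)) \<le> (\<Sum>z\<in>Z. Vz z * of_bool (c1z z < - s) + Vz z * of_bool (c2z z < - s))"
      using Vnn by (intro sum_mono) (auto simp: low_def of_bool_def Vz_def)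
    then show ?thesis using low1[OF that] low2[OF that] by (simp add: sum.distrib)
  qed
  have Vznn: "0 \<le> Vz z" for z unfolding Vz_def using Vnn by (cases z) auto
  define hg where "hg z = \<bar>Hz z * Gz z\<bar>" for z
  have hg: "0 \<le> hg z" "hg z \<le> 1" for z
    unfolding hg_def Hz_def Gz_def using HG1 by (cases z; auto)+
  \<comment> \<open>At each transcript the bias is at most the average of \<open>hg\<close> over
    \<open>(x1, y2)\<close>, so after division by \<open>ez\<close> the weight of the transcript is
    at least its mass under \<open>q\<close>.\<close>
  define wt where "wt z = Vz z * hg z / ez z" for z
  have eznn: "0 \<le> ez z" for z unfolding ez_def using epsnn by (cases z) auto
  have wtnn: "0 \<le> wt z" for z unfolding wt_def using Vznn hg eznn by simp
  \<comment> \<open>If both costs are at least \<open>- 12 * I\<close>, then \<open>csum\<close>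
    leaves \<open>- log 2 (ez z) \<le> R\<close>. The tail below \<open>- 12 * I\<close> has mass at
    most \<open>6 / 16 = 3 / 8\<close>.\<close>
  define R where "R = (Mb + 24 * I) / (180 * I)"
  define good where "good m \<longleftrightarrow> 0 < eps m \<and> - log 2 (eps m) \<le> R" for m
  have lowI: "(\<Sum>z\<in>Z. Vz z * of_bool (z \<in> low (12 * I))) \<le> 3/8"
  proof -
    have "- (12 * I) / (3 * I) = -4" using I by simp
    then have "2 powr (- (12 * I) / (3 * I)) = (2::real) powr (-4)" by simp
    then show ?thesis using lowm[of "12 * I"] I by (simp add: powr_minus)
  qed
  have bad_low: "z \<in> low (12 * I)" if "z \<in> Z" "0 < Vz z" "\<not> good (snd (snd z))" for z
  proof (rule ccontr)
    assume "z \<notin> low (12 * I)"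
    then have "- (180 * I * log 2 (ez z)) \<le> Mb + 24 * I" using csum[OF that(1,2)] by (auto simp: low_def)
    then have "- log 2 (ez z) \<le> R" unfolding R_def using I by (simp add: field_simps)
    then show False using that(3) csum[OF that(1,2)] unfolding good_def ez_def by (cases z) auto
  qed
  have wm: "qm m \<le> (\<Sum>x1\<in>X1. \<Sum>y2\<in>Y2. wt (x1, y2, m))" if "m \<in> M" for m
  proof (cases "qm m = 0")
    case True
    then show ?thesis using wtnn by (auto intro!: sum_nonneg)
  next
    case False
    then have qm0: "0 < qm m" using qmnn[of m] by linarith
    have "\<exists>x1\<in>X1. \<exists>y2\<in>Y2. V x1 y2 m \<noteq> 0"
    proof (rule ccontr)
      assume "\<not> (\<exists>x1\<in>X1. \<exists>y2\<in>Y2. V x1 y2 m \<noteq> 0)"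
      then have "qm m = 0" unfolding qm by simp
      with False show False by simp
    qed
    then obtain x1 y2 where xy: "x1 \<in> X1" "y2 \<in> Y2" "0 < V x1 y2 m" using Vnn by (metis less_eq_real_def)
    then have e0: "0 < eps m" using csum[of "(x1, y2, m)"] that unfolding Z_def Vz_def ez_def by auto
    have "eps m * qm m = \<bar>\<Sum>x1\<in>X1. \<Sum>y2\<in>Y2. V x1 y2 m * (H x1 y2 m * G x1 y2 m)\<bar>"
      unfolding epsVHG[OF that] using qm0 by simp
    also have "\<dots> \<le> (\<Sum>x1\<in>X1. \<Sum>y2\<in>Y2. V x1 y2 m * \<bar>H x1 y2 m * G x1 y2 m\<bar>)" by (rule eps_abs)
    also have "\<dots> = eps m * (\<Sum>x1\<in>X1. \<Sum>y2\<in>Y2. wt (x1, y2, m))"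
      unfolding sum_distrib_left wt_def hg_def zdefs using e0 by simp
    finally show ?thesis using e0 by simp
  qed
  have wgood: "5/8 \<le> (\<Sum>z\<in>Z. wt z * of_bool (good (snd (snd z))))"
  proof -
    have "1 - 3/8 \<le> (\<Sum>m\<in>M. qm m) - (\<Sum>z\<in>Z. Vz z * of_bool (z \<in> low (12 * I)))"
      using qmtotal lowI by linarith
    also have "\<dots> \<le> (\<Sum>m\<in>M. qm m) - (\<Sum>z\<in>Z. Vz z * of_bool (\<not> good (snd (snd z))))"
    proof (intro diff_left_mono sum_mono)
      fix z assume "z \<in> Z"
      then show "Vz z * of_bool (\<not> good (snd (snd z))) \<le> Vz z * of_bool (z \<in> low (12 * I))"
        using bad_low[of z] Vznn[of z] by (cases "Vz z = 0") (auto simp: of_bool_def)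
    qed
    also have "(\<Sum>z\<in>Z. Vz z * of_bool (\<not> good (snd (snd z)))) = (\<Sum>m\<in>M. qm m * of_bool (\<not> good m))"
      unfolding Z2 qm Vz_def by (simp add: sum_distrib_right)
    also have "(\<Sum>m\<in>M. qm m) - (\<Sum>m\<in>M. qm m * of_bool (\<not> good m)) = (\<Sum>m\<in>M. qm m * of_bool (good m))"
      unfolding sum_subtractf[symmetric] by (intro sum.cong refl) (auto simp: of_bool_def)
    also have "\<dots> \<le> (\<Sum>m\<in>M. (\<Sum>x1\<in>X1. \<Sum>y2\<in>Y2. wt (x1, y2, m)) * of_bool (good m))"
      using wm by (intro sum_mono mult_right_mono) auto
    also have "\<dots> = (\<Sum>z\<in>Z. wt z * of_bool (good (snd (snd z))))"
      unfolding Z2 by (simp add: sum_distrib_right)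
    finally show ?thesis by simp
  qed
  \<comment> \<open>\<open>Mb\<close> may be negative; \<open>R\<close> is not, because some
    transcript is good and biases are at most 1.\<close>
  have R0: "0 \<le> R"
  proof -
    have "\<exists>z\<in>Z. good (snd (snd z))"
    proof (rule ccontr)
      assume "\<not> (\<exists>z\<in>Z. good (snd (snd z)))"
      then have "(\<Sum>z\<in>Z. wt z * of_bool (good (snd (snd z)))) = 0" by simp
      with wgood show False by simp
    qed
    then obtain m where m: "m \<in> M" "good m" unfolding Z_def by auto
    then have "log 2 (eps m) \<le> 0" using eps1[OF m(1)] unfolding good_def by simp
    then show ?thesis using m(2) unfolding good_def by linarith
  qed
  \<comment> \<open>A deeper cut-off for the reweighted mass: on good transcripts \<open>wt\<close>
    exceeds \<open>Vz\<close> by a factor of at most \<open>2 powr R\<close>, so a tail of mass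
    \<open>6 * 2 powr (- R - 6)\<close> still weighs at most \<open>6 / 64\<close>.\<close>
  define s1 where "s1 = 3 * I * (R + 6)"
  have s10: "0 \<le> s1" unfolding s1_def using R0 I by simp
  have lows1: "(\<Sum>z\<in>Z. Vz z * of_bool (z \<in> low s1)) \<le> 6 * 2 powr (- R - 6)"
  proof -
    have "- s1 / (3 * I) = - R - 6" unfolding s1_def using I by simp
    then show ?thesis using lowm[OF s10] by simp
  qed
  \<comment> \<open>Points with \<open>hg\<close> below \<open>ez / 8\<close> weigh at most
    \<open>Vz / 8\<close>. Taking \<open>1 / 8\<close> and \<open>6 / 64\<close> from the initial
    \<open>5 / 8\<close> leaves more than \<open>1 / 4\<close>.\<close>
  define Z' where "Z' = {z \<in> Z. 0 < Vz z \<and> good (snd (snd z)) \<and> ez z / 8 \<le> hg z \<and> z \<notin> low s1}"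
  have Z'Z: "Z' \<subseteq> Z" unfolding Z'_def by auto
  have finZ': "finite Z'" using Z'Z finZ finite_subset by blast
  have ezR: "1 / ez z \<le> 2 powr R" "0 < ez z" if "good (snd (snd z))" for z
  proof -
    show e0: "0 < ez z" using that unfolding good_def ez_def by (cases z) auto
    have "log 2 (1 / ez z) \<le> R" using that e0 unfolding good_def ez_def by (cases z) (auto simp: log_divide)
    then show "1 / ez z \<le> 2 powr R" using e0 by (simp add: log_le_iff)
  qed
  have wZ': "1/4 \<le> (\<Sum>z\<in>Z'. wt z)"
  proof -
    have "wt z * of_bool (good (snd (snd z))) \<le> wt z * of_bool (z \<in> Z') + Vz z * (1/8) + 2 powr R * (Vz z * of_bool (z \<in> low s1))"
      if z: "z \<in> Z" for z
    proof (cases "good (snd (snd z)) \<and> z \<notin> Z' \<and> 0 < Vz z")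
      case False
      then show ?thesis using wtnn[of z] Vznn[of z] by (auto simp: of_bool_def wt_def)
    next
      case True
      then have g: "good (snd (snd z))" by simp
      from True z consider "hg z < ez z / 8" | "z \<in> low s1" unfolding Z'_def by force
      then show ?thesis
      proof cases
        case 1
        then have "Vz z * (hg z / ez z) \<le> Vz z * (1/8)" using ezR(2)[OF g] Vznn[of z]
          by (intro mult_left_mono) (auto simp: divide_le_eq)
        then have "wt z \<le> Vz z * (1/8)" by (simp add: wt_def)
        moreover have "0 \<le> 2 powr R * (Vz z * of_bool (z \<in> low s1))" using Vznn[of z] by simp
        moreover have "wt z * of_bool (good (snd (snd z))) = wt z" "wt z * of_bool (z \<in> Z') = 0" using g True by simp_all
        ultimately show ?thesis by linarith
      next
        case 2
        have "hg z * (1 / ez z) \<le> 1 * 2 powr R" using hg[of z] ezR[OF g] by (intro mult_mono) auto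
        then have "Vz z * (hg z * (1 / ez z)) \<le> Vz z * 2 powr R" using Vznn[of z] by (intro mult_left_mono) auto
        then have "wt z \<le> 2 powr R * Vz z" by (simp add: wt_def mult.commute)
        then show ?thesis using g True 2 Vznn[of z] by simp
      qed
    qed
    then have "(\<Sum>z\<in>Z. wt z * of_bool (good (snd (snd z)))) \<le>
       (\<Sum>z\<in>Z. wt z * of_bool (z \<in> Z') + Vz z * (1/8) + 2 powr R * (Vz z * of_bool (z \<in> low s1)))"
      by (rule sum_mono)
    also have "\<dots> = (\<Sum>z\<in>Z. wt z * of_bool (z \<in> Z')) + 1/8 + 2 powr R * (\<Sum>z\<in>Z. Vz z * of_bool (z \<in> low s1))"
      using VZ1 unfolding sum.distrib sum_distrib_left[symmetric] sum_distrib_right[symmetric] by simp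
    also have "\<dots> \<le> (\<Sum>z\<in>Z. wt z * of_bool (z \<in> Z')) + 1/8 + 2 powr R * (6 * 2 powr (- R - 6))"
      using lows1 by (intro add_left_mono mult_left_mono) auto
    also have "2 powr R * (6 * 2 powr (- R - 6)) = 6 * (2::real) powr (-6)" by (simp add: powr_add[symmetric])
    also have "6 * (2::real) powr (-6) = 6 / 64" by (simp add: powr_minus)
    also have "(\<Sum>z\<in>Z. wt z * of_bool (z \<in> Z')) = (\<Sum>z\<in>Z'. wt z)"
      using finZ Z'Z by (intro sum.mono_neutral_cong_right) auto
    finally show ?thesis using wgood by simp
  qed

  \<comment> \<open>Pigeonholing into classes of nearly constant bias and cost\<close>
  define key where "key z = (\<lfloor>- log 2 (ez z)\<rfloor>, \<lfloor>- log 2 \<bar>Hz z\<bar>\<rfloor>, \<lfloor>- log 2 \<bar>Gz z\<bar>\<rfloor>, \<lfloor>c1z z / I\<rfloor>, 0 < Hz z, 0 < Gz z)" for z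
  define A where "A = max 1 (Mb / I)"
  have A1: "1 \<le> A" unfolding A_def by simp
  have MbA: "Mb / I \<le> A" unfolding A_def by simp
  have RA: "R \<le> 25/180 * A"
  proof -
    have "R = (Mb / I + 24) / 180" unfolding R_def using I by (simp add: field_simps)
    then show ?thesis using MbA A1 by simp
  qed
  have inZ': "0 < ez z \<and> 0 < \<bar>Hz z\<bar> \<and> 0 < \<bar>Gz z\<bar> \<and> 0 \<le> - log 2 (ez z) \<and> - log 2 (ez z) \<le> R \<and>
      0 \<le> - log 2 \<bar>Hz z\<bar> \<and> - log 2 \<bar>Hz z\<bar> \<le> R + 3 \<and> 0 \<le> - log 2 \<bar>Gz z\<bar> \<and> - log 2 \<bar>Gz z\<bar> \<le> R + 3 \<and>
      - s1 \<le> c1z z \<and> c1z z \<le> Mb + s1"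
    if z: "z \<in> Z'" for z
  proof -
    have zZ: "z \<in> Z" "0 < Vz z" and g: "good (snd (snd z))" and h: "ez z / 8 \<le> hg z" and nl: "z \<notin> low s1"
      using z unfolding Z'_def by auto
    have e0: "0 < ez z" using ezR(2)[OF g] .
    have ele: "ez z \<le> 1" using eps1 zZ(1) unfolding ez_def Z_def by (cases z) auto
    have er: "- log 2 (ez z) \<le> R" using g unfolding good_def ez_def by (cases z) auto
    have el0: "log 2 (ez z) \<le> 0" using e0 ele by simp
    have h0: "0 < hg z" using h e0 by linarith
    then have HG0: "0 < \<bar>Hz z\<bar>" "0 < \<bar>Gz z\<bar>" unfolding hg_def by auto
    have HGle: "\<bar>Hz z\<bar> \<le> 1" "\<bar>Gz z\<bar> \<le> 1" unfolding Hz_def Gz_def using H1 G1 by (cases z; auto)+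
    have "hg z \<le> \<bar>Hz z\<bar>" "hg z \<le> \<bar>Gz z\<bar>"
      unfolding hg_def abs_mult using HGle HG0 by (auto intro: mult_left_le mult_left_le_one_le)
    then have "log 2 (ez z / 8) \<le> log 2 \<bar>Hz z\<bar>" "log 2 (ez z / 8) \<le> log 2 \<bar>Gz z\<bar>"
      using h e0 HG0 by (subst log_le_cancel_iff; auto)+
    moreover have "log 2 (ez z / 8) = log 2 (ez z) - 3"
      using e0 log_pow_cancel[of "2::real" 3] by (simp add: log_divide)
    ultimately have lo: "- log 2 \<bar>Hz z\<bar> \<le> R + 3" "- log 2 \<bar>Gz z\<bar> \<le> R + 3" using er by linarith+
    have up: "0 \<le> - log 2 \<bar>Hz z\<bar>" "0 \<le> - log 2 \<bar>Gz z\<bar>" using HG0 HGle by auto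
    have c: "- s1 \<le> c1z z" "- s1 \<le> c2z z" using nl unfolding low_def by auto
    have "180 * I * log 2 (ez z) \<le> 0" using el0 I by (simp add: mult_nonneg_nonpos)
    then have "c1z z \<le> Mb + s1" using csum[OF zZ] c by linarith
    then show ?thesis using e0 HG0 er el0 lo up c by auto
  qed
  \<comment> \<open>\<open>R\<close> and \<open>s1 / I\<close> are linear in \<open>Mb / I\<close>,
    so each of the four integer components takes a number of values linear in \<open>A\<close>; this
    produces the fourth power, and the two signs a factor 4.\<close>
  define K where "K = {0..\<lfloor>R\<rfloor>} \<times> {0..\<lfloor>R + 3\<rfloor>} \<times> {0..\<lfloor>R + 3\<rfloor>} \<times> {\<lfloor>- s1 / I\<rfloor>..\<lfloor>(Mb + s1) / I\<rfloor>} \<times> (UNIV :: bool set) \<times> (UNIV :: bool set)"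
  have keyK: "key ` Z' \<subseteq> K"
  proof
    fix k assume "k \<in> key ` Z'"
    then obtain z where z: "z \<in> Z'" "k = key z" by auto
    have "- s1 / I \<le> c1z z / I" "c1z z / I \<le> (Mb + s1) / I"
      by (rule divide_right_mono; use inZ'[OF z(1)] I in linarith)+
    moreover have "\<lfloor>- log 2 \<bar>Hz z\<bar>\<rfloor> \<le> \<lfloor>R\<rfloor> + 3" "\<lfloor>- log 2 \<bar>Gz z\<bar>\<rfloor> \<le> \<lfloor>R\<rfloor> + 3"
      using inZ'[OF z(1)] by linarith+
    ultimately show "k \<in> K" using inZ'[OF z(1)] unfolding z(2) key_def K_def by (auto intro!: floor_mono)
  qed
  have cardK: "real (card K) \<le> 9000 * A ^ 4"
  proof -
    have c1: "real (card {0..\<lfloor>R\<rfloor>}) \<le> 2 * A"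
    proof -
      have "real (card {0..\<lfloor>R\<rfloor>}) \<le> R + 1" using R0 by simp
      then show ?thesis using RA A1 by linarith
    qed
    have c2: "real (card {0..\<lfloor>R + 3\<rfloor>}) \<le> 5 * A"
    proof -
      have "real (card {0..\<lfloor>R + 3\<rfloor>}) \<le> R + 4" using R0 by simp
      then show ?thesis using RA A1 by linarith
    qed
    have c3: "real (card {\<lfloor>- s1 / I\<rfloor>..\<lfloor>(Mb + s1) / I\<rfloor>}) \<le> 45 * A"
    proof -
      have s1I: "s1 / I = 3 * (R + 6)" unfolding s1_def using I by simp
      have MI: "Mb / I = 180 * R - 24" unfolding R_def using I by (simp add: field_simps)
      have "(Mb + s1) / I = Mb / I + s1 / I" by (rule add_divide_distrib)
      then have "(Mb + s1) / I - (- s1 / I) + 2 \<le> 45 * A" "0 \<le> (Mb + s1) / I - (- s1 / I)"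
        using s1I MI MbA RA A1 R0 by (auto simp: minus_divide_left[symmetric])
      moreover have "real (nat k) \<le> r" if "of_int k \<le> r" "0 \<le> r" for k r using that by linarith
      moreover have "of_int (\<lfloor>(Mb + s1) / I\<rfloor> + 1 - \<lfloor>- s1 / I\<rfloor>) \<le> (Mb + s1) / I - (- s1 / I) + 2" by linarith
      ultimately show ?thesis by (simp add: order_trans)
    qed
    have "real (card K) = real (card {0..\<lfloor>R\<rfloor>}) * (real (card {0..\<lfloor>R + 3\<rfloor>}) * (real (card {0..\<lfloor>R + 3\<rfloor>}) *
       (real (card {\<lfloor>- s1 / I\<rfloor>..\<lfloor>(Mb + s1) / I\<rfloor>}) * 4)))"
      unfolding K_def by (simp only: card_cartesian_product of_nat_mult card_UNIV_bool)
    also have "\<dots> \<le> (2 * A) * ((5 * A) * ((5 * A) * ((45 * A) * 4)))"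
      using A1 by (intro mult_mono c1 c2 c3 mult_nonneg_nonneg) auto
    also have "\<dots> = 9000 * A ^ 4" by (simp add: power4_eq_xxxx)
    finally show ?thesis .
  qed
  define wk where "wk k = (\<Sum>z\<in>{z \<in> Z'. key z = k}. wt z)" for k
  have "Z' \<noteq> {}" using wZ' by auto
  then have "\<exists>k\<in>key ` Z'. \<forall>k'\<in>key ` Z'. wk k' \<le> wk k" by (intro finite_argmax finite_imageI finZ') blast
  then obtain k where k: "k \<in> key ` Z'" "\<And>k'. k' \<in> key ` Z' \<Longrightarrow> wk k' \<le> wk k" by blast
  have wknn: "0 \<le> wk k" unfolding wk_def using wtnn by (intro sum_nonneg) auto
  have wk1: "1/4 \<le> 9000 * A ^ 4 * wk k"
  proof -
    have "1/4 \<le> (\<Sum>k'\<in>key ` Z'. wk k')"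
      using wZ' sum.image_gen[OF finZ', of wt key] unfolding wk_def by simp
    also have "\<dots> \<le> real (card (key ` Z')) * wk k" using k(2) by (intro sum_bounded_above) auto
    also have "\<dots> \<le> real (card K) * wk k"
    proof (rule mult_right_mono[OF _ wknn])
      have "finite K" unfolding K_def by simp
      then show "real (card (key ` Z')) \<le> real (card K)" using keyK by (simp only: of_nat_le_iff card_mono)
    qed
    also have "\<dots> \<le> 9000 * A ^ 4 * wk k" using cardK wknn by (intro mult_right_mono) auto
    finally show ?thesis .
  qed
  obtain r a b j p1 p2 where kk: "k = (r, a, b, j, p1, p2)" by (cases k)
  define D where "D = {z \<in> Z'. key z = k}"
  have DZ': "D \<subseteq> Z'" unfolding D_def by auto
  have Dk: "\<lfloor>- log 2 (ez z)\<rfloor> = r" "\<lfloor>- log 2 \<bar>Hz z\<bar>\<rfloor> = a" "\<lfloor>- log 2 \<bar>Gz z\<bar>\<rfloor> = b" "\<lfloor>c1z z / I\<rfloor> = j"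
     "(0 < Hz z) = p1" "(0 < Gz z) = p2" if "z \<in> D" for z
    using that unfolding D_def key_def kk by auto
  define tau where "tau = (\<Sum>z\<in>D. Vz z)"
  have tau1: "tau \<le> 1"
    unfolding tau_def VZ1[symmetric] using finZ DZ' Z'Z Vznn by (intro sum_mono2) auto
  have DV: "0 < Vz z" if "z \<in> D" for z using that DZ' Z'_def by auto
  have wtD: "wt z \<le> Vz z * 2 powr (real_of_int (r + 1) - a - b)" if z: "z \<in> D" for z
  proof -
    have f: "0 < ez z" "0 < \<bar>Hz z\<bar>" "0 < \<bar>Gz z\<bar>" using inZ'[of z] z DZ' by auto
    have fl: "- log 2 (ez z) \<le> real_of_int (r + 1)" "log 2 \<bar>Hz z\<bar> \<le> - real_of_int a" "log 2 \<bar>Gz z\<bar> \<le> - real_of_int b"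
      using Dk(1-3)[OF z] by linarith+
    have "log 2 (hg z / ez z) \<le> real_of_int (r + 1) - a - b"
      unfolding hg_def abs_mult using f fl by (simp add: log_divide log_mult)
    then have "hg z / ez z \<le> 2 powr (real_of_int (r + 1) - a - b)"
      using f unfolding hg_def abs_mult by (subst (asm) log_le_iff) auto
    then have "Vz z * (hg z / ez z) \<le> Vz z * 2 powr (real_of_int (r + 1) - a - b)"
      using Vznn[of z] by (intro mult_left_mono) auto
    then show ?thesis by (simp add: wt_def)
  qed
  have wtau: "1/4 \<le> 9000 * A ^ 4 * (tau * 2 powr (real_of_int (r + 1) - a - b))"
  proof -
    have "wk k \<le> tau * 2 powr (real_of_int (r + 1) - a - b)"
      unfolding wk_def D_def[symmetric] tau_def sum_distrib_right using wtD by (intro sum_mono) auto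
    then have "9000 * A ^ 4 * wk k \<le> 9000 * A ^ 4 * (tau * 2 powr (real_of_int (r + 1) - a - b))"
      using A1 by (intro mult_left_mono) auto
    then show ?thesis using wk1 by linarith
  qed
  have tau0: "0 < tau"
  proof (rule ccontr)
    assume "\<not> 0 < tau"
    then have "tau * 2 powr (real_of_int (r + 1) - a - b) \<le> 0" by (simp add: mult_nonpos_nonneg)
    then have "9000 * A ^ 4 * (tau * 2 powr (real_of_int (r + 1) - a - b)) \<le> 0"
      by (rule mult_nonneg_nonpos[rotated]) (use A1 in simp)
    then show False using wtau by linarith
  qed
  \<comment> \<open>The weight of the heaviest class is at most \<open>tau\<close> times
    \<open>2 powr (r + 1 - a - b)\<close>, so its lower bound limits how far the product of the two
    biases can fall below that of the exclusive or. The number 65536 is a power of two above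
    \<open>4 * 9000\<close>.\<close>
  have budget: "a + b - r \<le> log 2 tau + 17 + 4 * log2_plus (Mb / I)"
  proof -
    have "1 \<le> 65536 * A ^ 4 * (tau * 2 powr (real_of_int (r + 1) - a - b))"
    proof -
      have "0 \<le> A ^ 4 * (tau * 2 powr (real_of_int (r + 1) - a - b))" using A1 tau0 by simp
      then show ?thesis using wtau by linarith
    qed
    moreover have "0 \<le> log 2 Q" if "1 \<le> Q" for Q :: real using that by simp
    ultimately have "0 \<le> log 2 (65536 * A ^ 4 * (tau * 2 powr (real_of_int (r + 1) - a - b)))" by blast
    also have "\<dots> = log 2 65536 + 4 * log 2 A + (log 2 tau + (real_of_int (r + 1) - a - b))"
      using A1 tau0 by (simp add: log_mult log_nat_power)
    also have "log 2 (65536::real) = 16" using log_pow_cancel[of "2::real" 16] by simp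
    finally show ?thesis unfolding log2_plus_def A_def by simp
  qed

  \<comment> \<open>Boxes for the two halves\<close>
  have D1: "D \<subseteq> X1 \<times> (Y2 \<times> M)" using DZ' Z'Z unfolding Z_def by auto
  have Dpos: "2 powr (- real_of_int (a + 1)) \<le> \<bar>Hz z\<bar> \<and> 2 powr (- real_of_int (b + 1)) \<le> \<bar>Gz z\<bar>" if z: "z \<in> D" for z
  proof -
    have f: "0 < \<bar>Hz z\<bar>" "0 < \<bar>Gz z\<bar>" using inZ'[of z] z DZ' by auto
    have "- real_of_int (a + 1) \<le> log 2 \<bar>Hz z\<bar>" "- real_of_int (b + 1) \<le> log 2 \<bar>Gz z\<bar>"
      using Dk(2,3)[OF z] by linarith+
    then show ?thesis using f by (simp add: le_log_iff)
  qed
  define \<sigma>1 where "\<sigma>1 = (if p1 then 1 else -1 :: real)"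
  define \<sigma>2 where "\<sigma>2 = (if p2 then 1 else -1 :: real)"
  have sH: "\<sigma>1 * Hz z = \<bar>Hz z\<bar>" "\<sigma>2 * Gz z = \<bar>Gz z\<bar>" if z: "z \<in> D" for z
    using Dk(5,6)[OF z] unfolding \<sigma>1_def \<sigma>2_def by auto
  have r1: "cheap_box I X1 Y1 (Y2 \<times> M) \<mu>1 h1 P1 l1
      (real_of_int (j + 1) * I + 180 * I * log 2 (1 / 2 powr (- real_of_int (a + 1))) + 45 * I * log 2 (1 / tau) + 372 * I)"
  proof (rule exists_cheap_box)
    show "D \<subseteq> X1 \<times> (Y2 \<times> M)" by (rule D1)
    show "\<sigma>1 = 1 \<or> \<sigma>1 = -1" unfolding \<sigma>1_def by simp
    show "2 powr (- real_of_int (a + 1)) * (\<Sum>y\<in>Y1. l1 x y w) \<le> \<sigma>1 * (\<Sum>y\<in>Y1. l1 x y w * sg (h1 x y))"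
      if "(x, w) \<in> D" for x w
    proof -
      have e: "(\<Sum>y\<in>Y1. l1 x y w * sg (h1 x y)) = Hz (x, w) * Vz (x, w)"
        using DV[OF that] unfolding Hz_def Vz_def H_def by (cases w) simp
      have "2 powr (- real_of_int (a + 1)) * Vz (x, w) \<le> \<bar>Hz (x, w)\<bar> * Vz (x, w)"
        using Dpos[OF that] Vznn by (intro mult_right_mono) auto
      then show ?thesis unfolding e V1w[symmetric] using sH(1)[OF that] by (simp add: mult.assoc[symmetric])
    qed
    have "(\<Sum>z\<in>Z. of_bool (z \<in> D) * Vz z) = tau"
      unfolding tau_def using finZ DZ' Z'Z by (intro sum.mono_neutral_cong_right) auto
    then show "tau = (\<Sum>x\<in>X1. \<Sum>w\<in>Y2 \<times> M. of_bool ((x, w) \<in> D) * (\<Sum>y\<in>Y1. l1 x y w))"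
      unfolding Z3 V1w by simp
    show "info_cost I X1 Y1 \<mu>1 P1 l1 x y w \<le> real_of_int (j + 1) * I"
      if "(x, w) \<in> D" "y \<in> Y1" "0 < l1 x y w" for x y w
    proof -
      obtain y2 m where w: "w = (y2, m)" by force
      have "info_cost I X1 Y1 \<mu>1 P1 l1 x y w \<le> c1z (x, w)" using c1ge[of y x y2 m] that unfolding w C1_def by simp
      also have "c1z (x, w) / I \<le> real_of_int (j + 1)" using Dk(4)[OF that(1)] by linarith
      then have "c1z (x, w) \<le> real_of_int (j + 1) * I" using I by (simp add: pos_divide_le_eq)
      finally show ?thesis .
    qed
  qed (use adm1 I tau0 in auto)
  \<comment> \<open>The cost of the second half was not pigeonholed: it is bounded by what
    \<open>csum\<close> leaves once the class has fixed the overall bias and the cost of the first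
    half.\<close>
  define v2 where "v2 = Mb - 180 * I * r - j * I"
  have r2: "cheap_box I X2 Y2 (X1 \<times> M) \<mu>2 h2 P2 l2
      (v2 + 180 * I * log 2 (1 / 2 powr (- real_of_int (b + 1))) + 45 * I * log 2 (1 / tau) + 372 * I)"
  proof (rule cheap_box_swap, rule exists_cheap_box)
    let ?D = "{(y2, w). (fst w, y2, snd w) \<in> D}"
    show "?D \<subseteq> Y2 \<times> (X1 \<times> M)" using D1 by auto
    show "\<sigma>2 = 1 \<or> \<sigma>2 = -1" unfolding \<sigma>2_def by simp
    show "2 powr (- real_of_int (b + 1)) * (\<Sum>x\<in>X2. l2 x y w) \<le> \<sigma>2 * (\<Sum>x\<in>X2. l2 x y w * sg (h2 x y))"
      if "(y, w) \<in> ?D" for y w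
    proof -
      have z: "(fst w, y, snd w) \<in> D" using that by simp
      have e: "(\<Sum>x\<in>X2. l2 x y w * sg (h2 x y)) = Gz (fst w, y, snd w) * Vz (fst w, y, snd w)"
        using DV[OF z] unfolding Gz_def Vz_def G_def by (cases w) simp
      have "2 powr (- real_of_int (b + 1)) * Vz (fst w, y, snd w) \<le> \<bar>Gz (fst w, y, snd w)\<bar> * Vz (fst w, y, snd w)"
        using Dpos[OF z] Vznn by (intro mult_right_mono) auto
      then show ?thesis unfolding e V2w[symmetric] using sH(2)[OF z] by (simp add: mult.assoc[symmetric])
    qed
    have "(\<Sum>z\<in>Z. of_bool (z \<in> D) * Vz z) = tau"
      unfolding tau_def using finZ DZ' Z'Z by (intro sum.mono_neutral_cong_right) auto
    then show "tau = (\<Sum>y\<in>Y2. \<Sum>w\<in>X1 \<times> M. of_bool ((y, w) \<in> ?D) * (\<Sum>x\<in>X2. l2 x y w))"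
      unfolding Z4 V2w by simp
    show "info_cost I Y2 X2 (\<lambda>y x. \<mu>2 x y) (\<lambda>y x. P2 x y) (\<lambda>y x. l2 x y) y x w \<le> v2"
      if "(y, w) \<in> ?D" "x \<in> X2" "0 < l2 x y w" for y x w
    proof -
      obtain x1 m where w: "w = (x1, m)" by force
      have z: "(x1, y, m) \<in> D" using that w by simp
      then have zZ: "(x1, y, m) \<in> Z" using DZ' Z'Z by auto
      have "info_cost I Y2 X2 (\<lambda>y x. \<mu>2 x y) (\<lambda>y x. P2 x y) (\<lambda>y x. l2 x y) y x w = C2 x1 x y m"
        unfolding C2_def w using info_cost_swap[of I Y2 X2 \<mu>2 P2 l2 y x "(x1, m)"] by simp
      also have "\<dots> \<le> c2z (x1, y, m)" using c2ge[of x y x1 m] that unfolding w by simp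
      also have "\<dots> \<le> Mb + 180 * I * log 2 (ez (x1, y, m)) - c1z (x1, y, m)" using csum[OF zZ DV[OF z]] by linarith
      also have "\<dots> \<le> v2"
      proof -
        have "log 2 (ez (x1, y, m)) \<le> - real_of_int r" using Dk(1)[OF z] by linarith
        then have "180 * I * log 2 (ez (x1, y, m)) \<le> 180 * I * (- real_of_int r)" using I by (intro mult_left_mono) auto
        moreover have "real_of_int j \<le> c1z (x1, y, m) / I" using Dk(4)[OF z] by linarith
        then have "real_of_int j * I \<le> c1z (x1, y, m)" using I by (simp add: pos_le_divide_eq)
        ultimately show ?thesis unfolding v2_def by simp
      qed
      finally show ?thesis .
    qed
  qed (use admissible_swap[OF adm2] I tau0 in auto)
  define la where "la = log 2 tau"
  define lp where "lp = log2_plus (Mb / I)"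
  have la0: "la \<le> 0" unfolding la_def using tau0 tau1 by simp
  have lp0: "0 \<le> lp" unfolding lp_def log2_plus_def by simp
  have inv: "log 2 (1 / 2 powr (- real_of_int k)) = real_of_int k" for k
    by (simp add: log_divide)
  have invt: "log 2 (1 / tau) = - la" unfolding la_def using tau0 by (simp add: log_divide)
  \<comment> \<open>The two boxes charge \<open>90 * I * log 2 (1 / tau)\<close>, while the budget
    for the biases, which count 180-fold, is smaller by \<open>180 * I * log 2 (1 / tau)\<close>. A
    class of small mass is thus no loss. What remains is
    \<open>4165 * I + 720 * I * lp\<close>.\<close>
  have "I * (real_of_int (a + b - r)) \<le> I * (la + 17 + 4 * lp)"
    using budget I unfolding la_def lp_def by (intro mult_left_mono) auto
  moreover have "I * la \<le> 0" using I la0 by (simp add: mult_nonneg_nonpos)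
  moreover have "0 \<le> I * lp" using I lp0 by simp
  ultimately have final: "(real_of_int (j + 1) * I + 180 * I * log 2 (1 / 2 powr (- real_of_int (a + 1))) + 45 * I * log 2 (1 / tau) + 372 * I)
     + (v2 + 180 * I * log 2 (1 / 2 powr (- real_of_int (b + 1))) + 45 * I * log 2 (1 / tau) + 372 * I)
      \<le> Mb + 5000 * I * (1 + log2_plus (Mb / I))"
    unfolding inv invt v2_def lp_def[symmetric] using I by (simp add: algebra_simps)
  show ?thesis using r1 r2 final by blast
qed

section \<open>Kernels and transcripts\<close>

lemma listset_conv: "xs \<in> listset As \<longleftrightarrow> length xs = length As \<and> (\<forall>i<length As. xs ! i \<in> As ! i)"
proof (induction As arbitrary: xs)
  case Nil then show ?case by simp
next
  case (Cons A As)
  show ?case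
  proof (cases xs)
    case Nil then show ?thesis by (auto simp: set_Cons_def)
  next
    case (Cons x ys)
    then show ?thesis using Cons.IH[of ys] by (auto simp: set_Cons_def nth_Cons split: nat.splits)
  qed
qed

lemma finite_listset: "\<forall>A\<in>set As. finite A \<Longrightarrow> finite (listset As)"
proof (induction As)
  case (Cons A As)
  have "listset (A # As) = (\<lambda>(x, xs). x # xs) ` (A \<times> listset As)" by (auto simp: set_Cons_def)
  then show ?case using Cons by simp
qed simp

lemma sum_listset_Cons: "(\<Sum>t\<in>listset (A # As). f t) = (\<Sum>x\<in>A. \<Sum>t\<in>listset As. f (x # t))"
proof -
  have "listset (A # As) = (\<lambda>(x, xs). x # xs) ` (A \<times> listset As)" by (auto simp: set_Cons_def)
  then have "(\<Sum>t\<in>listset (A # As). f t) = (\<Sum>p\<in>A \<times> listset As. f ((\<lambda>(x, xs). x # xs) p))"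
    by (simp only:) (subst sum.reindex, auto simp: inj_on_def)
  then show ?thesis by (simp add: sum.cartesian_product')
qed

text \<open>Normalization is asked after every prefix of the right length, whether or not its
  entries lie in the alphabets. This makes the condition stable under fixing a first entry and under
  interleaving two kernels.\<close>

definition kern :: "'m set list \<Rightarrow> ('m list \<Rightarrow> 'm \<Rightarrow> real) \<Rightarrow> bool" where
  "kern Cs \<kappa> \<longleftrightarrow> (\<forall>pre z. 0 \<le> \<kappa> pre z) \<and> (\<forall>pre. length pre < length Cs \<longrightarrow> (\<Sum>z\<in>Cs ! length pre. \<kappa> pre z) = 1)"

text \<open>The factors contributed by one speaker; \<open>True\<close> selects the odd positions,
  which are Alice's. A half protocol keeps this product for one player and replaces it for the
  other.\<close>

definition parity_prod :: "bool \<Rightarrow> ('m list \<Rightarrow> 'm \<Rightarrow> real) \<Rightarrow> 'm list \<Rightarrow> real" where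
  "parity_prod b \<kappa> t = (\<Prod>j<length t. if odd j = b then \<kappa> (take j t) (t ! j) else 1)"

lemma parity_prod_nonneg: "(\<And>pre z. 0 \<le> \<kappa> pre z) \<Longrightarrow> 0 \<le> parity_prod b \<kappa> t"
  unfolding parity_prod_def by (intro prod_nonneg) auto

lemma parity_prod_mult: "parity_prod True \<kappa> t * parity_prod False \<kappa>' t =
  (\<Prod>j<length t. (if odd (length (take j t)) then \<kappa> else \<kappa>') (take j t) (t ! j))"
  unfolding parity_prod_def prod.distrib[symmetric] by (intro prod.cong refl) (auto simp: min_def)

lemma sum_kernel_prod:
  assumes "kern Cs \<kappa>"
  shows "(\<Sum>t\<in>listset Cs. \<Prod>j<length t. \<kappa> (take j t) (t ! j)) = 1"
  using assms
proof (induction Cs arbitrary: \<kappa>)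
  case Nil then show ?case by simp
next
  case (Cons A As)
  have k: "kern As (\<lambda>pre. \<kappa> (x # pre))" for x
    using Cons.prems unfolding kern_def by (metis Suc_less_eq length_Cons nth_Cons_Suc)
  have "(\<Sum>x\<in>A. \<kappa> [] x) = 1" using Cons.prems unfolding kern_def by (metis length_Cons list.size(3) nth_Cons_0 zero_less_Suc)
  moreover have "(\<Sum>t\<in>listset (A # As). \<Prod>j<length t. \<kappa> (take j t) (t ! j))
      = (\<Sum>x\<in>A. \<Sum>t\<in>listset As. \<kappa> [] x * (\<Prod>j<length t. \<kappa> (x # take j t) (t ! j)))"
    unfolding sum_listset_Cons by (intro sum.cong refl) (simp add: prod.lessThan_Suc_shift del: prod.lessThan_Suc)
  moreover have "\<dots> = (\<Sum>x\<in>A. \<kappa> [] x * 1)"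
    unfolding sum_distrib_left[symmetric] using Cons.IH[OF k] by simp
  ultimately show ?case by simp
qed

text \<open>Switching between two kernels according to the parity of the prefix length gives a
  kernel again.\<close>

lemma sum_parity_prod:
  assumes "kern Cs \<kappa>" "kern Cs \<kappa>'"
  shows "(\<Sum>t\<in>listset Cs. parity_prod True \<kappa> t * parity_prod False \<kappa>' t) = 1"
  unfolding parity_prod_mult
  by (rule sum_kernel_prod[of Cs "\<lambda>pre. (if odd (length pre) then \<kappa> else \<kappa>') pre"])
     (use assms in \<open>auto simp: kern_def\<close>)

definition prefix_mass :: "'m set list \<Rightarrow> ('m list \<Rightarrow> real) \<Rightarrow> 'm list \<Rightarrow> real" where
  "prefix_mass Cs F pre = (\<Sum>t\<in>listset Cs. F t * of_bool (take (length pre) t = pre))"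

text \<open>The conditional law of the next entry under the weight \<open>F\<close>. After a null
  prefix it is a point mass at an arbitrary letter, so that it is normalized there as well.\<close>

definition prefix_kernel :: "'m set list \<Rightarrow> ('m list \<Rightarrow> real) \<Rightarrow> 'm list \<Rightarrow> 'm \<Rightarrow> real" where
  "prefix_kernel Cs F pre z = (if prefix_mass Cs F pre = 0 then of_bool (z = (SOME z. z \<in> Cs ! length pre))
     else prefix_mass Cs F (pre @ [z]) / prefix_mass Cs F pre)"

lemma prefix_mass_nonneg: "(\<And>t. 0 \<le> F t) \<Longrightarrow> 0 \<le> prefix_mass Cs F pre"
  unfolding prefix_mass_def by (intro sum_nonneg) auto

lemma prefix_mass_step:
  assumes fin: "\<forall>A\<in>set Cs. finite A" and l: "length pre < length Cs"
  shows "(\<Sum>z\<in>Cs ! length pre. prefix_mass Cs F (pre @ [z])) = prefix_mass Cs F pre"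
proof -
  have f: "finite (Cs ! length pre)" using fin l by auto
  have "(\<Sum>z\<in>Cs ! length pre. prefix_mass Cs F (pre @ [z])) =
     (\<Sum>t\<in>listset Cs. \<Sum>z\<in>Cs ! length pre. F t * of_bool (take (Suc (length pre)) t = pre @ [z]))"
    unfolding prefix_mass_def by (subst sum.swap) simp
  also have "\<dots> = (\<Sum>t\<in>listset Cs. F t * of_bool (take (length pre) t = pre))"
  proof (intro sum.cong refl)
    fix t assume "t \<in> listset Cs"
    then have t: "length pre < length t" "t ! length pre \<in> Cs ! length pre" using l by (auto simp: listset_conv)
    have "(\<Sum>z\<in>Cs ! length pre. F t * of_bool (take (Suc (length pre)) t = pre @ [z]))
      = (\<Sum>z\<in>Cs ! length pre. if z = t ! length pre then F t * of_bool (take (length pre) t = pre) else 0)"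
      using t by (intro sum.cong refl) (auto simp: take_Suc_conv_app_nth)
    then show "(\<Sum>z\<in>Cs ! length pre. F t * of_bool (take (Suc (length pre)) t = pre @ [z]))
      = F t * of_bool (take (length pre) t = pre)" using t f by simp
  qed
  finally show ?thesis unfolding prefix_mass_def .
qed

lemma kern_prefix_kernel:
  assumes fin: "\<forall>A\<in>set Cs. finite A" and ne: "listset Cs \<noteq> {}" and F: "\<And>t. 0 \<le> F t"
  shows "kern Cs (prefix_kernel Cs F)"
  unfolding kern_def
proof (intro conjI allI impI)
  fix pre z
  have "0 \<le> prefix_mass Cs F p" for p by (rule prefix_mass_nonneg) (rule F)
  then show "0 \<le> prefix_kernel Cs F pre z" unfolding prefix_kernel_def by simp
next
  fix pre :: "'a list" assume l: "length pre < length Cs"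
  have f: "finite (Cs ! length pre)" using fin l by auto
  obtain t where "t \<in> listset Cs" using ne by blast
  then have "t ! length pre \<in> Cs ! length pre" using l by (simp add: listset_conv)
  then have n: "Cs ! length pre \<noteq> {}" by blast
  show "(\<Sum>z\<in>Cs ! length pre. prefix_kernel Cs F pre z) = 1"
  proof (cases "prefix_mass Cs F pre = 0")
    case True
    then show ?thesis unfolding prefix_kernel_def using f n some_in_eq[of "Cs ! length pre"] by simp
  next
    case False
    then show ?thesis unfolding prefix_kernel_def using prefix_mass_step[OF fin l, of F] by (simp add: sum_divide_distrib[symmetric])
  qed
qed

lemma prefix_mass_full:
  assumes "\<forall>A\<in>set Cs. finite A" "t \<in> listset Cs"
  shows "prefix_mass Cs F t = F t"
proof -
  have "prefix_mass Cs F t = (\<Sum>t'\<in>listset Cs. if t' = t then F t else 0)"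
    unfolding prefix_mass_def using assms by (intro sum.cong refl) (auto simp: listset_conv)
  also have "\<dots> = F t" using assms(2) finite_listset[OF assms(1)] by simp
  finally show ?thesis .
qed

lemma prefix_mass_take_pos:
  assumes "\<forall>A\<in>set Cs. finite A" "t \<in> listset Cs" "\<And>t. 0 \<le> F t" "0 < F t"
  shows "0 < prefix_mass Cs F (take j t)"
proof -
  have "F t \<le> prefix_mass Cs F (take j t)"
    unfolding prefix_mass_def using assms finite_listset
    by (intro order_trans[OF _ member_le_sum[of t]]) (auto simp: min_def)
  then show ?thesis using assms by linarith
qed

text \<open>The quotients of consecutive prefix masses telescope. One half protocol uses only
  Alice's factors of this kernel and the other only Bob's; multiplied together they restore the
  whole normalized weight.\<close>

lemma parity_prod_prefix_kernel:
  assumes fin: "\<forall>A\<in>set Cs. finite A" and t: "t \<in> listset Cs" and F: "\<And>t. 0 \<le> F t" "0 < F t"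
  shows "parity_prod True (prefix_kernel Cs F) t * parity_prod False (prefix_kernel Cs F) t = F t / (\<Sum>t\<in>listset Cs. F t)"
proof -
  have pos: "0 < prefix_mass Cs F (take j t)" for j by (rule prefix_mass_take_pos[OF fin t]) (rule F)+
  have "parity_prod True (prefix_kernel Cs F) t * parity_prod False (prefix_kernel Cs F) t = (\<Prod>j<length t. prefix_kernel Cs F (take j t) (t ! j))"
    unfolding parity_prod_mult by simp
  also have "\<dots> = (\<Prod>j<length t. prefix_mass Cs F (take (Suc j) t) / prefix_mass Cs F (take j t))"
  proof (intro prod.cong refl)
    fix j assume "j \<in> {..<length t}"
    then show "prefix_kernel Cs F (take j t) (t ! j) = prefix_mass Cs F (take (Suc j) t) / prefix_mass Cs F (take j t)"
      unfolding prefix_kernel_def using pos[of j] by (simp add: take_Suc_conv_app_nth)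
  qed
  also have "\<dots> = prefix_mass Cs F (take (length t) t) / prefix_mass Cs F (take 0 t)"
    by (rule prod_lessThan_telescope) (use pos in \<open>metis less_irrefl\<close>)
  also have "\<dots> = F t / (\<Sum>t\<in>listset Cs. F t)" using prefix_mass_full[OF fin t, of F] by (simp add: prefix_mass_def)
  finally show ?thesis .
qed

text \<open>
  A transcript is \<open>(m\<^sub>0, m\<^sub>1, t)\<close> with \<open>t ! j\<close> the message \<open>m\<^bsub>j + 2\<^esub>\<close>, so that Alice sends the odd entries of \<open>t\<close>.
  The first two components are lists because every splitting step prepends an input word to one of them.
\<close>

type_synonym trans = "nat list list \<times> nat list list \<times> nat list"

text \<open>\<open>u\<close> is the public randomness with law \<open>\<rho>\<close> and
  \<open>v\<close> is Alice's first message with law \<open>\<alpha>\<close>. They stand apart from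
  the kernels because they are the components whose alphabets change in a split.\<close>

definition prot_by ::
  "'x set \<Rightarrow> 'y set \<Rightarrow> nat set list \<Rightarrow> ('x \<Rightarrow> 'y \<Rightarrow> real) \<Rightarrow> nat list list set \<Rightarrow> nat list list set
     \<Rightarrow> ('x \<Rightarrow> 'y \<Rightarrow> trans \<Rightarrow> real) \<Rightarrow> (nat list list \<Rightarrow> real) \<Rightarrow> ('x \<Rightarrow> nat list list \<Rightarrow> nat list list \<Rightarrow> real)
     \<Rightarrow> ('x \<Rightarrow> nat list list \<Rightarrow> nat list list \<Rightarrow> nat list \<Rightarrow> nat \<Rightarrow> real)
     \<Rightarrow> ('y \<Rightarrow> nat list list \<Rightarrow> nat list list \<Rightarrow> nat list \<Rightarrow> nat \<Rightarrow> real) \<Rightarrow> bool" where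
  "prot_by X Y Cs \<mu> U V P \<rho> \<alpha> \<kappa> \<kappa>' \<longleftrightarrow>
     (\<forall>u. 0 \<le> \<rho> u) \<and> (\<Sum>u\<in>U. \<rho> u) = 1 \<and>
     (\<forall>x u v. 0 \<le> \<alpha> x u v) \<and> (\<forall>x\<in>X. \<forall>u\<in>U. (\<Sum>v\<in>V. \<alpha> x u v) = 1) \<and>
     (\<forall>x\<in>X. \<forall>u\<in>U. \<forall>v\<in>V. kern Cs (\<kappa> x u v)) \<and>
     (\<forall>y\<in>Y. \<forall>u\<in>U. \<forall>v\<in>V. kern Cs (\<kappa>' y u v)) \<and>
     (\<forall>x\<in>X. \<forall>y\<in>Y. \<forall>u\<in>U. \<forall>v\<in>V. \<forall>t\<in>listset Cs. P x y (u, v, t) =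
        \<mu> x y * \<rho> u * \<alpha> x u v * (parity_prod True (\<kappa> x u v) t * parity_prod False (\<kappa>' y u v) t))"

lemma prot_byD:
  assumes "prot_by X Y Cs \<mu> U V P \<rho> \<alpha> \<kappa> \<kappa>'"
  shows "0 \<le> \<rho> u" "(\<Sum>u\<in>U. \<rho> u) = 1" "0 \<le> \<alpha> x u v"
    "x \<in> X \<Longrightarrow> u \<in> U \<Longrightarrow> (\<Sum>v\<in>V. \<alpha> x u v) = 1"
    "x \<in> X \<Longrightarrow> u \<in> U \<Longrightarrow> v \<in> V \<Longrightarrow> kern Cs (\<kappa> x u v)"
    "y \<in> Y \<Longrightarrow> u \<in> U \<Longrightarrow> v \<in> V \<Longrightarrow> kern Cs (\<kappa>' y u v)"
    "x \<in> X \<Longrightarrow> y \<in> Y \<Longrightarrow> u \<in> U \<Longrightarrow> v \<in> V \<Longrightarrow> t \<in> listset Cs \<Longrightarrow> P x y (u, v, t) =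
        \<mu> x y * \<rho> u * \<alpha> x u v * (parity_prod True (\<kappa> x u v) t * parity_prod False (\<kappa>' y u v) t)"
  using assms unfolding prot_by_def by blast+

definition prot ::
  "'x set \<Rightarrow> 'y set \<Rightarrow> nat set list \<Rightarrow> ('x \<Rightarrow> 'y \<Rightarrow> real) \<Rightarrow> nat list list set \<Rightarrow> nat list list set
     \<Rightarrow> ('x \<Rightarrow> 'y \<Rightarrow> trans \<Rightarrow> real) \<Rightarrow> bool" where
  "prot X Y Cs \<mu> U V P \<longleftrightarrow> (\<exists>\<rho> \<alpha> \<kappa> \<kappa>'. prot_by X Y Cs \<mu> U V P \<rho> \<alpha> \<kappa> \<kappa>')"

lemma prot_sum:
  assumes "prot X Y Cs \<mu> U V P"
  shows "(\<Sum>x\<in>X. \<Sum>y\<in>Y. \<Sum>m\<in>U \<times> V \<times> listset Cs. P x y m) = (\<Sum>x\<in>X. \<Sum>y\<in>Y. \<mu> x y)"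
proof (intro sum.cong refl)
  fix x y assume xy: "x \<in> X" "y \<in> Y"
  from assms obtain \<rho> \<alpha> \<kappa> \<kappa>' where "prot_by X Y Cs \<mu> U V P \<rho> \<alpha> \<kappa> \<kappa>'" unfolding prot_def by blast
  note p = prot_byD[OF this]
  have "(\<Sum>m\<in>U \<times> V \<times> listset Cs. P x y m) =
      (\<Sum>u\<in>U. \<Sum>v\<in>V. \<mu> x y * \<rho> u * \<alpha> x u v * (\<Sum>t\<in>listset Cs. parity_prod True (\<kappa> x u v) t * parity_prod False (\<kappa>' y u v) t))"
    using p(7)[OF xy] unfolding sum.cartesian_product' sum_distrib_left by (intro sum.cong refl) auto
  also have "\<dots> = (\<Sum>u\<in>U. \<mu> x y * \<rho> u * (\<Sum>v\<in>V. \<alpha> x u v))"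
    unfolding sum_distrib_left[of "\<mu> x y * \<rho> _" "\<lambda>v. \<alpha> x _ v"]
    by (intro sum.cong refl) (simp add: sum_parity_prod[OF p(5)[OF xy(1)] p(6)[OF xy(2)]])
  also have "\<dots> = \<mu> x y * (\<Sum>u\<in>U. \<rho> u)"
    using p(4)[OF xy(1)] by (simp add: sum_distrib_left)
  finally show "(\<Sum>m\<in>U \<times> V \<times> listset Cs. P x y m) = \<mu> x y" using p(2) by simp
qed

lemma prot_nonneg:
  assumes "prot X Y Cs \<mu> U V P" "\<And>x y. 0 \<le> \<mu> x y" "x \<in> X" "y \<in> Y" "m \<in> U \<times> V \<times> listset Cs"
  shows "0 \<le> P x y m"
proof -
  obtain u v t where m: "m = (u, v, t)" "u \<in> U" "v \<in> V" "t \<in> listset Cs" using assms(5) by auto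
  from assms(1) obtain \<rho> \<alpha> \<kappa> \<kappa>' where "prot_by X Y Cs \<mu> U V P \<rho> \<alpha> \<kappa> \<kappa>'" unfolding prot_def by blast
  note p = prot_byD[OF this]
  have "0 \<le> parity_prod True (\<kappa> x u v) t" "0 \<le> parity_prod False (\<kappa>' y u v) t"
    using p(5,6) assms m by (auto intro!: parity_prod_nonneg simp: kern_def)
  then show ?thesis using p(1,3) p(7)[OF assms(3,4) m(2-4)] assms(2) m by simp
qed

text \<open>Half protocols are analyzed with labels \<open>(y2, m)\<close> or
  \<open>(x1, m)\<close>, whereas their transcripts store the extra word at the head of the first
  message or of the public randomness. The cost is indifferent to this renaming.\<close>

lemma cheap_relabel:
  assumes "\<And>w. w \<in> W \<Longrightarrow> \<psi> (\<phi> w) = w"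
    and "cheap I X Y W \<mu> h (\<lambda>x y w. P x y (\<phi> w)) q t"
  shows "cheap I X Y (\<phi> ` W) \<mu> h P (\<lambda>x y m. q x y (\<psi> m)) t"
  unfolding cheap_def
proof (intro ballI impI)
  fix x y m assume "x \<in> X" "y \<in> Y" "m \<in> \<phi> ` W" "0 < q x y (\<psi> m)"
  then obtain w where w: "w \<in> W" "m = \<phi> w" "0 < q x y w" using assms(1) by auto
  have "info_cost I X Y \<mu> P (\<lambda>x y m. q x y (\<psi> m)) x y m = info_cost I X Y \<mu> (\<lambda>x y w. P x y (\<phi> w)) q x y w"
    "bias X Y h (\<lambda>x y m. q x y (\<psi> m)) m = bias X Y h q w"
    unfolding w(2) info_cost_def bias_def assms(1)[OF w(1)] by simp_all
  then show "0 < P x y m \<and> 0 < bias X Y h (\<lambda>x y m. q x y (\<psi> m)) m \<and>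
      info_cost I X Y \<mu> P (\<lambda>x y m. q x y (\<psi> m)) x y m - 180 * I * log 2 (bias X Y h (\<lambda>x y m. q x y (\<psi> m)) m) \<le> t"
    using assms(2) w \<open>x \<in> X\<close> \<open>y \<in> Y\<close> unfolding cheap_def by simp
qed

lemma finite_words: "finite X \<Longrightarrow> finite (words n X)"
  unfolding words_def by (rule finite_lists_length_eq)

lemma words_append:
  "words (a + b) X = (\<lambda>(x1, x2). x1 @ x2) ` (words a X \<times> words b X)"
proof (intro equalityI subsetI)
  fix x assume x: "x \<in> words (a + b) X"
  have "x = (\<lambda>(x1, x2). x1 @ x2) (take a x, drop a x)" by simp
  moreover have "take a x \<in> words a X" "drop a x \<in> words b X"
    using x by (auto simp: words_def dest: in_set_takeD in_set_dropD)
  ultimately show "x \<in> (\<lambda>(x1, x2). x1 @ x2) ` (words a X \<times> words b X)" by blast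
qed (auto simp: words_def)

lemma append_in_words: "x1 \<in> words a X \<Longrightarrow> x2 \<in> words b X \<Longrightarrow> x1 @ x2 \<in> words (a + b) X"
  unfolding words_append by blast

lemma sum_words_append:
  "(\<Sum>x\<in>words (a + b) X. f x) = (\<Sum>x1\<in>words a X. \<Sum>x2\<in>words b X. f (x1 @ x2))"
proof -
  have "inj_on (\<lambda>(x1, x2). x1 @ x2) (words a X \<times> words b X)" by (auto simp: inj_on_def words_def)
  then show ?thesis unfolding words_append by (subst sum.reindex) (simp_all add: sum.cartesian_product')
qed

section \<open>Splitting a protocol\<close>

text \<open>\<open>U\<close> and \<open>V\<close> are existentially quantified while
  \<open>Cs\<close> is fixed: public randomness and first message may change their alphabets, the
  later messages may not.\<close>

definition achievable ::
  "real \<Rightarrow> 'x set \<Rightarrow> 'y set \<Rightarrow> ('x \<Rightarrow> 'y \<Rightarrow> bool) \<Rightarrow> ('x \<Rightarrow> 'y \<Rightarrow> real) \<Rightarrow> nat set list \<Rightarrow> real \<Rightarrow> bool" where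
  "achievable I X Y h \<mu> Cs t \<longleftrightarrow> (\<exists>U V P A B. finite U \<and> finite V \<and> prot X Y Cs \<mu> U V P \<and>
     (\<forall>x m. 0 \<le> A x m) \<and> (\<forall>y m. 0 \<le> B y m) \<and>
     (\<Sum>x\<in>X. \<Sum>y\<in>Y. \<Sum>m\<in>U \<times> V \<times> listset Cs. \<mu> x y * A x m * B y m) = 1 \<and>
     cheap I X Y (U \<times> V \<times> listset Cs) \<mu> h P (\<lambda>x y m. \<mu> x y * A x m * B y m) t)"

lemma achievableI:
  assumes W: "\<And>w. w \<in> W \<Longrightarrow> \<psi> (\<phi> w) = w" "\<phi> ` W = U \<times> V \<times> listset Cs"
    and fin: "finite U" "finite V" and pr: "prot X Y Cs \<mu> U V P"
    and AB: "\<And>x w. 0 \<le> A x w" "\<And>y w. 0 \<le> B y w"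
    and q: "\<And>x y w. q x y w = \<mu> x y * A x w * B y w"
    and total: "(\<Sum>x\<in>X. \<Sum>y\<in>Y. \<Sum>w\<in>W. q x y w) = 1"
    and ch: "cheap I X Y W \<mu> h (\<lambda>x y w. P x y (\<phi> w)) q t"
  shows "achievable I X Y h \<mu> Cs t"
proof -
  have inj: "inj_on \<phi> W" using W(1) by (metis inj_onI)
  have "(\<Sum>m\<in>U \<times> V \<times> listset Cs. q x y (\<psi> m)) = (\<Sum>w\<in>W. q x y w)" for x y
    unfolding W(2)[symmetric] using W(1) by (subst sum.reindex[OF inj]) simp
  then have "(\<Sum>x\<in>X. \<Sum>y\<in>Y. \<Sum>m\<in>U \<times> V \<times> listset Cs. \<mu> x y * A x (\<psi> m) * B y (\<psi> m)) = 1"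
    using total unfolding q by simp
  moreover have "cheap I X Y (U \<times> V \<times> listset Cs) \<mu> h P (\<lambda>x y m. \<mu> x y * A x (\<psi> m) * B y (\<psi> m)) t"
    using cheap_relabel[of W \<psi> \<phi> I X Y \<mu> h P q t, OF _ ch] W(1) unfolding W(2) q by blast
  ultimately show ?thesis unfolding achievable_def using fin pr AB
    by (intro exI[of _ U] exI[of _ V] exI[of _ P] exI[of _ "\<lambda>x m. A x (\<psi> m)"] exI[of _ "\<lambda>y m. B y (\<psi> m)"]) blast
qed

text \<open>\<open>V\<close> is both the sum of \<open>l1\<close> over \<open>y1\<close> and the sum
  of \<open>l2\<close> over \<open>x2\<close>. By \<open>a * V = l1 * l2\<close> the product of
  \<open>l1 / N1\<close> and \<open>l2 / V\<close> is \<open>a / N1\<close>, that of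
  \<open>l1 / V\<close> and \<open>l2 / N2\<close> is \<open>a / N2\<close>, and in the last term
  \<open>V\<close> cancels against \<open>P1 * P2 = P * V\<close>.\<close>

lemma cost_additive:
  fixes a V N1 N2 :: real
  assumes "0 < a" "0 < l1" "0 < l2" "0 < V" "0 < N1" "0 < N2" "0 < m1" "0 < m2" "0 < n1" "0 < n2"
    "0 < \<mu>1" "0 < \<mu>2" "0 < P" "0 < P1" "0 < P2" "a * V = l1 * l2" "P1 * P2 = P * V"
  shows "log 2 (a / N1 / (\<mu>1 * \<mu>2 / (m1 * m2))) + log 2 (a / N2 / (\<mu>1 * \<mu>2 / (n1 * n2))) + I * log 2 (a / P) =
    (log 2 (l1 / N1 / (\<mu>1 / m1)) + log 2 (l1 / V / (\<mu>1 / n1)) + I * log 2 (l1 / P1)) +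
    (log 2 (l2 / V / (\<mu>2 / m2)) + log 2 (l2 / N2 / (\<mu>2 / n2)) + I * log 2 (l2 / P2))"
proof -
  have m: "log 2 (x * y) = log 2 x + log 2 y" if "0 < x" "0 < y" for x y :: real
    using that by (simp add: log_mult)
  have "log 2 (a * V) = log 2 (l1 * l2)" "log 2 (P1 * P2) = log 2 (P * V)"
    unfolding assms(16,17) by (rule refl)+
  then have e: "log 2 a = log 2 l1 + log 2 l2 - log 2 V" "log 2 P = log 2 P1 + log 2 P2 - log 2 V"
    unfolding m[OF assms(1,4)] m[OF assms(2,3)] m[OF assms(14,15)] m[OF assms(13,4)] by simp_all
  have f: "log 2 (x / y / (z / w)) = log 2 x - log 2 y - log 2 z + log 2 w"
    if "0 < x" "0 < y" "0 < z" "0 < w" for x y z w :: real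
    using that by (simp add: log_divide log_mult)
  have g: "log 2 (x / y) = log 2 x - log 2 y" if "0 < x" "0 < y" for x y :: real
    using that by (simp add: log_divide)
  show ?thesis using assms(1-15) by (simp add: f g e log_mult algebra_simps)
qed

lemma sum_rotate3:
  "(\<Sum>b\<in>B. \<Sum>c\<in>C. \<Sum>d\<in>D. f b c d) = (\<Sum>d\<in>D. \<Sum>b\<in>B. \<Sum>c\<in>C. f b c d)"
proof -
  have "(\<Sum>b\<in>B. \<Sum>c\<in>C. \<Sum>d\<in>D. f b c d) = (\<Sum>b\<in>B. \<Sum>d\<in>D. \<Sum>c\<in>C. f b c d)"
    by (intro sum.cong refl sum.swap)
  also have "\<dots> = (\<Sum>d\<in>D. \<Sum>b\<in>B. \<Sum>c\<in>C. f b c d)" by (rule sum.swap)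
  finally show ?thesis .
qed

text \<open>
  In the protocol for the first half Alice samples \<open>y2\<close> together with \<open>m\<^sub>1\<close>, and from then on her messages, from
  their law under \<open>q\<close> given \<open>x1\<close> and \<open>y2\<close>, while Bob follows the original protocol.  In the one for the second half
  \<open>x1\<close> is public randomness and the roles are exchanged.  The product of the two transcript laws is the original
  one times the marginal of \<open>q\<close> on \<open>(x1, y2, m)\<close>, hence the costs add up.
\<close>

lemma achievable_split:
  fixes X Y :: "nat set" and \<mu> \<mu>1 \<mu>2 :: "nat list \<Rightarrow> nat list \<Rightarrow> real"
  assumes I: "1 \<le> I" and finXY: "finite X" "finite Y" and finC: "\<forall>C\<in>set Cs. finite C"
    and mu: "\<And>x1 x2 y1 y2. x1 \<in> words a X \<Longrightarrow> x2 \<in> words b X \<Longrightarrow> y1 \<in> words a Y \<Longrightarrow> y2 \<in> words b Y \<Longrightarrow>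
      \<mu> (x1 @ x2) (y1 @ y2) = \<mu>1 x1 y1 * \<mu>2 x2 y2"
    and h: "\<And>x1 x2 y1 y2. x1 \<in> words a X \<Longrightarrow> x2 \<in> words b X \<Longrightarrow> y1 \<in> words a Y \<Longrightarrow> y2 \<in> words b Y \<Longrightarrow>
      h (x1 @ x2) (y1 @ y2) = (h1 x1 y1 \<noteq> h2 x2 y2)"
    and mu_nn: "\<And>x y. 0 \<le> \<mu>1 x y" "\<And>x y. 0 \<le> \<mu>2 x y"
    and mu_le: "(\<Sum>x\<in>words a X. \<Sum>y\<in>words a Y. \<mu>1 x y) \<le> 1" "(\<Sum>x\<in>words b X. \<Sum>y\<in>words b Y. \<mu>2 x y) \<le> 1"
    and g: "achievable I (words (a + b) X) (words (a + b) Y) h \<mu> Cs Mb"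
  shows "\<exists>t1 t2. achievable I (words a X) (words a Y) h1 \<mu>1 Cs t1 \<and> achievable I (words b X) (words b Y) h2 \<mu>2 Cs t2 \<and>
     t1 + t2 \<le> Mb + 5000 * I * (1 + log2_plus (Mb / I))"
proof -
  let ?X1 = "words a X" and ?X2 = "words b X" and ?Y1 = "words a Y" and ?Y2 = "words b Y"
  let ?XX = "words (a + b) X" and ?YY = "words (a + b) Y"
  define L where "L = listset Cs"
  have finL: "finite L" unfolding L_def using finC by (rule finite_listset)
  have finw: "finite ?X1" "finite ?X2" "finite ?Y1" "finite ?Y2" "finite ?XX" "finite ?YY"
    using finXY by (simp_all add: finite_words)
  obtain U V P A B where fin: "finite U" "finite V" and pr: "prot ?XX ?YY Cs \<mu> U V P"
    and AB: "\<And>x m. 0 \<le> A x m" "\<And>y m. 0 \<le> B y m"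
    and total: "(\<Sum>x\<in>?XX. \<Sum>y\<in>?YY. \<Sum>m\<in>U \<times> V \<times> L. \<mu> x y * A x m * B y m) = 1"
    and ch: "cheap I ?XX ?YY (U \<times> V \<times> L) \<mu> h P (\<lambda>x y m. \<mu> x y * A x m * B y m) Mb"
    using g unfolding achievable_def L_def by blast
  define M where "M = U \<times> V \<times> L"
  have finM: "finite M" unfolding M_def using fin finL by simp
  obtain \<rho> \<alpha> \<kappa> \<kappa>' where "prot_by ?XX ?YY Cs \<mu> U V P \<rho> \<alpha> \<kappa> \<kappa>'" using pr unfolding prot_def by blast
  note p = prot_byD[OF this]
  define q where "q x1 x2 y1 y2 m = \<mu>1 x1 y1 * \<mu>2 x2 y2 * A (x1 @ x2) m * B (y1 @ y2) m" for x1 x2 y1 y2 m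
  have qnn: "0 \<le> q x1 x2 y1 y2 m" for x1 x2 y1 y2 m unfolding q_def using mu_nn AB by simp
  have qeq: "\<mu> (x1 @ x2) (y1 @ y2) * A (x1 @ x2) m * B (y1 @ y2) m = q x1 x2 y1 y2 m"
    if "x1 \<in> ?X1" "x2 \<in> ?X2" "y1 \<in> ?Y1" "y2 \<in> ?Y2" for x1 x2 y1 y2 m
    unfolding q_def mu[OF that] ..
  \<comment> \<open>With \<open>y2\<close> in the label, \<open>x2\<close> can be summed out inside
    Alice's factor; with \<open>x1\<close> in the label, \<open>y1\<close> can be summed out inside
    Bob's.\<close>
  define A1 where "A1 x1 w = (\<Sum>x2\<in>?X2. \<mu>2 x2 (fst w) * A (x1 @ x2) (snd w))" for x1 and w :: "nat list \<times> trans"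
  define B1 where "B1 y1 w = B (y1 @ fst w) (snd w)" for y1 and w :: "nat list \<times> trans"
  define A2 where "A2 x2 w = A (fst w @ x2) (snd w)" for x2 and w :: "nat list \<times> trans"
  define B2 where "B2 y2 w = (\<Sum>y1\<in>?Y1. \<mu>1 (fst w) y1 * B (y1 @ y2) (snd w))" for y2 and w :: "nat list \<times> trans"
  define l1 where "l1 x1 y1 w = \<mu>1 x1 y1 * A1 x1 w * B1 y1 w" for x1 y1 w
  define l2 where "l2 x2 y2 w = \<mu>2 x2 y2 * A2 x2 w * B2 y2 w" for x2 y2 w
  define Vf where "Vf x1 y2 m = (\<Sum>x2\<in>?X2. \<Sum>y1\<in>?Y1. q x1 x2 y1 y2 m)" for x1 y2 m
  have A1nn: "0 \<le> A1 x w" "0 \<le> A2 x w" for x w unfolding A1_def A2_def by (intro sum_nonneg mult_nonneg_nonneg mu_nn AB)+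
  have B1nn: "0 \<le> B1 x w" "0 \<le> B2 x w" for x w unfolding B1_def B2_def by (intro sum_nonneg mult_nonneg_nonneg mu_nn AB)+
  have l1: "l1 x1 y1 (y2, m) = (\<Sum>x2\<in>?X2. q x1 x2 y1 y2 m)" for x1 y1 y2 m
    unfolding l1_def A1_def B1_def q_def by (simp add: sum_distrib_left sum_distrib_right mult_ac)
  have l2: "l2 x2 y2 (x1, m) = (\<Sum>y1\<in>?Y1. q x1 x2 y1 y2 m)" for x1 x2 y2 m
    unfolding l2_def A2_def B2_def q_def by (simp add: sum_distrib_left sum_distrib_right mult_ac)
  have Vprod: "Vf x1 y2 m = A1 x1 (y2, m) * B2 y2 (x1, m)" for x1 y2 m
    unfolding Vf_def A1_def B2_def q_def sum_product by (intro sum.cong refl) (simp add: mult_ac)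
  have CI: "q x1 x2 y1 y2 m * Vf x1 y2 m = l1 x1 y1 (y2, m) * l2 x2 y2 (x1, m)" for x1 x2 y1 y2 m
    unfolding Vprod l1_def l2_def q_def B1_def A2_def by (simp add: mult_ac)
  have Vnn: "0 \<le> Vf x1 y2 m" for x1 y2 m unfolding Vprod using A1nn B1nn by simp
  have total': "(\<Sum>x1\<in>?X1. \<Sum>x2\<in>?X2. \<Sum>y1\<in>?Y1. \<Sum>y2\<in>?Y2. \<Sum>m\<in>M. q x1 x2 y1 y2 m) = 1"
    using total unfolding sum_words_append M_def[symmetric] by (simp add: qeq)
  have Vtotal: "(\<Sum>x1\<in>?X1. \<Sum>y2\<in>?Y2. \<Sum>m\<in>M. Vf x1 y2 m) = 1"
  proof -
    have "(\<Sum>y2\<in>?Y2. \<Sum>m\<in>M. Vf x1 y2 m) = (\<Sum>x2\<in>?X2. \<Sum>y1\<in>?Y1. \<Sum>y2\<in>?Y2. \<Sum>m\<in>M. q x1 x2 y1 y2 m)" for x1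
    proof -
      have "(\<Sum>y2\<in>?Y2. \<Sum>m\<in>M. Vf x1 y2 m) = (\<Sum>y2\<in>?Y2. \<Sum>x2\<in>?X2. \<Sum>m\<in>M. \<Sum>y1\<in>?Y1. q x1 x2 y1 y2 m)"
        unfolding Vf_def by (intro sum.cong refl sum.swap)
      also have "\<dots> = (\<Sum>y2\<in>?Y2. \<Sum>x2\<in>?X2. \<Sum>y1\<in>?Y1. \<Sum>m\<in>M. q x1 x2 y1 y2 m)"
        by (intro sum.cong refl sum.swap)
      also have "\<dots> = (\<Sum>x2\<in>?X2. \<Sum>y2\<in>?Y2. \<Sum>y1\<in>?Y1. \<Sum>m\<in>M. q x1 x2 y1 y2 m)" by (rule sum.swap)
      also have "\<dots> = (\<Sum>x2\<in>?X2. \<Sum>y1\<in>?Y1. \<Sum>y2\<in>?Y2. \<Sum>m\<in>M. q x1 x2 y1 y2 m)"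
        by (intro sum.cong refl sum.swap)
      finally show ?thesis .
    qed
    then show ?thesis using total' by simp
  qed
  have "M \<noteq> {}" "?Y2 \<noteq> {}" "?X1 \<noteq> {}" using Vtotal by auto
  then obtain y0 u0 v0 t0 where ne: "y0 \<in> ?Y2" "u0 \<in> U" "v0 \<in> V" "t0 \<in> L" unfolding M_def by auto
  define Vuv where "Vuv x1 y2 u v = (\<Sum>t\<in>L. Vf x1 y2 (u, v, t))" for x1 y2 u v
  define Vxu where "Vxu x1 u = (\<Sum>y2\<in>?Y2. \<Sum>v\<in>V. Vuv x1 y2 u v)" for x1 u
  have Vuvnn: "0 \<le> Vuv x1 y2 u v" for x1 y2 u v unfolding Vuv_def using Vnn by (intro sum_nonneg) auto
  have Vxunn: "0 \<le> Vxu x1 u" for x1 u unfolding Vxu_def using Vuvnn by (intro sum_nonneg) auto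
  define V1 where "V1 = (\<lambda>(y2, v). y2 # v) ` (?Y2 \<times> V)"
  define U2 where "U2 = (\<lambda>(x1, u). x1 # u) ` (?X1 \<times> U)"
  have finVU: "finite V1" "finite U2" unfolding V1_def U2_def using finw fin by auto
  \<comment> \<open>The law of \<open>y2\<close> and the old first message given \<open>x1\<close>
    and \<open>u\<close> under \<open>q\<close>. Where \<open>(x1, u)\<close> is null, the point
    mass at \<open>y0 # v0\<close> keeps it normalized.\<close>
  define \<alpha>1 where "\<alpha>1 x1 u v' = (if Vxu x1 u = 0 then of_bool (v' = y0 # v0) else Vuv x1 (hd v') u (tl v') / Vxu x1 u)" for x1 u v'
  define kV where "kV x1 y2 u v = prefix_kernel Cs (\<lambda>t. Vf x1 y2 (u, v, t))" for x1 y2 u v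
  have neL: "listset Cs \<noteq> {}" using ne(4) L_def by blast
  have kernV: "kern Cs (kV x1 y2 u v)" for x1 y2 u v
    unfolding kV_def by (rule kern_prefix_kernel[OF finC neL Vnn])
  have sumV1: "(\<Sum>v'\<in>V1. f v') = (\<Sum>y2\<in>?Y2. \<Sum>v\<in>V. f (y2 # v))" for f :: "_ \<Rightarrow> real"
    unfolding V1_def by (subst sum.reindex) (auto simp: inj_on_def sum.cartesian_product')
  have sumU2: "(\<Sum>u'\<in>U2. f u') = (\<Sum>x1\<in>?X1. \<Sum>u\<in>U. f (x1 # u))" for f :: "_ \<Rightarrow> real"
    unfolding U2_def by (subst sum.reindex) (auto simp: inj_on_def sum.cartesian_product')
  \<comment> \<open>In \<open>P1\<close> the word \<open>y2\<close> is \<open>hd v'\<close> and the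
    old first message is \<open>tl v'\<close>; in \<open>P2\<close> the word \<open>x1\<close> is
    \<open>hd u'\<close> and the old public randomness is \<open>tl u'\<close>.\<close>
  define P1 where "P1 x1 y1 = (\<lambda>(u, v', t). \<mu>1 x1 y1 * \<rho> u * \<alpha>1 x1 u v' *
     (parity_prod True (kV x1 (hd v') u (tl v')) t * parity_prod False (\<kappa>' (y1 @ hd v') u (tl v')) t))" for x1 y1
  define P2 where "P2 x2 y2 = (\<lambda>(u', v, t). \<mu>2 x2 y2 * Vxu (hd u') (tl u') * \<alpha> (hd u' @ x2) (tl u') v *
     (parity_prod True (\<kappa> (hd u' @ x2) (tl u') v) t * parity_prod False (kV (hd u') y2 (tl u') v) t))" for x2 y2
  have pr1: "prot ?X1 ?Y1 Cs \<mu>1 U V1 P1"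
    unfolding prot_def prot_by_def
  proof (intro exI conjI allI ballI)
    fix x1 u assume xu: "x1 \<in> ?X1" "u \<in> U"
    show "(\<Sum>v'\<in>V1. \<alpha>1 x1 u v') = 1"
    proof (cases "Vxu x1 u = 0")
      case True
      have "y0 # v0 \<in> V1" using ne V1_def by auto
      then show ?thesis using True finVU unfolding \<alpha>1_def by simp
    next
      case False
      then show ?thesis unfolding sumV1 \<alpha>1_def by (simp add: sum_divide_distrib[symmetric] Vxu_def)
    qed
  next
    fix x1 y1 u v' t assume "x1 \<in> ?X1" "y1 \<in> ?Y1" "u \<in> U" "v' \<in> V1" "t \<in> listset Cs"
    show "P1 x1 y1 (u, v', t) = \<mu>1 x1 y1 * \<rho> u * \<alpha>1 x1 u v' *
     (parity_prod True ((\<lambda>x1 u v'. kV x1 (hd v') u (tl v')) x1 u v') t * parity_prod False ((\<lambda>y1 u v'. \<kappa>' (y1 @ hd v') u (tl v')) y1 u v') t)"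
      unfolding P1_def by simp
  next
    fix y1 u v' assume "y1 \<in> ?Y1" "u \<in> U" "v' \<in> V1"
    then show "kern Cs (\<kappa>' (y1 @ hd v') u (tl v'))"
      unfolding V1_def by (auto intro!: p(6) append_in_words)
  qed (use p(1,2) Vuvnn Vxunn kernV in \<open>auto simp: \<alpha>1_def\<close>)
  have pr2: "prot ?X2 ?Y2 Cs \<mu>2 U2 V P2"
    unfolding prot_def prot_by_def
  proof (intro exI conjI allI ballI)
    have "(\<Sum>u'\<in>U2. Vxu (hd u') (tl u')) = (\<Sum>x1\<in>?X1. \<Sum>y2\<in>?Y2. \<Sum>u\<in>U. \<Sum>v\<in>V. Vuv x1 y2 u v)"
      unfolding sumU2 Vxu_def by (simp, intro sum.cong refl sum.swap)
    also have "\<dots> = 1" using Vtotal unfolding M_def Vuv_def sum.cartesian_product' .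
    finally show "(\<Sum>u'\<in>U2. Vxu (hd u') (tl u')) = 1" .
  next
    fix x2 u' assume "x2 \<in> ?X2" "u' \<in> U2"
    then show "(\<Sum>v\<in>V. \<alpha> (hd u' @ x2) (tl u') v) = 1"
      unfolding U2_def by (auto intro!: p(4) append_in_words)
  next
    fix x2 y2 u' v t assume "x2 \<in> ?X2" "y2 \<in> ?Y2" "u' \<in> U2" "v \<in> V" "t \<in> listset Cs"
    show "P2 x2 y2 (u', v, t) = \<mu>2 x2 y2 * Vxu (hd u') (tl u') * \<alpha> (hd u' @ x2) (tl u') v *
     (parity_prod True ((\<lambda>x2 u' v. \<kappa> (hd u' @ x2) (tl u') v) x2 u' v) t * parity_prod False ((\<lambda>y2 u' v. kV (hd u') y2 (tl u') v) y2 u' v) t)"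
      unfolding P2_def by simp
  next
    fix x2 u' v assume "x2 \<in> ?X2" "u' \<in> U2" "v \<in> V"
    then show "kern Cs (\<kappa> (hd u' @ x2) (tl u') v)"
      unfolding U2_def by (auto intro!: p(5) append_in_words)
  qed (use p(3) Vxunn kernV in auto)
  define \<phi>1 where "\<phi>1 w = (fst (snd w), fst w # fst (snd (snd w)), snd (snd (snd w)))" for w :: "nat list \<times> trans"
  define \<psi>1 where "\<psi>1 m = (hd (fst (snd m)), fst m, tl (fst (snd m)), snd (snd m))" for m :: trans
  define \<phi>2 where "\<phi>2 w = (fst w # fst (snd w), fst (snd (snd w)), snd (snd (snd w)))" for w :: "nat list \<times> trans"
  define \<psi>2 where "\<psi>2 m = (hd (fst m), tl (fst m), fst (snd m), snd (snd m))" for m :: trans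
  have \<psi>\<phi>: "\<psi>1 (\<phi>1 w) = w" "\<psi>2 (\<phi>2 w) = w" for w unfolding \<psi>1_def \<phi>1_def \<psi>2_def \<phi>2_def by simp_all
  have im1: "\<phi>1 ` (?Y2 \<times> M) = U \<times> V1 \<times> listset Cs"
    unfolding M_def L_def V1_def \<phi>1_def by (force simp: image_iff)
  have im2: "\<phi>2 ` (?X1 \<times> M) = U2 \<times> V \<times> listset Cs"
    unfolding M_def L_def U2_def \<phi>2_def by (force simp: image_iff)
  have qV: "q x1 x2 y1 y2 m \<le> Vf x1 y2 m" if "x2 \<in> ?X2" "y1 \<in> ?Y1" for x1 x2 y1 y2 m
  proof -
    have "q x1 x2 y1 y2 m \<le> (\<Sum>y1\<in>?Y1. q x1 x2 y1 y2 m)" using that finw by (intro member_le_sum qnn) auto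
    also have "\<dots> \<le> Vf x1 y2 m" unfolding Vf_def using that finw by (intro member_le_sum[of x2] sum_nonneg qnn) auto
    finally show ?thesis .
  qed
  have P0: "0 < P (x1 @ x2) (y1 @ y2) m"
    if "x1 \<in> ?X1" "x2 \<in> ?X2" "y1 \<in> ?Y1" "y2 \<in> ?Y2" "m \<in> M" "0 < q x1 x2 y1 y2 m" for x1 x2 y1 y2 m
    using ch append_in_words[OF that(1,2)] append_in_words[OF that(3,4)] that(5,6)
    unfolding cheap_def M_def qeq[OF that(1-4), symmetric] by blast
  \<comment> \<open>\<open>P1\<close> contributes \<open>\<rho>\<close> and Bob's original factors,
    \<open>P2\<close> contributes \<open>\<alpha>\<close> and Alice's. \<open>Vxu\<close> cancels
    between the first message of \<open>P1\<close> and the public randomness of \<open>P2\<close>.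
    The two parts of \<open>kV\<close> multiply to \<open>Vf / Vuv\<close>, whose denominator
    cancels against the \<open>Vuv\<close> in \<open>P1\<close>, so that \<open>Vf\<close> is left
    over.\<close>
  have PP: "P1 x1 y1 (\<phi>1 (y2, m)) * P2 x2 y2 (\<phi>2 (x1, m)) = P (x1 @ x2) (y1 @ y2) m * Vf x1 y2 m"
    if xy: "x1 \<in> ?X1" "x2 \<in> ?X2" "y1 \<in> ?Y1" "y2 \<in> ?Y2" and mM: "m \<in> M" and q0: "0 < q x1 x2 y1 y2 m" for x1 x2 y1 y2 m
  proof -
    obtain u v t where m: "m = (u, v, t)" "u \<in> U" "v \<in> V" "t \<in> L" using mM unfolding M_def by auto
    have V0: "0 < Vf x1 y2 (u, v, t)" using qV[OF xy(2,3), of x1 y2 m] q0 m by simp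
    have "Vf x1 y2 (u, v, t) \<le> Vuv x1 y2 u v"
      unfolding Vuv_def using m(4) finL Vnn by (intro member_le_sum) auto
    then have Vuv0: "0 < Vuv x1 y2 u v" using V0 by linarith
    have "Vuv x1 y2 u v \<le> (\<Sum>v\<in>V. Vuv x1 y2 u v)" using m(3) fin Vuvnn by (intro member_le_sum) auto
    also have "\<dots> \<le> Vxu x1 u" unfolding Vxu_def using xy(4) finw Vuvnn
      by (intro member_le_sum[of y2]) (auto intro!: sum_nonneg)
    finally have Vxu0: "0 < Vxu x1 u" using Vuv0 by linarith
    have k: "parity_prod True (kV x1 y2 u v) t * parity_prod False (kV x1 y2 u v) t = Vf x1 y2 (u, v, t) / Vuv x1 y2 u v"
      unfolding kV_def Vuv_def L_def using m(4) V0 Vnn L_def by (intro parity_prod_prefix_kernel finC) auto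
    have Pe: "P (x1 @ x2) (y1 @ y2) m = \<mu>1 x1 y1 * \<mu>2 x2 y2 * \<rho> u * \<alpha> (x1 @ x2) u v *
        (parity_prod True (\<kappa> (x1 @ x2) u v) t * parity_prod False (\<kappa>' (y1 @ y2) u v) t)"
      unfolding m(1) mu[OF xy, symmetric] using m xy by (intro p(7)) (auto intro: append_in_words simp: L_def)
    have P1e: "P1 x1 y1 (\<phi>1 (y2, m)) = \<mu>1 x1 y1 * \<rho> u * (Vuv x1 y2 u v / Vxu x1 u) *
       (parity_prod True (kV x1 y2 u v) t * parity_prod False (\<kappa>' (y1 @ y2) u v) t)"
      unfolding P1_def \<phi>1_def m(1) \<alpha>1_def using Vxu0 by simp
    have P2e: "P2 x2 y2 (\<phi>2 (x1, m)) = \<mu>2 x2 y2 * Vxu x1 u * \<alpha> (x1 @ x2) u v *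
       (parity_prod True (\<kappa> (x1 @ x2) u v) t * parity_prod False (kV x1 y2 u v) t)"
      unfolding P2_def \<phi>2_def m(1) by simp
    have ac: "(c1 * r * (g / z) * (e1 * e2)) * (c2 * z * d * (e3 * e4)) = (c1 * c2 * r * d * (e3 * e2)) * (g * (e1 * e4))"
      if "0 < z" for c1 r g z e1 e2 c2 d e3 e4 :: real using that by (simp add: field_simps)
    show ?thesis unfolding P1e P2e ac[OF Vxu0] k Pe using Vuv0 by (simp add: m(1))
  qed
  have P1nn: "0 \<le> P1 x y (\<phi>1 w)" if "x \<in> ?X1" "y \<in> ?Y1" "w \<in> ?Y2 \<times> M" for x y w
    using prot_nonneg[OF pr1 mu_nn(1) that(1,2)] im1 that(3) by blast
  have P2nn: "0 \<le> P2 x y (\<phi>2 w)" if "x \<in> ?X2" "y \<in> ?Y2" "w \<in> ?X1 \<times> M" for x y w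
    using prot_nonneg[OF pr2 mu_nn(2) that(1,2)] im2 that(3) by blast
  have PPpos: "0 < P1 x1 y1 (\<phi>1 (y2, m)) \<and> 0 < P2 x2 y2 (\<phi>2 (x1, m))"
    if xy: "x1 \<in> ?X1" "x2 \<in> ?X2" "y1 \<in> ?Y1" "y2 \<in> ?Y2" and mM: "m \<in> M" and q0: "0 < q x1 x2 y1 y2 m" for x1 x2 y1 y2 m
  proof -
    have "0 < Vf x1 y2 m" using qV[OF xy(2,3), of x1 y2 m] q0 by linarith
    then have "0 < P1 x1 y1 (\<phi>1 (y2, m)) * P2 x2 y2 (\<phi>2 (x1, m))" unfolding PP[OF that] using P0[OF that] by simp
    moreover have "0 \<le> P1 x1 y1 (\<phi>1 (y2, m))" "0 \<le> P2 x2 y2 (\<phi>2 (x1, m))"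
      using P1nn P2nn xy mM by auto
    ultimately show ?thesis by (simp add: zero_less_mult_iff)
  qed
  have tot1: "(\<Sum>x\<in>?X1. \<Sum>y\<in>?Y1. \<Sum>w\<in>?Y2 \<times> M. P1 x y (\<phi>1 w)) \<le> 1"
  proof -
    have "inj_on \<phi>1 (?Y2 \<times> M)" by (metis inj_onI \<psi>\<phi>(1))
    then have "(\<Sum>w\<in>?Y2 \<times> M. P1 x y (\<phi>1 w)) = (\<Sum>m\<in>U \<times> V1 \<times> listset Cs. P1 x y m)" for x y
      unfolding im1[symmetric] by (subst sum.reindex) auto
    then show ?thesis using prot_sum[OF pr1] mu_le by simp
  qed
  have tot2: "(\<Sum>x\<in>?X2. \<Sum>y\<in>?Y2. \<Sum>w\<in>?X1 \<times> M. P2 x y (\<phi>2 w)) \<le> 1"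
  proof -
    have "inj_on \<phi>2 (?X1 \<times> M)" by (metis inj_onI \<psi>\<phi>(2))
    then have "(\<Sum>w\<in>?X1 \<times> M. P2 x y (\<phi>2 w)) = (\<Sum>m\<in>U2 \<times> V \<times> listset Cs. P2 x y m)" for x y
      unfolding im2[symmetric] by (subst sum.reindex) auto
    then show ?thesis using prot_sum[OF pr2] mu_le by simp
  qed
  have mu0: "0 < \<mu>1 x1 y1 \<and> 0 < \<mu>2 x2 y2" if "0 < q x1 x2 y1 y2 m" for x1 x2 y1 y2 m
  proof -
    have "\<mu>1 x1 y1 \<noteq> 0" "\<mu>2 x2 y2 \<noteq> 0" using that unfolding q_def by auto
    then show ?thesis using mu_nn[of x1 y1] mu_nn[of x2 y2] by simp
  qed
  have v1: "(\<Sum>y1\<in>?Y1. l1 x1 y1 (y2, m)) = Vf x1 y2 m" for x1 y2 m unfolding l1 Vf_def by (rule sum.swap)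
  have v2: "(\<Sum>x2\<in>?X2. l2 x2 y2 (x1, m)) = Vf x1 y2 m" for x1 y2 m unfolding l2 Vf_def ..
  have l1nn: "0 \<le> l1 x y w" "0 \<le> l2 x y w" for x y w unfolding l1_def l2_def using mu_nn A1nn B1nn by auto
  have adm1: "admissible ?X1 ?Y1 (?Y2 \<times> M) \<mu>1 (\<lambda>x y w. P1 x y (\<phi>1 w)) l1"
    unfolding admissible_def
  proof (intro conjI allI ballI impI)
    have "(\<Sum>x\<in>?X1. \<Sum>y\<in>?Y1. \<Sum>w\<in>?Y2 \<times> M. l1 x y w) = (\<Sum>x\<in>?X1. \<Sum>w\<in>?Y2 \<times> M. \<Sum>y\<in>?Y1. l1 x y w)"
      by (intro sum.cong refl sum.swap)
    then show "(\<Sum>x\<in>?X1. \<Sum>y\<in>?Y1. \<Sum>w\<in>?Y2 \<times> M. l1 x y w) = 1"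
      using Vtotal unfolding sum.cartesian_product' v1 by simp
    fix x y w assume xs: "x \<in> ?X1" "y \<in> ?Y1" "w \<in> ?Y2 \<times> M" and l: "0 < l1 x y w"
    have w: "fst w \<in> ?Y2" "snd w \<in> M" "(fst w, snd w) = w" using xs(3) by auto
    have "0 < (\<Sum>x2\<in>?X2. q x x2 y (fst w) (snd w))" using l l1[of x y "fst w" "snd w"] by simp
    then obtain x2 where x2: "x2 \<in> ?X2" "0 < q x x2 y (fst w) (snd w)"
      by (metis not_less sum_nonpos)
    from PPpos[OF xs(1) x2(1) xs(2) w(1,2) x2(2)] show "0 < P1 x y (\<phi>1 w)" unfolding w(3) by blast
    show "0 < \<mu>1 x y" using mu0[OF x2(2)] by blast
  qed (use finw finM l1nn mu_nn P1nn tot1 in auto)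
  have adm2: "admissible ?X2 ?Y2 (?X1 \<times> M) \<mu>2 (\<lambda>x y w. P2 x y (\<phi>2 w)) l2"
    unfolding admissible_def
  proof (intro conjI allI ballI impI)
    have "(\<Sum>x\<in>?X2. \<Sum>y\<in>?Y2. \<Sum>w\<in>?X1 \<times> M. l2 x y w) = (\<Sum>y\<in>?Y2. \<Sum>x\<in>?X2. \<Sum>w\<in>?X1 \<times> M. l2 x y w)"
      by (rule sum.swap)
    also have "\<dots> = (\<Sum>y\<in>?Y2. \<Sum>w\<in>?X1 \<times> M. \<Sum>x\<in>?X2. l2 x y w)"
      by (intro sum.cong refl sum.swap)
    also have "\<dots> = (\<Sum>x1\<in>?X1. \<Sum>y2\<in>?Y2. \<Sum>m\<in>M. Vf x1 y2 m)"
      unfolding sum.cartesian_product' v2 by (rule sum.swap)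
    finally show "(\<Sum>x\<in>?X2. \<Sum>y\<in>?Y2. \<Sum>w\<in>?X1 \<times> M. l2 x y w) = 1" using Vtotal by simp
    fix x y w assume xs: "x \<in> ?X2" "y \<in> ?Y2" "w \<in> ?X1 \<times> M" and l: "0 < l2 x y w"
    have w: "fst w \<in> ?X1" "snd w \<in> M" "(fst w, snd w) = w" using xs(3) by auto
    have "0 < (\<Sum>y1\<in>?Y1. q (fst w) x y1 y (snd w))" using l l2[of x y "fst w" "snd w"] by simp
    then obtain y1 where y1: "y1 \<in> ?Y1" "0 < q (fst w) x y1 y (snd w)"
      by (metis not_less sum_nonpos)
    from PPpos[OF w(1) xs(1) y1(1) xs(2) w(2) y1(2)] show "0 < P2 x y (\<phi>2 w)" unfolding w(3) by blast
    show "0 < \<mu>2 x y" using mu0[OF y1(2)] by blast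
  qed (use finw finM l1nn mu_nn P2nn tot2 in auto)
  define qm where "qm m = (\<Sum>x1\<in>?X1. \<Sum>y2\<in>?Y2. Vf x1 y2 m)" for m
  define eps where "eps m = \<bar>\<Sum>x1\<in>?X1. \<Sum>y2\<in>?Y2. \<Sum>x2\<in>?X2. \<Sum>y1\<in>?Y1.
        q x1 x2 y1 y2 m * (sg (h1 x1 y1) * sg (h2 x2 y2))\<bar> / qm m" for m
  have eps_bias: "bias ?XX ?YY h (\<lambda>x y m. \<mu> x y * A x m * B y m) m = eps m" for m
  proof -
    have "(\<Sum>x\<in>?XX. \<Sum>y\<in>?YY. \<mu> x y * A x m * B y m * sg (h x y)) =
       (\<Sum>x1\<in>?X1. \<Sum>x2\<in>?X2. \<Sum>y1\<in>?Y1. \<Sum>y2\<in>?Y2. q x1 x2 y1 y2 m * (sg (h1 x1 y1) * sg (h2 x2 y2)))"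
      unfolding sum_words_append by (intro sum.cong refl) (auto simp: qeq h sg_def)
    moreover have "(\<Sum>x\<in>?XX. \<Sum>y\<in>?YY. \<mu> x y * A x m * B y m) =
       (\<Sum>x1\<in>?X1. \<Sum>x2\<in>?X2. \<Sum>y1\<in>?Y1. \<Sum>y2\<in>?Y2. q x1 x2 y1 y2 m)"
      unfolding sum_words_append by (intro sum.cong refl) (simp add: qeq)
    moreover have "(\<Sum>x1\<in>?X1. \<Sum>x2\<in>?X2. \<Sum>y1\<in>?Y1. \<Sum>y2\<in>?Y2. f x1 x2 y1 y2) =
       (\<Sum>x1\<in>?X1. \<Sum>y2\<in>?Y2. \<Sum>x2\<in>?X2. \<Sum>y1\<in>?Y1. f x1 x2 y1 y2)" for f :: "_ \<Rightarrow> _ \<Rightarrow> _ \<Rightarrow> _ \<Rightarrow> real"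
      by (intro sum.cong refl sum_rotate3)
    ultimately show ?thesis unfolding bias_def eps_def qm_def Vf_def by (simp only:)
  qed
  have cost: "0 < eps m \<and> info_cost I ?X1 ?Y1 \<mu>1 (\<lambda>x y w. P1 x y (\<phi>1 w)) l1 x1 y1 (y2, m) +
      info_cost I ?X2 ?Y2 \<mu>2 (\<lambda>x y w. P2 x y (\<phi>2 w)) l2 x2 y2 (x1, m) - 180 * I * log 2 (eps m) \<le> Mb"
    if xy: "x1 \<in> ?X1" "x2 \<in> ?X2" "y1 \<in> ?Y1" "y2 \<in> ?Y2" and mM: "m \<in> M" and q0: "0 < q x1 x2 y1 y2 m" for x1 x2 y1 y2 m
  proof -
    let ?q = "\<lambda>x y m. \<mu> x y * A x m * B y m"
    have qq: "?q (x1 @ x2) (y1 @ y2) m = q x1 x2 y1 y2 m" by (rule qeq[OF xy])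
    have c: "0 < eps m" "info_cost I ?XX ?YY \<mu> P ?q (x1 @ x2) (y1 @ y2) m - 180 * I * log 2 (eps m) \<le> Mb"
      using ch append_in_words[OF xy(1,2)] append_in_words[OF xy(3,4)] mM q0 unfolding cheap_def eps_bias M_def qq[symmetric] by blast+
    have V0: "0 < Vf x1 y2 m" using qV[OF xy(2,3), of x1 y2 m] q0 by linarith
    have l0: "0 < l1 x1 y1 (y2, m)" "0 < l2 x2 y2 (x1, m)"
      unfolding l1 l2
      by (rule sum_pos2[where f = "\<lambda>x2. q x1 x2 y1 y2 m", OF finw(2) xy(2) q0 qnn],
          rule sum_pos2[where f = "\<lambda>y1. q x1 x2 y1 y2 m", OF finw(3) xy(3) q0 qnn])
    have s1: "(\<Sum>x'\<in>?XX. ?q x' (y1 @ y2) m) = (\<Sum>x1\<in>?X1. l1 x1 y1 (y2, m))"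
      unfolding sum_words_append l1 using xy by (intro sum.cong refl) (simp add: qeq)
    have s2: "(\<Sum>y'\<in>?YY. ?q (x1 @ x2) y' m) = (\<Sum>y2\<in>?Y2. l2 x2 y2 (x1, m))"
      unfolding sum_words_append l2 using xy by (subst sum.swap, intro sum.cong refl) (simp add: qeq)
    have m1: "(\<Sum>x'\<in>?XX. \<mu> x' (y1 @ y2)) = (\<Sum>x1\<in>?X1. \<mu>1 x1 y1) * (\<Sum>x2\<in>?X2. \<mu>2 x2 y2)"
      unfolding sum_words_append sum_product using xy by (intro sum.cong refl) (simp add: mu)
    have m2: "(\<Sum>y'\<in>?YY. \<mu> (x1 @ x2) y') = (\<Sum>y1\<in>?Y1. \<mu>1 x1 y1) * (\<Sum>y2\<in>?Y2. \<mu>2 x2 y2)"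
      unfolding sum_words_append sum_product using xy by (intro sum.cong refl) (simp add: mu)
    note mu0 = mu0[OF q0, THEN conjunct1] mu0[OF q0, THEN conjunct2]
    have pos: "0 < (\<Sum>x1\<in>?X1. l1 x1 y1 (y2, m))" "0 < (\<Sum>y2\<in>?Y2. l2 x2 y2 (x1, m))"
      "0 < (\<Sum>x1\<in>?X1. \<mu>1 x1 y1)" "0 < (\<Sum>x2\<in>?X2. \<mu>2 x2 y2)"
      "0 < (\<Sum>y1\<in>?Y1. \<mu>1 x1 y1)" "0 < (\<Sum>y2\<in>?Y2. \<mu>2 x2 y2)"
      using sum_pos2[where f = "\<lambda>x1. l1 x1 y1 (y2, m)", OF finw(1) xy(1) l0(1) l1nn(1)]
        sum_pos2[where f = "\<lambda>y2. l2 x2 y2 (x1, m)", OF finw(4) xy(4) l0(2) l1nn(2)]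
        sum_pos2[where f = "\<lambda>x1. \<mu>1 x1 y1", OF finw(1) xy(1) mu0(1) mu_nn(1)]
        sum_pos2[where f = "\<lambda>x2. \<mu>2 x2 y2", OF finw(2) xy(2) mu0(2) mu_nn(2)]
        sum_pos2[where f = "\<lambda>y1. \<mu>1 x1 y1", OF finw(3) xy(3) mu0(1) mu_nn(1)]
        sum_pos2[where f = "\<lambda>y2. \<mu>2 x2 y2", OF finw(4) xy(4) mu0(2) mu_nn(2)]
      by blast+
    have "info_cost I ?XX ?YY \<mu> P ?q (x1 @ x2) (y1 @ y2) m = info_cost I ?X1 ?Y1 \<mu>1 (\<lambda>x y w. P1 x y (\<phi>1 w)) l1 x1 y1 (y2, m) +
      info_cost I ?X2 ?Y2 \<mu>2 (\<lambda>x y w. P2 x y (\<phi>2 w)) l2 x2 y2 (x1, m)"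
      unfolding info_cost_def qq s1 s2 m1 m2 v1 v2
      unfolding mu[OF xy]
      by (rule cost_additive[OF q0 l0 V0 pos mu0 P0[OF xy mM q0] PPpos[OF xy mM q0, THEN conjunct1]
            PPpos[OF xy mM q0, THEN conjunct2] CI PP[OF xy mM q0]])
    then show ?thesis using c by simp
  qed
  have "\<exists>t1 t2. cheap_box I ?X1 ?Y1 (?Y2 \<times> M) \<mu>1 h1 (\<lambda>x y w. P1 x y (\<phi>1 w)) l1 t1 \<and>
    cheap_box I ?X2 ?Y2 (?X1 \<times> M) \<mu>2 h2 (\<lambda>x y w. P2 x y (\<phi>2 w)) l2 t2 \<and>
    t1 + t2 \<le> Mb + 5000 * I * (1 + log2_plus (Mb / I))"
    by (rule cheap_box_split[of ?X1 ?X2 ?Y1 ?Y2 M I q l1 l2 Vf \<mu>1 _ \<mu>2 _ qm eps h1 h2 Mb])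
       (rule finw finM I qnn l1 l2 Vf_def CI adm1 adm2 qm_def eps_def cost; assumption)+
  then obtain t1 t2 S1 T1 c1 S2 T2 c2 where r: "0 < c1" "0 < c2"
    "(\<Sum>x\<in>?X1. \<Sum>y\<in>?Y1. \<Sum>w\<in>?Y2 \<times> M. l1 x y w * of_bool ((x, w) \<in> S1) * of_bool ((y, w) \<in> T1) / c1) = 1"
    "cheap I ?X1 ?Y1 (?Y2 \<times> M) \<mu>1 h1 (\<lambda>x y w. P1 x y (\<phi>1 w)) (\<lambda>x y w. l1 x y w * of_bool ((x, w) \<in> S1) * of_bool ((y, w) \<in> T1) / c1) t1"
    "(\<Sum>x\<in>?X2. \<Sum>y\<in>?Y2. \<Sum>w\<in>?X1 \<times> M. l2 x y w * of_bool ((x, w) \<in> S2) * of_bool ((y, w) \<in> T2) / c2) = 1"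
    "cheap I ?X2 ?Y2 (?X1 \<times> M) \<mu>2 h2 (\<lambda>x y w. P2 x y (\<phi>2 w)) (\<lambda>x y w. l2 x y w * of_bool ((x, w) \<in> S2) * of_bool ((y, w) \<in> T2) / c2) t2"
    "t1 + t2 \<le> Mb + 5000 * I * (1 + log2_plus (Mb / I))" unfolding cheap_box_def by blast
  have "achievable I ?X1 ?Y1 h1 \<mu>1 Cs t1"
    by (rule achievableI[where \<psi> = \<psi>1 and A = "\<lambda>x w. A1 x w * of_bool ((x, w) \<in> S1) / c1" and
          B = "\<lambda>y w. B1 y w * of_bool ((y, w) \<in> T1)", OF \<psi>\<phi>(1) im1 fin(1) finVU(1) pr1 _ _ _ r(3,4)])
       (use A1nn B1nn r(1) in \<open>simp_all add: l1_def\<close>)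
  moreover have "achievable I ?X2 ?Y2 h2 \<mu>2 Cs t2"
    by (rule achievableI[where \<psi> = \<psi>2 and A = "\<lambda>x w. A2 x w * of_bool ((x, w) \<in> S2) / c2" and
          B = "\<lambda>y w. B2 y w * of_bool ((y, w) \<in> T2)", OF \<psi>\<phi>(2) im2 finVU(2) fin(2) pr2 _ _ _ r(5,6)])
       (use A1nn B1nn r(2) in \<open>simp_all add: l2_def\<close>)
  ultimately show ?thesis using r(7) by blast
qed

section \<open>Reduction to one coordinate\<close>

text \<open>As the bias is at most 1, a bound below \<open>- 12 * I\<close> would push the
  information cost below \<open>- 12 * I\<close> on the whole support, but the lower tail there has
  mass at most \<open>3 / 16\<close>. This excludes the value \<open>-\<infinity>\<close> of the
  marginal information.\<close>

lemma achievable_lower_bound: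
  assumes I: "1 \<le> I" and fin: "finite X" "finite Y" "\<forall>C\<in>set Cs. finite C"
    and mu: "\<And>x y. 0 \<le> \<mu> x y" "(\<Sum>x\<in>X. \<Sum>y\<in>Y. \<mu> x y) \<le> 1"
    and g: "achievable I X Y h \<mu> Cs t"
  shows "- (12 * I) \<le> t"
proof (rule ccontr)
  assume t: "\<not> - (12 * I) \<le> t"
  obtain U V P A B where finU: "finite U" "finite V" and pr: "prot X Y Cs \<mu> U V P"
    and AB: "\<And>x m. 0 \<le> A x m" "\<And>y m. 0 \<le> B y m"
    and total: "(\<Sum>x\<in>X. \<Sum>y\<in>Y. \<Sum>m\<in>U \<times> V \<times> listset Cs. \<mu> x y * A x m * B y m) = 1"
    and ch: "cheap I X Y (U \<times> V \<times> listset Cs) \<mu> h P (\<lambda>x y m. \<mu> x y * A x m * B y m) t"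
    using g unfolding achievable_def by blast
  define M where "M = U \<times> V \<times> listset Cs"
  define q where "q x y m = \<mu> x y * A x m * B y m" for x y m
  have finM: "finite M" unfolding M_def using finU finite_listset[OF fin(3)] by simp
  have qnn: "0 \<le> q x y m" for x y m unfolding q_def by (intro mult_nonneg_nonneg mu AB)
  have tot: "(\<Sum>x\<in>X. \<Sum>y\<in>Y. \<Sum>m\<in>M. q x y m) = 1" using total unfolding M_def q_def .
  have chq: "cheap I X Y M \<mu> h P q t" using ch unfolding M_def q_def .
  have bias1: "bias X Y h q m \<le> 1" for m
  proof -
    have "\<bar>\<Sum>x\<in>X. \<Sum>y\<in>Y. q x y m * sg (h x y)\<bar> \<le> (\<Sum>x\<in>X. \<Sum>y\<in>Y. \<bar>q x y m * sg (h x y)\<bar>)"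
      by (intro order_trans[OF sum_abs] sum_mono) simp
    also have "\<dots> = (\<Sum>x\<in>X. \<Sum>y\<in>Y. q x y m)" by (simp only: abs_mult abs_sg abs_of_nonneg[OF qnn] mult_1_right)
    finally show ?thesis unfolding bias_def by (auto simp: divide_le_eq_1 le_less)
  qed
  have mu0: "0 < \<mu> x y" if "0 < q x y m" for x y m
  proof -
    have "\<mu> x y \<noteq> 0" using that unfolding q_def by auto
    then show ?thesis using mu(1)[of x y] by simp
  qed
  have Pnn: "0 \<le> P x y m" if "x \<in> X" "y \<in> Y" "m \<in> M" for x y m
    using prot_nonneg[OF pr mu(1)] that unfolding M_def by blast
  have "(\<Sum>x\<in>X. \<Sum>y\<in>Y. \<Sum>m\<in>M. q x y m * of_bool (0 < q x y m \<and> info_cost I X Y \<mu> P q x y m < - (12 * I)))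
     \<le> 3 * 2 powr (- (12 * I) / (3 * I))"
  proof (rule cost_lower_tail)
    have "0 < P x y m" if "x \<in> X" "y \<in> Y" "m \<in> M" "0 < q x y m" for x y m
      using chq that unfolding cheap_def by blast
    moreover have "(\<Sum>x\<in>X. \<Sum>y\<in>Y. \<Sum>m\<in>M. P x y m) \<le> 1" using prot_sum[OF pr] mu(2) unfolding M_def by simp
    ultimately show "admissible X Y M \<mu> P q"
      unfolding admissible_def using fin finM qnn tot mu mu0 Pnn by blast
  qed (use I in auto)
  moreover have "- (12 * I) / (3 * I) = -4" using I by simp
  moreover have "q x y m * of_bool (0 < q x y m \<and> info_cost I X Y \<mu> P q x y m < - (12 * I)) = q x y m"
    if "x \<in> X" "y \<in> Y" "m \<in> M" for x y m
  proof (cases "0 < q x y m")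
    case True
    then have c: "0 < bias X Y h q m" "info_cost I X Y \<mu> P q x y m - 180 * I * log 2 (bias X Y h q m) \<le> t"
      using chq that unfolding cheap_def by blast+
    have "log 2 (bias X Y h q m) \<le> 0" using c(1) bias1[of m] by simp
    then have "180 * I * log 2 (bias X Y h q m) \<le> 0" using I by (simp add: mult_nonneg_nonpos)
    then have "info_cost I X Y \<mu> P q x y m < - (12 * I)" using c(2) t by linarith
    then show ?thesis using True by simp
  next
    case False
    then show ?thesis using qnn[of x y m] by simp
  qed
  ultimately have "1 \<le> 3 * (2::real) powr (-4)" using tot by simp
  then show False by (simp add: powr_minus)
qed

text \<open>The offset \<open>s\<close> selects the block of \<open>n\<close> coordinates starting
  at \<open>s\<close>, so that both halves of a block have priors of the same family; the words of a
  block are indexed from 0.\<close>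

definition product_prior :: "(nat \<Rightarrow> nat \<Rightarrow> nat \<Rightarrow> real) \<Rightarrow> nat \<Rightarrow> nat \<Rightarrow> nat list \<Rightarrow> nat list \<Rightarrow> real" where
  "product_prior \<mu>c s n x y = (\<Prod>i<n. \<mu>c (s + i) (x ! i) (y ! i))"

lemma product_prior_nonneg: "(\<And>i x y. 0 \<le> \<mu>c i x y) \<Longrightarrow> 0 \<le> product_prior \<mu>c s n x y"
  unfolding product_prior_def by (intro prod_nonneg) auto

lemma prod_lessThan_add: "(\<Prod>i<a + b. f i) = (\<Prod>i<a. f i) * (\<Prod>i<b. f (a + i :: nat) :: real)"
  by (induction b) (simp_all add: mult.assoc)

lemma product_prior_append:
  assumes "length x1 = a" "length y1 = a"
  shows "product_prior \<mu>c s (a + b) (x1 @ x2) (y1 @ y2) = product_prior \<mu>c s a x1 y1 * product_prior \<mu>c (s + a) b x2 y2"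
  unfolding product_prior_def prod_lessThan_add using assms by (simp add: nth_append add.assoc)

lemma xor_power_append:
  "length x1 = length y1 \<Longrightarrow> xor_power f (x1 @ x2) (y1 @ y2) = (xor_power f x1 y1 \<noteq> xor_power f x2 y2)"
  by (induction x1 y1 rule: list_induct2) (auto simp: xor_power_def)

lemma words1: "words 1 X = (\<lambda>a. [a]) ` X"
  by (auto simp: words_def length_Suc_conv)

lemma sum_words1: "(\<Sum>x\<in>words 1 X. f x) = (\<Sum>a\<in>X. f [a])"
  unfolding words1 by (subst sum.reindex) (auto simp: inj_on_def)

lemma product_prior_sum:
  assumes "finite X" "finite Y" and nn: "\<And>i x y. 0 \<le> \<mu>c i x y" and le: "\<And>i. (\<Sum>x\<in>X. \<Sum>y\<in>Y. \<mu>c i x y) \<le> 1"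
  shows "(\<Sum>x\<in>words n X. \<Sum>y\<in>words n Y. product_prior \<mu>c s n x y) \<le> 1"
proof (induction n arbitrary: s)
  case 0
  have "words 0 X = {[]}" for X :: "nat set" by (auto simp: words_def)
  then show ?case by (simp add: product_prior_def)
next
  case (Suc n)
  have l: "length x = n" if "x \<in> words n X" for x X and n :: nat using that by (simp add: words_def)
  have "(\<Sum>x\<in>words (1 + n) X. \<Sum>y\<in>words (1 + n) Y. product_prior \<mu>c s (1 + n) x y) =
    (\<Sum>x1\<in>words 1 X. \<Sum>x2\<in>words n X. \<Sum>y1\<in>words 1 Y. \<Sum>y2\<in>words n Y. product_prior \<mu>c s 1 x1 y1 * product_prior \<mu>c (s + 1) n x2 y2)"
    unfolding sum_words_append using product_prior_append[of _ 1] l by (intro sum.cong refl) blast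
  also have "\<dots> = (\<Sum>x1\<in>words 1 X. \<Sum>x2\<in>words n X. (\<Sum>y1\<in>words 1 Y. product_prior \<mu>c s 1 x1 y1) * (\<Sum>y2\<in>words n Y. product_prior \<mu>c (s + 1) n x2 y2))"
    by (simp only: sum_product)
  also have "\<dots> = (\<Sum>x1\<in>words 1 X. \<Sum>y1\<in>words 1 Y. product_prior \<mu>c s 1 x1 y1) * (\<Sum>x2\<in>words n X. \<Sum>y2\<in>words n Y. product_prior \<mu>c (s + 1) n x2 y2)"
    by (simp only: sum_product)
  also have "\<dots> \<le> 1 * 1"
  proof (rule mult_mono)
    show "(\<Sum>x1\<in>words 1 X. \<Sum>y1\<in>words 1 Y. product_prior \<mu>c s 1 x1 y1) \<le> 1"
      unfolding sum_words1 using le[of s] by (simp add: product_prior_def)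
    show "(\<Sum>x2\<in>words n X. \<Sum>y2\<in>words n Y. product_prior \<mu>c (s + 1) n x2 y2) \<le> 1" by (rule Suc.IH)
    show "0 \<le> (\<Sum>x2\<in>words n X. \<Sum>y2\<in>words n Y. product_prior \<mu>c (s + 1) n x2 y2)"
      by (intro sum_nonneg product_prior_nonneg nn)
  qed simp
  finally show ?case by simp
qed

section \<open>Estimates for the truncated logarithm\<close>

lemma log2_plus_nonneg: "0 \<le> log2_plus a"
  unfolding log2_plus_def by simp

text \<open>The tangent of \<open>ln\<close> at e gives \<open>ln z \<le> z / exp 1\<close>, which
  is at most \<open>z / 2\<close>, and \<open>1 / 2 \<le> ln 2\<close>.\<close>

lemma log2_le_self:
  assumes "0 < z"
  shows "log 2 z \<le> (z :: real)"
proof -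
  have "2 \<le> exp (1::real)" using exp_ge_add_one_self[of 1] by simp
  then have "z / exp 1 \<le> z / 2" using assms by (intro divide_left_mono) auto
  moreover have "ln (z / exp 1) \<le> z / exp 1 - 1" using assms by (intro ln_le_minus_one) simp
  moreover have "ln (z / exp 1) = ln z - 1" using assms by (simp add: ln_div)
  ultimately have "ln z \<le> z * (1/2)" by linarith
  also have "\<dots> \<le> z * ln 2" using assms ln2_ge_two_thirds by (intro mult_left_mono) auto
  finally show ?thesis by (simp add: log_def divide_le_eq)
qed

lemma log2_1p_le: "0 \<le> z \<Longrightarrow> log 2 (1 + z) \<le> 2 * (z :: real)"
proof -
  assume z: "0 \<le> z"
  have "ln (1 + z) \<le> z * 1" using z ln_add_one_self_le_self by simp
  also have "\<dots> \<le> z * (2 * ln 2)" using z ln2_ge_two_thirds by (intro mult_left_mono) auto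
  finally show ?thesis by (simp add: log_def divide_le_eq)
qed

lemma log2_plus_mult:
  assumes "1 \<le> a"
  shows "log2_plus (a * c) \<le> log 2 a + log2_plus c"
proof -
  have "max 1 (a * c) \<le> a * max 1 c"
    using assms mult_left_mono[of c "max 1 c" a] mult_mono[of 1 a 1 "max 1 c"] by simp
  then have "log 2 (max 1 (a * c)) \<le> log 2 (a * max 1 c)" using assms by (subst log_le_cancel_iff) auto
  also have "\<dots> = log 2 a + log 2 (max 1 c)" using assms by (simp add: log_mult)
  finally show ?thesis by (simp add: log2_plus_def)
qed

text \<open>With \<open>A = max 1 c\<close>, the terms \<open>e\<close> and
  \<open>log2_plus c\<close> are at most \<open>A * e\<close> and \<open>A\<close>, so the additive
  increase becomes a relative one and \<open>c'\<close> is at most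
  \<open>A * (1 + d * (e + 1))\<close>. For \<open>d\<close> of order 1 / n the truncated logarithm
  therefore hardly moves.\<close>

lemma log2_plus_perturb:
  assumes "0 \<le> d" "0 \<le> e" and c': "c' \<le> c + d * (e + log2_plus c)"
  shows "log2_plus c' \<le> log2_plus c + 2 * (d * (e + 1))"
proof -
  define A where "A = max 1 c"
  have A: "1 \<le> A" "c \<le> A" unfolding A_def by auto
  have lA: "log2_plus c \<le> A" unfolding log2_plus_def A_def[symmetric] using A by (intro log2_le_self) simp
  have "e \<le> A * e" using A assms(2) mult_right_mono[of 1 A e] by simp
  then have "d * (e + log2_plus c) \<le> d * (A * e + A)" using lA assms(1) by (intro mult_left_mono) auto
  then have "c' \<le> A + d * (A * e + A)" using c' A(2) by linarith
  also have "\<dots> = A * (1 + d * (e + 1))" by (simp add: algebra_simps)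
  finally have "c' \<le> A * (1 + d * (e + 1))" .
  moreover have "1 \<le> A * (1 + d * (e + 1))"
    using A assms mult_mono[of 1 A 1 "1 + d * (e + 1)"] by simp
  ultimately have "log 2 (max 1 c') \<le> log 2 (A * (1 + d * (e + 1)))" by (subst log_le_cancel_iff) auto
  also have "\<dots> = log 2 A + log 2 (1 + d * (e + 1))"
    using A assms by (subst log_mult) (auto simp: add_nonneg_eq_0_iff)
  also have "\<dots> \<le> log 2 A + 2 * (d * (e + 1))" using assms by (intro add_left_mono log2_1p_le) simp
  finally show ?thesis by (simp add: log2_plus_def A_def)
qed

text \<open>The shape of the two loss terms is dictated by \<open>loss_step\<close>: halving must absorb the loss of one splitting step.\<close>

definition const_loss :: "nat \<Rightarrow> real" where "const_loss n = 6000000000 * (1 - 1 / sqrt (real n))"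
definition log_loss :: "nat \<Rightarrow> real" where "log_loss n = 20000 * (1 - 1 / real n)"

text \<open>As \<open>m\<close> is at most \<open>3 * n / 4\<close>, the difference
  \<open>1 / m - 1 / n\<close> is at least \<open>1 / (3 * n)\<close> and absorbs the loss in front
  of the truncated logarithm. The other loss is of order log n / n, too large for that; being of
  order \<open>1 / sqrt n\<close> at most, it fits into a difference of inverse square roots. The
  ratio 3/4 covers the larger half of every \<open>n\<close> from 2 on.\<close>

lemma loss_step:
  assumes n: "2 \<le> n" and m: "1 \<le> m" "4 * m \<le> 3 * n"
  shows "5000 / n + log_loss m \<le> log_loss n"
    "5000 / n * (1 + log 2 n) + const_loss m + log_loss m * (2 * (5000 / n * (1 + log 2 n + 1))) \<le> const_loss n"
proof -
  have mr: "0 < real m" "4 * real m \<le> 3 * real n" "0 < real n" using m n by auto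
  have "4 / (3 * real n) \<le> 1 / real m" using mr by (simp add: field_simps)
  then show "5000 / n + log_loss m \<le> log_loss n" unfolding log_loss_def using mr by (simp add: field_simps)
  define r where "r = sqrt (real n)"
  have r: "0 < r" "r * r = real n" "1 \<le> r" unfolding r_def using n by auto
  have l0: "0 \<le> log 2 (real n)" using n by simp
  have "log 2 (r * r) = log 2 r + log 2 r" by (subst log_mult) (use r(1) in auto)
  then have "log 2 (real n) = 2 * log 2 r" unfolding r(2) by simp
  also have "\<dots> \<le> 2 * r" using log2_le_self[OF r(1)] by simp
  finally have l: "2 + log 2 (real n) \<le> 4 * r" using r(3) by linarith
  have lr: "(2 + log 2 (real n)) / n \<le> 4 / r"
  proof -
    have "(2 + log 2 (real n)) / n \<le> (4 * r) / n" using l by (intro divide_right_mono) auto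
    also have "\<dots> = (4 * r) / (r * r)" unfolding r(2) ..
    also have "\<dots> = 4 / r" using r(1) by simp
    finally show ?thesis .
  qed
  have b: "0 \<le> log_loss m" "log_loss m \<le> 20000" unfolding log_loss_def using mr by (auto simp: field_simps)
  \<comment> \<open>The square of 1.15 is below \<open>4 / 3\<close>.\<close>
  have e: "1.15 / r \<le> 1 / sqrt (real m)"
  proof -
    have "(1.15 * sqrt (real m))^2 \<le> r^2"
      using mr unfolding power_mult_distrib r_def by (simp add: power2_eq_square)
    then have "1.15 * sqrt (real m) \<le> r" using r by (simp add: power2_le_iff_abs_le)
    then show ?thesis using mr r by (simp add: field_simps)
  qed
  define w where "w = 5000 / n * (2 + log 2 n)"
  have w: "0 \<le> w" "5000 / n * (1 + log 2 n) \<le> w" "5000 / n * (1 + log 2 n + 1) = w"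
    unfolding w_def using l0 by (auto intro!: divide_right_mono)
  have "5000 / n * (1 + log 2 n) + log_loss m * (2 * (5000 / n * (1 + log 2 n + 1))) \<le> w + 20000 * (2 * w)"
    unfolding w(3) using b w(1,2) by (intro add_mono mult_right_mono) auto
  \<comment> \<open>\<open>200005000 = 5000 * (1 + 40000)\<close>. Four times this stays below
    \<open>900000000 = 0.15 * 6000000000\<close>, the guaranteed gap between
    \<open>const_loss m\<close> and \<open>const_loss n\<close> in units of
    \<open>1 / r\<close>.\<close>
  also have "\<dots> = 200005000 * ((2 + log 2 (real n)) / n)" unfolding w_def by (simp add: add_divide_distrib[symmetric])
  also have "\<dots> \<le> 200005000 * (4 / r)" using lr by (intro mult_left_mono) auto
  also have "\<dots> \<le> 900000000 / r" using r by (simp add: field_simps)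
  also have "\<dots> = 6000000000 * (1.15 / r - 1 / r)" by (simp add: field_simps)
  also have "\<dots> \<le> 6000000000 * (1 / sqrt (real m) - 1 / r)" using e by (intro mult_left_mono) auto
  finally show "5000 / n * (1 + log 2 n) + const_loss m + log_loss m * (2 * (5000 / n * (1 + log 2 n + 1))) \<le> const_loss n"
    unfolding const_loss_def r_def[symmetric] by simp
qed

text \<open>Induction on the block length with free offset. The bound survives a split because both
  loss terms grow from the half to the whole by at least what the split costs per coordinate,
  including the shift that it causes inside the truncated logarithm.\<close>

lemma achievable_coordinate:
  fixes \<mu>c :: "nat \<Rightarrow> nat \<Rightarrow> nat \<Rightarrow> real"
  assumes I: "1 \<le> I" and fin: "finite X" "finite Y" "\<forall>C\<in>set Cs. finite C"
    and nn: "\<And>i x y. 0 \<le> \<mu>c i x y" and le: "\<And>i. (\<Sum>x\<in>X. \<Sum>y\<in>Y. \<mu>c i x y) \<le> 1"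
  shows "1 \<le> n \<Longrightarrow> achievable I (words n X) (words n Y) (xor_power f) (product_prior \<mu>c s n) Cs t \<Longrightarrow>
    \<exists>i t'. s \<le> i \<and> i < s + n \<and> achievable I (words 1 X) (words 1 Y) (xor_power f) (product_prior \<mu>c i 1) Cs t' \<and>
      t' \<le> t / n + I * (const_loss n + log_loss n * log2_plus (t / (n * I)))"
proof (induction n arbitrary: s t rule: less_induct)
  case (less n)
  show ?case
  proof (cases "n = 1")
    case True
    then show ?thesis using less.prems by (intro exI[of _ s] exI[of _ t]) (auto simp: const_loss_def log_loss_def)
  next
    case False
    then have n: "2 \<le> n" using less.prems(1) by simp
    define n1 n2 where "n1 = n div 2" and "n2 = n - n div 2"
    have nn12: "n = n1 + n2" "1 \<le> n1" "1 \<le> n2" "n1 < n" "n2 < n" "4 * n1 \<le> 3 * n" "4 * n2 \<le> 3 * n"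
      unfolding n1_def n2_def using n by auto
    define D where "D = 5000 * I * (1 + log2_plus (t / I))"
    have l: "length x = k" if "x \<in> words k X" for x k and X :: "nat set" using that by (simp add: words_def)
    have "\<exists>t1 t2. achievable I (words n1 X) (words n1 Y) (xor_power f) (product_prior \<mu>c s n1) Cs t1 \<and>
        achievable I (words n2 X) (words n2 Y) (xor_power f) (product_prior \<mu>c (s + n1) n2) Cs t2 \<and> t1 + t2 \<le> t + D"
      unfolding D_def
    proof (rule achievable_split[OF I fin])
      show "achievable I (words (n1 + n2) X) (words (n1 + n2) Y) (xor_power f) (product_prior \<mu>c s (n1 + n2)) Cs t"
        using less.prems(2) unfolding nn12(1)[symmetric] .
      show "product_prior \<mu>c s (n1 + n2) (x1 @ x2) (y1 @ y2) = product_prior \<mu>c s n1 x1 y1 * product_prior \<mu>c (s + n1) n2 x2 y2"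
        if "x1 \<in> words n1 X" "y1 \<in> words n1 Y" for x1 x2 y1 y2 using that l by (intro product_prior_append) auto
      show "xor_power f (x1 @ x2) (y1 @ y2) = (xor_power f x1 y1 \<noteq> xor_power f x2 y2)"
        if "x1 \<in> words n1 X" "y1 \<in> words n1 Y" for x1 x2 y1 y2 using that l by (intro xor_power_append) metis
    qed (rule product_prior_nonneg nn product_prior_sum[OF fin(1,2) nn le])+
    then obtain t1 t2 where r: "achievable I (words n1 X) (words n1 Y) (xor_power f) (product_prior \<mu>c s n1) Cs t1"
      "achievable I (words n2 X) (words n2 Y) (xor_power f) (product_prior \<mu>c (s + n1) n2) Cs t2" "t1 + t2 \<le> t + D" by blast
    \<comment> \<open>Serves either half: apart from its position and length, all that matters is a
      cost of at most \<open>(t + D) / n\<close> per coordinate.\<close>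
    have step: "\<exists>i t'. s \<le> i \<and> i < s + n \<and> achievable I (words 1 X) (words 1 Y) (xor_power f) (product_prior \<mu>c i 1) Cs t' \<and>
      t' \<le> t / n + I * (const_loss n + log_loss n * log2_plus (t / (n * I)))"
      if m: "1 \<le> m" "m < n" "4 * m \<le> 3 * n" "s \<le> s'" "s' + m \<le> s + n"
        and g: "achievable I (words m X) (words m Y) (xor_power f) (product_prior \<mu>c s' m) Cs tm"
        and tm: "tm \<le> m * ((t + D) / n)" for m s' tm
    proof -
      obtain i t' where i: "s' \<le> i" "i < s' + m" "achievable I (words 1 X) (words 1 Y) (xor_power f) (product_prior \<mu>c i 1) Cs t'"
        "t' \<le> tm / m + I * (const_loss m + log_loss m * log2_plus (tm / (m * I)))"
        using less.IH[OF m(2,1) g] by blast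
      define c where "c = t / (n * I)"
      define c' where "c' = tm / (m * I)"
      have nI: "0 < real n" "0 < real m" "0 < I" using n m I by auto
      \<comment> \<open>The loss of a split involves the total cost, whose logarithm exceeds that of
        the cost per coordinate by \<open>log 2 n\<close>. Divided by \<open>n\<close>, this is
        still summable along the recursion.\<close>
      have "log2_plus (t / I) \<le> log 2 n + log2_plus c"
      proof -
        have "t / I = real n * c" unfolding c_def using nI by simp
        then show ?thesis using log2_plus_mult[of "real n" c] n by simp
      qed
      then have D: "D \<le> 5000 * I * (1 + log 2 n + log2_plus c)"
        unfolding D_def using I by (intro mult_left_mono) auto
      have c': "c' \<le> c + 5000 / n * (1 + log 2 n + log2_plus c)"
      proof -
        have "c' \<le> (t + D) / (n * I)" unfolding c'_def using tm nI by (simp add: field_simps)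
        also have "\<dots> \<le> (t + 5000 * I * (1 + log 2 n + log2_plus c)) / (n * I)"
          using D nI by (intro divide_right_mono) auto
        also have "\<dots> = c + 5000 / n * (1 + log 2 n + log2_plus c)"
          unfolding c_def using nI by (simp add: add_divide_distrib)
        finally show ?thesis .
      qed
      have b0: "0 \<le> log_loss m" unfolding log_loss_def using m by (intro mult_nonneg_nonneg) (auto simp: divide_le_eq_1)
      have lc: "log2_plus c' \<le> log2_plus c + 2 * (5000 / n * (1 + log 2 n + 1))"
        using c' n by (intro log2_plus_perturb) auto
      have "t' / I \<le> c' + (const_loss m + log_loss m * log2_plus c')"
        using i(4) nI unfolding c'_def by (simp add: field_simps)
      also have "\<dots> \<le> c' + (const_loss m + log_loss m * (log2_plus c + 2 * (5000 / n * (1 + log 2 n + 1))))"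
        using lc b0 by (intro add_left_mono mult_left_mono)
      also have "\<dots> \<le> c + 5000 / n * (1 + log 2 n + log2_plus c) +
          (const_loss m + log_loss m * (log2_plus c + 2 * (5000 / n * (1 + log 2 n + 1))))" using c' by simp
      also have "\<dots> = c + (5000 / n * (1 + log 2 n) + const_loss m + log_loss m * (2 * (5000 / n * (1 + log 2 n + 1))))
          + (5000 / n + log_loss m) * log2_plus c" by (simp only: algebra_simps)
      also have "\<dots> \<le> c + const_loss n + log_loss n * log2_plus c"
        using loss_step[OF n m(1,3)] log2_plus_nonneg[of c] by (intro add_mono mult_right_mono) auto
      finally have "t' \<le> I * (c + const_loss n + log_loss n * log2_plus c)" using nI by (simp add: divide_le_eq mult.commute)
      also have "\<dots> = t / n + I * (const_loss n + log_loss n * log2_plus c)" unfolding c_def using nI by (simp add: distrib_left)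
      finally show ?thesis using i m unfolding c_def by (intro exI[of _ i] exI[of _ t']) auto
    qed
    show ?thesis
    proof (cases "t1 \<le> n1 * ((t + D) / n)")
      case True
      then show ?thesis using nn12 by (intro step[OF _ _ _ _ _ r(1)]) auto
    next
      case False
      have "n1 * ((t + D) / n) + n2 * ((t + D) / n) = t + D"
        unfolding distrib_right[symmetric] of_nat_add[symmetric] nn12(1)[symmetric] using n by simp
      then have "t2 \<le> n2 * ((t + D) / n)" using False r(3) by linarith
      then show ?thesis using nn12 by (intro step[OF _ _ _ _ _ r(2)]) auto
    qed
  qed
qed

section \<open>Kernels and protocol distributions\<close>

lemma prob_finite:
  assumes fin: "finite X" "finite Y" "finite L" and sub: "set_pmf p \<subseteq> X \<times> Y \<times> L"
  shows "\<P>(w in p. Q w) = (\<Sum>x\<in>X. \<Sum>y\<in>Y. \<Sum>m\<in>L. pmf p (x, y, m) * of_bool (Q (x, y, m)))"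
proof -
  let ?S = "X \<times> Y \<times> L"
  have "{w. Q w} \<inter> ?S \<inter> set_pmf p = {w. Q w} \<inter> set_pmf p" using sub by blast
  then have "\<P>(w in p. Q w) = measure p ({w. Q w} \<inter> ?S)"
    using measure_Int_set_pmf[of p "{w. Q w}"] measure_Int_set_pmf[of p "{w. Q w} \<inter> ?S"] by simp
  also have "\<dots> = sum (pmf p) ({w. Q w} \<inter> ?S)" using fin by (intro measure_measure_pmf_finite) auto
  also have "\<dots> = (\<Sum>w\<in>?S. pmf p w * of_bool (Q w))"
    using fin by (intro sum.mono_neutral_cong_left) auto
  finally show ?thesis by (simp add: sum.cartesian_product')
qed

lemma pmf_finite_exists:
  assumes fin: "finite S" and f: "\<And>z. z \<in> S \<Longrightarrow> 0 \<le> f z" and s: "sum f S = 1"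
  shows "\<exists>p. \<forall>z. pmf p z = (if z \<in> S then f z else 0)"
proof -
  define g where "g z = (if z \<in> S then f z else 0)" for z
  have nn: "0 \<le> g z" for z unfolding g_def using f by simp
  have "(\<integral>\<^sup>+ z. ennreal (g z) \<partial>count_space UNIV) = (\<Sum>z\<in>S. ennreal (g z))"
    using fin by (intro nn_integral_count_space') (auto simp: g_def)
  also have "\<dots> = ennreal (sum g S)" using nn by simp
  also have "sum g S = 1" using s by (simp add: g_def)
  finally have "pmf (embed_pmf g) z = g z" for z using nn by (intro pmf_embed_pmf) auto
  then show ?thesis unfolding g_def by blast
qed

text \<open>Unlike \<open>kern\<close>, this speaks only about prefixes of actual transcripts.
  Numbers outside the alphabets may decode to words after which the weights do not sum to 1.\<close>

definition kernel_on :: "'m set list \<Rightarrow> ('m list \<Rightarrow> 'm \<Rightarrow> real) \<Rightarrow> bool" where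
  "kernel_on As G \<longleftrightarrow> (\<forall>m\<in>listset As. \<forall>j<length As. 0 \<le> G (take j m) (m ! j) \<and> (\<Sum>z\<in>As ! j. G (take j m) z) = 1)"

text \<open>Descending induction on \<open>j\<close>: a full transcript has its own product as mass,
  and summing out one entry removes its factor by normalization.\<close>

lemma prefix_mass_kernel:
  assumes fin: "\<forall>A\<in>set As. finite A" and G: "kernel_on As G" and m: "m \<in> listset As" and j: "j \<le> length As"
  shows "prefix_mass As (\<lambda>m. \<Prod>i<length As. G (take i m) (m ! i)) (take j m) = (\<Prod>i<j. G (take i m) (m ! i))"
  using j m
proof (induction arbitrary: m rule: inc_induct)
  case base
  then have "take (length As) m = m" by (simp add: listset_conv)
  then show ?case using prefix_mass_full[OF fin base] by simp
next
  case (step j)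
  have l: "length m = length As" using step.prems by (simp add: listset_conv)
  have lj: "length (take j m) = j" "j < length m" using l step.hyps by auto
  have "prefix_mass As (\<lambda>m. \<Prod>i<length As. G (take i m) (m ! i)) (take j m @ [z]) = (\<Prod>i<j. G (take i m) (m ! i)) * G (take j m) z"
    if z: "z \<in> As ! j" for z
  proof -
    have m': "m[j := z] \<in> listset As" unfolding listset_conv
    proof (intro conjI allI impI)
      show "m[j := z] ! i \<in> As ! i" if "i < length As" for i
        using step.prems z that lj by (cases "i = j") (auto simp: listset_conv)
    qed (simp add: l)
    have "take j m @ [z] = take (Suc j) (m[j := z])" using lj by (simp add: take_Suc_conv_app_nth)
    moreover have "(\<Prod>i<Suc j. G (take i (m[j := z])) (m[j := z] ! i)) = (\<Prod>i<j. G (take i m) (m ! i)) * G (take j m) z"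
      using lj by simp
    ultimately show ?thesis using step.IH[OF m'] by simp
  qed
  then have "prefix_mass As (\<lambda>m. \<Prod>i<length As. G (take i m) (m ! i)) (take j m) =
      (\<Sum>z\<in>As ! j. (\<Prod>i<j. G (take i m) (m ! i)) * G (take j m) z)"
    using prefix_mass_step[OF fin, of "take j m"] lj l by (metis (no_types, lifting) sum.cong)
  also have "\<dots> = (\<Prod>i<j. G (take i m) (m ! i))"
    using G step.prems step.hyps unfolding kernel_on_def by (simp add: sum_distrib_left[symmetric])
  finally show ?case .
qed

text \<open>At odd positions \<open>G\<close> depends only on \<open>x\<close> and the prefix, so it
  can be pulled out of the sum over \<open>y\<close> and equals the conditional probability given
  \<open>x\<close> and the prefix; symmetrically for Bob. This holds wherever the prefix is not
  null, which is enough for the factorization.\<close>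

lemma protocol_dist_kernel:
  assumes fin: "finite X" "finite Y" "\<forall>A\<in>set As. finite A" and len: "2 \<le> length As" and ne: "listset As \<noteq> {}"
    and G: "\<And>x y pre z. G x y pre z = (if pre = [] then r z else if odd (length pre) then a x pre z else b y pre z)"
    and kern: "\<And>x y. x \<in> X \<Longrightarrow> y \<in> Y \<Longrightarrow> kernel_on As (G x y)"
    and mu: "set_pmf \<mu> \<subseteq> X \<times> Y"
    and p: "\<And>x y m. pmf p (x, y, m) = (if x \<in> X \<and> y \<in> Y \<and> m \<in> listset As
        then pmf \<mu> (x, y) * (\<Prod>j<length As. G x y (take j m) (m ! j)) else 0)"
  shows "inputs p = \<mu>" "protocol_dist X Y As p"
proof -
  let ?L = "listset As"
  have finL: "finite ?L" using fin(3) by (rule finite_listset)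
  have sub: "set_pmf p \<subseteq> X \<times> Y \<times> ?L" by (auto simp: set_pmf_iff p split: if_splits)
  \<comment> \<open>The probability that the inputs satisfy \<open>R\<close> and the first
    \<open>j\<close> entries are those of \<open>m\<close>. Choosing \<open>R\<close> as
    \<open>x' = x\<close>, as \<open>y' = y\<close> or as true covers every conditioning event that
    occurs.\<close>
  define T where "T R m j = (\<Sum>x\<in>X. \<Sum>y\<in>Y. of_bool (R x y) * (pmf \<mu> (x, y) * (\<Prod>i<j. G x y (take i m) (m ! i))))" for R m j
  have prefix: "\<P>(w in p. R (fst w) (fst (snd w)) \<and> take j (snd (snd w)) = take j m) = T R m j"
    if m: "m \<in> ?L" "j \<le> length As" for R m j
    unfolding prob_finite[OF fin(1,2) finL sub] T_def
  proof (intro sum.cong refl)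
    fix x y assume xy: "x \<in> X" "y \<in> Y"
    have lj: "length (take j m) = j" using m by (simp add: listset_conv)
    have "(\<Sum>m'\<in>?L. pmf p (x, y, m') * of_bool (R (fst (x, y, m')) (fst (snd (x, y, m'))) \<and> take j (snd (snd (x, y, m'))) = take j m))
      = of_bool (R x y) * (pmf \<mu> (x, y) * prefix_mass As (\<lambda>m. \<Prod>i<length As. G x y (take i m) (m ! i)) (take j m))"
      unfolding prefix_mass_def lj sum_distrib_left by (intro sum.cong refl) (auto simp: p xy)
    then show "(\<Sum>m'\<in>?L. pmf p (x, y, m') * of_bool (R (fst (x, y, m')) (fst (snd (x, y, m'))) \<and> take j (snd (snd (x, y, m'))) = take j m))
      = of_bool (R x y) * (pmf \<mu> (x, y) * (\<Prod>i<j. G x y (take i m) (m ! i)))"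
      unfolding prefix_mass_kernel[OF fin(3) kern[OF xy] m] .
  qed
  have extend: "\<P>(w in p. snd (snd w) ! j = m ! j \<and> R (fst w) (fst (snd w)) \<and> take j (snd (snd w)) = take j m) = T R m (Suc j)"
    if m: "m \<in> ?L" "j < length As" for R m j
    unfolding prefix[OF m(1) Suc_leI[OF m(2)], symmetric] prob_finite[OF fin(1,2) finL sub]
  proof (intro sum.cong refl arg_cong2[where f = "(*)"] arg_cong[where f = of_bool])
    fix m' assume "m' \<in> ?L"
    then show "(snd (snd (x, y, m')) ! j = m ! j \<and> R (fst (x, y, m')) (fst (snd (x, y, m'))) \<and> take j (snd (snd (x, y, m'))) = take j m) =
      (R (fst (x, y, m')) (fst (snd (x, y, m'))) \<and> take (Suc j) (snd (snd (x, y, m'))) = take (Suc j) m)" for x y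
      using m by (auto simp: listset_conv take_Suc_conv_app_nth)
  qed
  obtain m0 where m0: "m0 \<in> ?L" using ne by blast
  show inp: "inputs p = \<mu>"
  proof (rule pmf_eqI)
    fix xy :: "'a \<times> 'b"
    obtain x y where xy: "xy = (x, y)" by (cases xy)
    have "(\<lambda>(x, y, m). (x, y)) -` {(x, y)} = {w \<in> space p. (fst w = x \<and> fst (snd w) = y) \<and> take 0 (snd (snd w)) = take 0 m0}"
      by auto
    then have "pmf (inputs p) (x, y) = T (\<lambda>x' y'. x' = x \<and> y' = y) m0 0"
      unfolding inputs_def pmf_map prefix[OF m0 le0, symmetric] by simp
    also have "\<dots> = (\<Sum>x'\<in>X. if x' = x then \<Sum>y'\<in>Y. if y' = y then pmf \<mu> (x, y) else 0 else 0)"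
      unfolding T_def by (intro sum.cong refl) (auto intro!: sum.cong)
    also have "\<dots> = (if x \<in> X \<and> y \<in> Y then pmf \<mu> (x, y) else 0)" using fin by simp
    also have "\<dots> = pmf \<mu> (x, y)" using mu by (auto simp: set_pmf_iff)
    finally show "pmf (inputs p) xy = pmf \<mu> xy" unfolding xy .
  qed
  define c where "c x y m j = (if odd j
      then \<P>(w in p. snd (snd w) ! j = m ! j \<bar> fst w = x \<and> take j (snd (snd w)) = take j m)
      else \<P>(w in p. snd (snd w) ! j = m ! j \<bar> fst (snd w) = y \<and> take j (snd (snd w)) = take j m))" for x y m j
  have Gnn: "0 \<le> (\<Prod>i<j. G x y (take i m) (m ! i))" if "x \<in> X" "y \<in> Y" "m \<in> ?L" "j \<le> length As" for x y m j
    using kern[OF that(1,2)] that(3,4) unfolding kernel_on_def by (intro prod_nonneg) auto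
  have Tpos: "0 < T R m j"
    if "x \<in> X" "y \<in> Y" "m \<in> ?L" "j \<le> length As" "R x y" "pmf \<mu> (x, y) * (\<Prod>i<j. G x y (take i m) (m ! i)) \<noteq> 0" for R x y m j
  proof -
    have nn: "0 \<le> of_bool (R x y) * (pmf \<mu> (x, y) * (\<Prod>i<j. G x y (take i m) (m ! i)))" if "x \<in> X" "y \<in> Y" for x y
      using Gnn[OF that \<open>m \<in> ?L\<close> \<open>j \<le> length As\<close>] by simp
    have "0 < of_bool (R x y) * (pmf \<mu> (x, y) * (\<Prod>i<j. G x y (take i m) (m ! i)))"
      using nn[OF that(1,2)] that(5,6) by (simp only: le_less of_bool_eq mult_1_left) auto
    also have "\<dots> \<le> (\<Sum>y\<in>Y. of_bool (R x y) * (pmf \<mu> (x, y) * (\<Prod>i<j. G x y (take i m) (m ! i))))"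
      using fin(2) nn[OF that(1)] that(2) by (intro member_le_sum[of y]) auto
    also have "\<dots> \<le> T R m j" unfolding T_def
      by (rule member_le_sum[of x X "\<lambda>x. \<Sum>y\<in>Y. of_bool (R x y) * (pmf \<mu> (x, y) * (\<Prod>i<j. G x y (take i m) (m ! i)))"])
         (use fin(1) that(1) nn in \<open>auto intro!: sum_nonneg\<close>)
    finally show ?thesis .
  qed
  have cond: "c x y m j = G x y (take j m) (m ! j)"
    if xy: "x \<in> X" "y \<in> Y" and m: "m \<in> ?L" and j: "1 \<le> j" "j < length As"
      and pos: "pmf \<mu> (x, y) * (\<Prod>i<j. G x y (take i m) (m ! i)) \<noteq> 0" for x y m j
  proof -
    have lj: "length (take j m) = j" "take j m \<noteq> []" using m j by (auto simp: listset_conv)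
    have mult: "T R m (Suc j) = G x y (take j m) (m ! j) * T R m j"
      if "\<And>x' y'. R x' y' \<Longrightarrow> G x' y' (take j m) (m ! j) = G x y (take j m) (m ! j)" for R
      unfolding T_def sum_distrib_left using that by (intro sum.cong refl) (auto simp: of_bool_def)
    show ?thesis
    proof (cases "odd j")
      case True
      have "T (\<lambda>x' y'. x' = x) m (Suc j) = G x y (take j m) (m ! j) * T (\<lambda>x' y'. x' = x) m j"
        by (rule mult) (use True in \<open>simp only: G lj if_True if_False not_False_eq_True not_True_eq_False\<close>)
      moreover have "0 < T (\<lambda>x' y'. x' = x) m j" using pos xy m j by (intro Tpos[of x y]) auto
      ultimately show ?thesis unfolding c_def cond_prob_def
        using True extend[OF m j(2), of "\<lambda>x' y'. x' = x"] prefix[OF m less_imp_le[OF j(2)], of "\<lambda>x' y'. x' = x"] by simp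
    next
      case False
      have "T (\<lambda>x' y'. y' = y) m (Suc j) = G x y (take j m) (m ! j) * T (\<lambda>x' y'. y' = y) m j"
        by (rule mult) (use False in \<open>simp only: G lj if_True if_False not_False_eq_True not_True_eq_False\<close>)
      moreover have "0 < T (\<lambda>x' y'. y' = y) m j" using pos xy m j by (intro Tpos[of x y]) auto
      ultimately show ?thesis unfolding c_def cond_prob_def
        using False extend[OF m j(2), of "\<lambda>x' y'. y' = y"] prefix[OF m less_imp_le[OF j(2)], of "\<lambda>x' y'. y' = y"] by simp
    qed
  qed
  have first: "\<P>(w in p. snd (snd w) ! 0 = m ! 0) = r (m ! 0)" if m: "m \<in> ?L" for m
  proof -
    have l: "0 < length As" using len by linarith
    have "\<P>(w in p. snd (snd w) ! 0 = m ! 0) = T (\<lambda>_ _. True) m (Suc 0)"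
      using extend[OF m l, of "\<lambda>_ _. True"] by simp
    also have "\<dots> = r (m ! 0) * T (\<lambda>_ _. True) m 0"
      unfolding T_def sum_distrib_left by (simp add: G mult.commute)
    also have "T (\<lambda>_ _. True) m 0 = 1" using prefix[OF m, of 0 "\<lambda>_ _. True"] measure_pmf.prob_space[of p] by simp
    finally show ?thesis by simp
  qed
  \<comment> \<open>Once a prefix is null both products have become 0, so the identity
    \<open>cond\<close> is called only while the product is nonzero.\<close>
  have main: "pmf \<mu> (x, y) * r (m ! 0) * (\<Prod>j = 1..<k. c x y m j) = pmf \<mu> (x, y) * (\<Prod>j<k. G x y (take j m) (m ! j))"
    if xy: "x \<in> X" "y \<in> Y" and m: "m \<in> ?L" and "1 \<le> k" "k \<le> length As" for x y m k
    using that(4,5)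
  proof (induction k rule: dec_induct)
    case base
    then show ?case by (simp add: G)
  next
    case (step k)
    then have IH: "pmf \<mu> (x, y) * r (m ! 0) * (\<Prod>j = 1..<k. c x y m j) = pmf \<mu> (x, y) * (\<Prod>j<k. G x y (take j m) (m ! j))"
      by simp
    have "pmf \<mu> (x, y) * r (m ! 0) * (\<Prod>j = 1..<Suc k. c x y m j) =
        pmf \<mu> (x, y) * r (m ! 0) * (\<Prod>j = 1..<k. c x y m j) * c x y m k"
      using step.hyps by (simp add: prod.atLeastLessThan_Suc mult.assoc)
    also have "\<dots> = pmf \<mu> (x, y) * (\<Prod>j<k. G x y (take j m) (m ! j)) * G x y (take k m) (m ! k)"
    proof (cases "pmf \<mu> (x, y) * (\<Prod>j<k. G x y (take j m) (m ! j)) = 0")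
      case True
      then show ?thesis unfolding IH by simp
    next
      case False
      then have "c x y m k = G x y (take k m) (m ! k)"
        using step.hyps step.prems by (intro cond xy m) auto
      then show ?thesis unfolding IH by simp
    qed
    finally show ?case by (simp add: mult.assoc)
  qed
  show "protocol_dist X Y As p"
    unfolding protocol_dist_def c_def[symmetric] inp
  proof (intro conjI ballI len fin(3) sub)
    fix x y m assume xy: "x \<in> X" "y \<in> Y" and m: "m \<in> ?L"
    show "pmf p (x, y, m) = pmf \<mu> (x, y) * \<P>(w in p. snd (snd w) ! 0 = m ! 0) * (\<Prod>j = 1..<length As. c x y m j)"
      unfolding first[OF m] by (subst main[OF xy m]) (use len xy m in \<open>auto simp: p\<close>)
  qed (use fin(3) in blast)
qed

lemma pmf_inputs:
  assumes fin: "finite X" "finite Y" "finite L" and sub: "set_pmf p \<subseteq> X \<times> Y \<times> L" and xy: "x \<in> X" "y \<in> Y"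
  shows "pmf (inputs p) (x, y) = (\<Sum>m\<in>L. pmf p (x, y, m))"
proof -
  have "(\<lambda>(x, y, m). (x, y)) -` {(x, y)} = {w \<in> space p. fst w = x \<and> fst (snd w) = y}" by auto
  then have "pmf (inputs p) (x, y) = (\<Sum>x'\<in>X. \<Sum>y'\<in>Y. \<Sum>m\<in>L. pmf p (x', y', m) * of_bool (x' = x \<and> y' = y))"
    unfolding inputs_def pmf_map using prob_finite[OF fin sub, of "\<lambda>w. fst w = x \<and> fst (snd w) = y"] by simp
  also have "\<dots> = (\<Sum>x'\<in>X. if x' = x then \<Sum>y'\<in>Y. if y' = y then \<Sum>m\<in>L. pmf p (x, y, m) else 0 else 0)"
    by (intro sum.cong refl) (auto intro!: sum.cong)
  finally show ?thesis using fin xy by simp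
qed

text \<open>The support point ensures that the conditioning event of \<open>cond_pmf\<close> is not
  null.\<close>

lemma cond_bias_eq:
  assumes fin: "finite X" "finite Y" "finite L" and sub: "set_pmf q \<subseteq> X \<times> Y \<times> L" and m: "(x, y, m) \<in> set_pmf q"
  shows "cond_bias q h m = bias X Y h (\<lambda>x y m. pmf q (x, y, m)) m"
proof -
  let ?E = "{w. snd (snd w) = m}"
  have ne: "set_pmf q \<inter> ?E \<noteq> {}" using m by force
  have mL: "m \<in> L" using sub m by blast
  have D: "measure q ?E = (\<Sum>x\<in>X. \<Sum>y\<in>Y. pmf q (x, y, m))"
  proof -
    have "measure q ?E = (\<Sum>x\<in>X. \<Sum>y\<in>Y. \<Sum>m'\<in>L. pmf q (x, y, m') * of_bool (m' = m))"
      using prob_finite[OF fin sub, of "\<lambda>w. snd (snd w) = m"] by simp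
    also have "\<dots> = (\<Sum>x\<in>X. \<Sum>y\<in>Y. \<Sum>m'\<in>L. if m' = m then pmf q (x, y, m) else 0)"
      by (intro sum.cong refl) auto
    finally show ?thesis using fin mL by simp
  qed
  have "measure_pmf.expectation (cond_pmf q ?E) (\<lambda>(x, y, _). (- 1) ^ (of_bool (h x y) :: nat))
      = (\<Sum>w\<in>X \<times> Y \<times> L. (\<lambda>(x, y, _). (- 1) ^ (of_bool (h x y) :: nat)) w * pmf (cond_pmf q ?E) w)"
    using fin sub ne by (intro integral_measure_pmf_real) auto
  also have "\<dots> = (\<Sum>w\<in>X \<times> Y \<times> L. if snd (snd w) = m then sg (h (fst w) (fst (snd w))) * (pmf q (fst w, fst (snd w), m) / measure q ?E) else 0)"
    by (intro sum.cong refl) (auto simp: pmf_cond[OF ne] sg_def)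
  also have "\<dots> = (\<Sum>x\<in>X. \<Sum>y\<in>Y. pmf q (x, y, m) * sg (h x y) / measure q ?E)"
    using fin mL by (simp add: sum.cartesian_product' mult.commute)
  also have "\<dots> = (\<Sum>x\<in>X. \<Sum>y\<in>Y. pmf q (x, y, m) * sg (h x y)) / measure q ?E"
    by (simp add: sum_divide_distrib)
  finally show ?thesis unfolding cond_bias_def bias_def D[symmetric] by simp
qed

lemma cond_prob_left:
  assumes fin: "finite X" "finite Y" "finite L" and sub: "set_pmf p \<subseteq> X \<times> Y \<times> L" and xy: "x \<in> X" "y \<in> Y"
  shows "\<P>(w in p. fst w = x \<bar> fst (snd w) = y) = pmf (inputs p) (x, y) / (\<Sum>x'\<in>X. pmf (inputs p) (x', y))"
    and "m \<in> L \<Longrightarrow> \<P>(w in p. fst w = x \<bar> fst (snd w) = y \<and> snd (snd w) = m) = pmf p (x, y, m) / (\<Sum>x'\<in>X. pmf p (x', y, m))"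
proof -
  have n: "\<P>(w in p. fst w = x \<and> fst (snd w) = y) = pmf (inputs p) (x, y)"
    unfolding inputs_def pmf_map by (intro arg_cong[where f = "measure p"]) auto
  have "\<P>(w in p. fst (snd w) = y) = (\<Sum>x\<in>X. \<Sum>y'\<in>Y. if y' = y then \<Sum>m\<in>L. pmf p (x, y, m) else 0)"
    unfolding prob_finite[OF fin sub] by (intro sum.cong refl) auto
  also have "\<dots> = (\<Sum>x\<in>X. pmf (inputs p) (x, y))" using fin xy by (simp add: pmf_inputs[OF fin sub])
  finally show "\<P>(w in p. fst w = x \<bar> fst (snd w) = y) = pmf (inputs p) (x, y) / (\<Sum>x'\<in>X. pmf (inputs p) (x', y))"
    unfolding cond_prob_def n by simp
  assume m: "m \<in> L"
  have "{w \<in> space p. fst w = x \<and> fst (snd w) = y \<and> snd (snd w) = m} = {(x, y, m)}" by auto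
  then have n: "\<P>(w in p. fst w = x \<and> fst (snd w) = y \<and> snd (snd w) = m) = pmf p (x, y, m)"
    by (simp add: measure_pmf_single)
  have "\<P>(w in p. fst (snd w) = y \<and> snd (snd w) = m) =
      (\<Sum>x\<in>X. \<Sum>y'\<in>Y. if y' = y then \<Sum>m'\<in>L. if m' = m then pmf p (x, y, m) else 0 else 0)"
    unfolding prob_finite[OF fin sub] by (intro sum.cong refl) (auto intro!: sum.cong)
  also have "\<dots> = (\<Sum>x\<in>X. pmf p (x, y, m))" using fin xy m by simp
  finally show "\<P>(w in p. fst w = x \<bar> fst (snd w) = y \<and> snd (snd w) = m) = pmf p (x, y, m) / (\<Sum>x'\<in>X. pmf p (x', y, m))"
    unfolding cond_prob_def n by simp
qed

lemma cond_prob_right: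
  assumes fin: "finite X" "finite Y" "finite L" and sub: "set_pmf p \<subseteq> X \<times> Y \<times> L" and xy: "x \<in> X" "y \<in> Y"
  shows "\<P>(w in p. fst (snd w) = y \<bar> fst w = x) = pmf (inputs p) (x, y) / (\<Sum>y'\<in>Y. pmf (inputs p) (x, y'))"
    and "m \<in> L \<Longrightarrow> \<P>(w in p. fst (snd w) = y \<bar> fst w = x \<and> snd (snd w) = m) = pmf p (x, y, m) / (\<Sum>y'\<in>Y. pmf p (x, y', m))"
proof -
  have n: "\<P>(w in p. fst (snd w) = y \<and> fst w = x) = pmf (inputs p) (x, y)"
    unfolding inputs_def pmf_map by (intro arg_cong[where f = "measure p"]) auto
  have "\<P>(w in p. fst w = x) = (\<Sum>x'\<in>X. if x' = x then \<Sum>y\<in>Y. \<Sum>m\<in>L. pmf p (x, y, m) else 0)"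
    unfolding prob_finite[OF fin sub] by (intro sum.cong refl) auto
  also have "\<dots> = (\<Sum>y\<in>Y. pmf (inputs p) (x, y))" using fin xy by (simp add: pmf_inputs[OF fin sub])
  finally show "\<P>(w in p. fst (snd w) = y \<bar> fst w = x) = pmf (inputs p) (x, y) / (\<Sum>y'\<in>Y. pmf (inputs p) (x, y'))"
    unfolding cond_prob_def n by simp
  assume m: "m \<in> L"
  have "{w \<in> space p. fst (snd w) = y \<and> fst w = x \<and> snd (snd w) = m} = {(x, y, m)}" by auto
  then have n: "\<P>(w in p. fst (snd w) = y \<and> fst w = x \<and> snd (snd w) = m) = pmf p (x, y, m)"
    by (simp add: measure_pmf_single)
  have "\<P>(w in p. fst w = x \<and> snd (snd w) = m) =
      (\<Sum>x'\<in>X. if x' = x then \<Sum>y\<in>Y. \<Sum>m'\<in>L. if m' = m then pmf p (x, y, m) else 0 else 0)"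
    unfolding prob_finite[OF fin sub] by (intro sum.cong refl) (auto intro!: sum.cong)
  also have "\<dots> = (\<Sum>y\<in>Y. pmf p (x, y, m))" using fin xy m by simp
  finally show "\<P>(w in p. fst (snd w) = y \<bar> fst w = x \<and> snd (snd w) = m) = pmf p (x, y, m) / (\<Sum>y'\<in>Y. pmf p (x, y', m))"
    unfolding cond_prob_def n by simp
qed

text \<open>For a finite threshold the value \<open>\<infinity>\<close> turns into the two
  positivity conditions. The cases \<open>px = 0\<close> and \<open>py = 0\<close> are covered by
  the first, since a positive \<open>p\<close> at \<open>(x, y, m)\<close> has a positive input
  marginal. The exponent is \<open>12 / marginal_delta = 180\<close>.\<close>

lemma marginal_cost_le_iff:
  assumes fin: "finite X" "finite Y" "finite L" and sub: "set_pmf p \<subseteq> X \<times> Y \<times> L" "set_pmf q \<subseteq> X \<times> Y \<times> L"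
    and q: "(x, y, m) \<in> set_pmf q"
  shows "marginal_cost I p h q x y m \<le> ereal t \<longleftrightarrow>
     0 < pmf p (x, y, m) \<and> 0 < bias X Y h (\<lambda>x y m. pmf q (x, y, m)) m \<and>
     info_cost I X Y (\<lambda>x y. pmf (inputs p) (x, y)) (\<lambda>x y m. pmf p (x, y, m)) (\<lambda>x y m. pmf q (x, y, m)) x y m
       - 180 * I * log 2 (bias X Y h (\<lambda>x y m. pmf q (x, y, m)) m) \<le> t"
proof -
  have xym: "x \<in> X" "y \<in> Y" "m \<in> L" using q sub by auto
  define e where "e = bias X Y h (\<lambda>x y m. pmf q (x, y, m)) m"
  define px where "px = pmf (inputs p) (x, y) / (\<Sum>x'\<in>X. pmf (inputs p) (x', y))"
  define py where "py = pmf (inputs p) (x, y) / (\<Sum>y'\<in>Y. pmf (inputs p) (x, y'))"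
  define qx where "qx = pmf q (x, y, m) / (\<Sum>x'\<in>X. pmf q (x', y, m))"
  define qy where "qy = pmf q (x, y, m) / (\<Sum>y'\<in>Y. pmf q (x, y', m))"
  have e0: "0 \<le> e" unfolding e_def bias_def by (intro divide_nonneg_nonneg sum_nonneg) auto
  have cost: "marginal_cost I p h q x y m = (if px = 0 \<or> py = 0 \<or> pmf p (x, y, m) = 0 \<or> e = 0 then \<infinity>
         else ereal (log 2 (qx / px * (qy / py) * (pmf q (x, y, m) / pmf p (x, y, m)) powr I * e powr (- 180 * I))))"
    unfolding marginal_cost_def Let_def cond_bias_eq[OF fin sub(2) q] cond_prob_left(1)[OF fin sub(1) xym(1,2)]
      cond_prob_left(2)[OF fin sub(2) xym] cond_prob_right(1)[OF fin sub(1) xym(1,2)]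
      cond_prob_right(2)[OF fin sub(2) xym] e_def[symmetric] px_def[symmetric] py_def[symmetric]
      qx_def[symmetric] qy_def[symmetric] marginal_delta_def by simp
  show ?thesis
  proof (cases "0 < pmf p (x, y, m) \<and> 0 < e")
    case False
    then have "pmf p (x, y, m) = 0 \<or> e = 0" using e0 by (auto simp: not_less intro: antisym pmf_nonneg)
    then show ?thesis unfolding cost e_def[symmetric] by auto
  next
    case True
    have q0: "0 < pmf q (x, y, m)" using q by (simp add: pmf_positive)
    have "pmf p (x, y, m) \<le> pmf (inputs p) (x, y)"
      unfolding pmf_inputs[OF fin sub(1) xym(1,2)] using fin xym by (intro member_le_sum[of m L "\<lambda>m. pmf p (x, y, m)"]) auto
    then have mu: "0 < pmf (inputs p) (x, y)" using True by linarith
    have pos: "0 < px" "0 < py" "0 < qx" "0 < qy"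
      unfolding px_def py_def qx_def qy_def using mu q0 fin xym
      by (auto intro!: divide_pos_pos sum_pos2[of X x "\<lambda>x. pmf (inputs p) (x, y)"] sum_pos2[of Y y "\<lambda>y. pmf (inputs p) (x, y)"]
        sum_pos2[of X x "\<lambda>x. pmf q (x, y, m)"] sum_pos2[of Y y "\<lambda>y. pmf q (x, y, m)"])
    have "log 2 (a * b * c powr I * e powr s) = log 2 a + log 2 b + I * log 2 c + s * log 2 e"
      if "0 < a" "0 < b" "0 < c" for a b c s :: real using that True by (simp add: log_mult log_powr)
    from this[of "qx / px" "qy / py" "pmf q (x, y, m) / pmf p (x, y, m)" "- 180 * I"]
    have "log 2 (qx / px * (qy / py) * (pmf q (x, y, m) / pmf p (x, y, m)) powr I * e powr (- 180 * I))
       = log 2 (qx / px) + log 2 (qy / py) + I * log 2 (pmf q (x, y, m) / pmf p (x, y, m)) - 180 * I * log 2 e"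
      using pos q0 True by simp
    then show ?thesis using True pos unfolding cost e_def[symmetric] info_cost_def px_def[symmetric] py_def[symmetric]
      qx_def[symmetric] qy_def[symmetric] by simp
  qed
qed

lemma SUP_marginal_cost_le_iff:
  assumes fin: "finite X" "finite Y" "finite L" and sub: "set_pmf p \<subseteq> X \<times> Y \<times> L" "set_pmf q \<subseteq> X \<times> Y \<times> L"
  shows "(SUP (x, y, m)\<in>set_pmf q. marginal_cost I p h q x y m) \<le> ereal t \<longleftrightarrow>
    cheap I X Y L (\<lambda>x y. pmf (inputs p) (x, y)) h (\<lambda>x y m. pmf p (x, y, m)) (\<lambda>x y m. pmf q (x, y, m)) t"
proof -
  have "(SUP (x, y, m)\<in>set_pmf q. marginal_cost I p h q x y m) \<le> ereal t \<longleftrightarrow>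
    (\<forall>x y m. (x, y, m) \<in> set_pmf q \<longrightarrow> marginal_cost I p h q x y m \<le> ereal t)"
    unfolding SUP_le_iff by auto
  also have "\<dots> \<longleftrightarrow> cheap I X Y L (\<lambda>x y. pmf (inputs p) (x, y)) h (\<lambda>x y m. pmf p (x, y, m)) (\<lambda>x y m. pmf q (x, y, m)) t"
    unfolding cheap_def using marginal_cost_le_iff[OF fin sub] sub(2) by (auto simp: pmf_positive_iff)
  finally show ?thesis .
qed

text \<open>\<open>P\<close> is compared only where \<open>q\<close> is positive: a protocol rebuilt
  from conditional laws with default values is known to agree with the original one only
  there.\<close>

lemma cheap_cong:
  assumes "\<And>x y. x \<in> X \<Longrightarrow> y \<in> Y \<Longrightarrow> \<mu> x y = \<mu>' x y" "\<And>x y. x \<in> X \<Longrightarrow> y \<in> Y \<Longrightarrow> h x y = h' x y"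
    and q: "\<And>x y w. x \<in> X \<Longrightarrow> y \<in> Y \<Longrightarrow> w \<in> W \<Longrightarrow> q x y w = q' x y w"
    and P: "\<And>x y w. x \<in> X \<Longrightarrow> y \<in> Y \<Longrightarrow> w \<in> W \<Longrightarrow> 0 < q x y w \<Longrightarrow> P x y w = P' x y w"
    and ch: "cheap I X Y W \<mu> h P q t"
  shows "cheap I X Y W \<mu>' h' P' q' t"
  unfolding cheap_def
proof (intro ballI impI)
  fix x y w assume xyw: "x \<in> X" "y \<in> Y" "w \<in> W" "0 < q' x y w"
  then have pos: "0 < q x y w" using q by simp
  have "info_cost I X Y \<mu> P q x y w = info_cost I X Y \<mu>' P' q' x y w"
    unfolding info_cost_def using xyw assms(1) q P[OF xyw(1-3) pos] by (simp cong: sum.cong)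
  moreover have "bias X Y h q w = bias X Y h' q' w"
    unfolding bias_def using xyw assms(2) q by (simp cong: sum.cong)
  moreover have "P x y w = P' x y w" using P[OF xyw(1-3) pos] .
  ultimately show "0 < P' x y w \<and> 0 < bias X Y h' q' w \<and> info_cost I X Y \<mu>' P' q' x y w - 180 * I * log 2 (bias X Y h' q' w) \<le> t"
    using ch xyw(1-3) pos unfolding cheap_def by metis
qed

lemma cheap_words1:
  assumes "cheap I (words 1 X) (words 1 Y) W \<mu> h P q t"
  shows "cheap I X Y W (\<lambda>x y. \<mu> [x] [y]) (\<lambda>x y. h [x] [y]) (\<lambda>x y. P [x] [y]) (\<lambda>x y. q [x] [y]) t"
proof -
  show ?thesis using assms unfolding cheap_def info_cost_def bias_def sum_words1 by (simp add: words1 del: One_nat_def)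
qed

lemma protocol_dist_exists:
  assumes fin: "finite X" "finite Y" "\<forall>A\<in>set As. finite A" and len: "2 \<le> length As" and ne: "listset As \<noteq> {}"
    and G: "\<And>x y pre z. G x y pre z = (if pre = [] then r z else if odd (length pre) then a x pre z else b y pre z)"
    and kern: "\<And>x y. x \<in> X \<Longrightarrow> y \<in> Y \<Longrightarrow> kernel_on As (G x y)"
    and mu: "set_pmf \<mu> \<subseteq> X \<times> Y"
  shows "\<exists>p. inputs p = \<mu> \<and> protocol_dist X Y As p \<and> (\<forall>x y m. pmf p (x, y, m) = (if x \<in> X \<and> y \<in> Y \<and> m \<in> listset As
        then pmf \<mu> (x, y) * (\<Prod>j<length As. G x y (take j m) (m ! j)) else 0))"
proof -
  define F where "F = (\<lambda>(x, y, m). pmf \<mu> (x, y) * (\<Prod>j<length As. G x y (take j m) (m ! j)))"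
  have finL: "finite (listset As)" using fin(3) by (rule finite_listset)
  obtain m0 where m0: "m0 \<in> listset As" using ne by blast
  have K: "(\<Sum>m\<in>listset As. \<Prod>j<length As. G x y (take j m) (m ! j)) = 1" if "x \<in> X" "y \<in> Y" for x y
    using prefix_mass_kernel[OF fin(3) kern[OF that] m0 le0] by (simp add: prefix_mass_def)
  have "\<exists>p. \<forall>w. pmf p w = (if w \<in> X \<times> Y \<times> listset As then F w else 0)"
  proof (rule pmf_finite_exists)
    show "finite (X \<times> Y \<times> listset As)" using fin finL by simp
    show "0 \<le> F w" if w: "w \<in> X \<times> Y \<times> listset As" for w
    proof -
      obtain x y m where "w = (x, y, m)" "x \<in> X" "y \<in> Y" "m \<in> listset As" using w by auto
      then show ?thesis using kern[of x y] unfolding F_def kernel_on_def by (auto intro!: mult_nonneg_nonneg prod_nonneg)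
    qed
    have "sum F (X \<times> Y \<times> listset As) = (\<Sum>x\<in>X. \<Sum>y\<in>Y. pmf \<mu> (x, y) * (\<Sum>m\<in>listset As. \<Prod>j<length As. G x y (take j m) (m ! j)))"
      unfolding F_def by (simp add: sum.cartesian_product' sum_distrib_left)
    also have "\<dots> = sum (pmf \<mu>) (X \<times> Y)" by (simp add: K sum.cartesian_product')
    also have "\<dots> = 1" using fin mu by (intro sum_pmf_eq_1) auto
    finally show "sum F (X \<times> Y \<times> listset As) = 1" .
  qed
  then obtain p where "\<And>w. pmf p w = (if w \<in> X \<times> Y \<times> listset As then F w else 0)" by blast
  then have p: "pmf p (x, y, m) = (if x \<in> X \<and> y \<in> Y \<and> m \<in> listset As
        then pmf \<mu> (x, y) * (\<Prod>j<length As. G x y (take j m) (m ! j)) else 0)" for x y m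
    by (simp add: F_def)
  show ?thesis using protocol_dist_kernel[OF fin len ne G kern mu p] p by blast
qed

text \<open>After the splits, public randomness and first message are lists of words. Coding them as
  single numbers by \<open>to_nat\<close> changes entries 0 and 1 of the transcript alone, and a
  word of length 1 is replaced by its letter.\<close>

lemma protocol_of_achievable:
  fixes X Y :: "nat set" and \<mu> :: "(nat \<times> nat) pmf"
  assumes fin: "finite X" "finite Y" "\<forall>A\<in>set As. finite A" and len: "2 \<le> length As" and mu: "set_pmf \<mu> \<subseteq> X \<times> Y"
    and g: "achievable I (words 1 X) (words 1 Y) (xor_power f) (\<lambda>x y. pmf \<mu> (x ! 0, y ! 0)) (drop 2 As) t"
  shows "\<exists>As' p'. protocol_dist X Y As' p' \<and> inputs p' = \<mu> \<and> length As' = length As \<and>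
    (\<forall>j. 1 < j \<and> j < length As \<longrightarrow> As' ! j = As ! j) \<and> marginal_info I p' f \<le> ereal t"
proof -
  define Cs where "Cs = drop 2 As"
  have finC: "\<forall>C\<in>set Cs. finite C" unfolding Cs_def using fin(3) by (auto dest: in_set_dropD)
  obtain U V P A B where finU: "finite U" "finite V"
    and pr: "prot (words 1 X) (words 1 Y) Cs (\<lambda>x y. pmf \<mu> (x ! 0, y ! 0)) U V P"
    and AB: "\<And>x m. 0 \<le> A x m" "\<And>y m. 0 \<le> B y m"
    and total: "(\<Sum>x\<in>words 1 X. \<Sum>y\<in>words 1 Y. \<Sum>m\<in>U \<times> V \<times> listset Cs. pmf \<mu> (x ! 0, y ! 0) * A x m * B y m) = 1"
    and ch: "cheap I (words 1 X) (words 1 Y) (U \<times> V \<times> listset Cs) (\<lambda>x y. pmf \<mu> (x ! 0, y ! 0)) (xor_power f) P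
      (\<lambda>x y m. pmf \<mu> (x ! 0, y ! 0) * A x m * B y m) t"
    using g unfolding achievable_def Cs_def by blast
  obtain \<rho> \<alpha> \<kappa> \<kappa>' where pb: "prot_by (words 1 X) (words 1 Y) Cs (\<lambda>x y. pmf \<mu> (x ! 0, y ! 0)) U V P \<rho> \<alpha> \<kappa> \<kappa>'"
    using pr unfolding prot_def by blast
  note p = prot_byD[OF pb]
  have w1: "[x] \<in> words 1 X" if "x \<in> X" for x and X :: "nat set" using that by (simp add: words_def)
  define enc :: "trans \<Rightarrow> nat list" where "enc = (\<lambda>(u, v, t). to_nat u # to_nat v # t)"
  define dec :: "nat list \<Rightarrow> trans" where "dec m = (from_nat (m ! 0), from_nat (m ! 1), drop 2 m)" for m
  have de: "dec (enc w) = w" for w by (cases w) (simp add: enc_def dec_def)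
  define As' where "As' = to_nat ` U # to_nat ` V # Cs"
  let ?W = "U \<times> V \<times> listset Cs"
  have LW: "listset As' = enc ` ?W" unfolding As'_def enc_def by (auto simp: set_Cons_def image_iff)
  have injW: "inj_on enc ?W" using de by (metis inj_onI)
  have finA': "\<forall>A\<in>set As'. finite A" unfolding As'_def using finU finC by simp
  have lenA': "length As' = Suc (Suc (length Cs))" "2 \<le> length As'" unfolding As'_def by auto
  have ne: "listset As' \<noteq> {}" using total unfolding LW by auto
  have finL: "finite (listset As')" using finA' by (rule finite_listset)
  define r where "r z = \<rho> (from_nat z)" for z
  define a where "a x pre z = (if length pre = 1 then \<alpha> [x] (from_nat (pre ! 0)) (from_nat z)
    else \<kappa> [x] (from_nat (pre ! 0)) (from_nat (pre ! 1)) (drop 2 pre) z)" for x pre z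
  define b where "b y pre z = \<kappa>' [y] (from_nat (pre ! 0)) (from_nat (pre ! 1)) (drop 2 pre) z" for y pre z
  define G where "G x y pre z = (if pre = [] then r z else if odd (length pre) then a x pre z else b y pre z)" for x y pre z
  have G0: "G x y [] z = \<rho> (from_nat z)" for x y z by (simp add: G_def r_def)
  have G1: "G x y [u] z = \<alpha> [x] (from_nat u) (from_nat z)" for x y u z by (simp add: G_def a_def)
  have G2: "G x y (u # v # pre) z = (if odd (length pre) then \<kappa> [x] (from_nat u) (from_nat v) else \<kappa>' [y] (from_nat u) (from_nat v)) pre z"
    for x y u v pre z by (simp add: G_def a_def b_def)
  have Gprod: "(\<Prod>j<length As'. G x y (take j (enc (u, v, s))) (enc (u, v, s) ! j)) =
      \<rho> u * \<alpha> [x] u v * (parity_prod True (\<kappa> [x] u v) s * parity_prod False (\<kappa>' [y] u v) s)" if "s \<in> listset Cs" for x y u v s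
    using that unfolding lenA' prod.lessThan_Suc_shift parity_prod_mult enc_def by (simp add: G0 G1 G2 listset_conv cong: if_cong)
  have ker: "kernel_on As' (G x y)" if xy: "x \<in> X" "y \<in> Y" for x y
    unfolding kernel_on_def
  proof (intro ballI allI impI)
    fix m j assume "m \<in> listset As'" and j: "j < length As'"
    then obtain u v s where m: "m = to_nat u # to_nat v # s" "u \<in> U" "v \<in> V" "s \<in> listset Cs"
      unfolding LW enc_def by auto
    show "0 \<le> G x y (take j m) (m ! j) \<and> (\<Sum>z\<in>As' ! j. G x y (take j m) z) = 1"
    proof (cases j)
      case 0
      then show ?thesis using p(1,2) by (simp add: G0 As'_def sum.reindex)
    next
      case (Suc i)
      show ?thesis
      proof (cases i)
        case 0
        then show ?thesis using p(3) p(4)[OF w1[OF xy(1)] m(2)] Suc m by (simp add: G1 As'_def sum.reindex)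
      next
        case (Suc k)
        then have k: "length (take k s) = k" "k < length Cs" using j \<open>j = Suc i\<close> m(4) lenA' by (auto simp: listset_conv)
        have kk: "kern Cs (\<kappa> [x] u v)" "kern Cs (\<kappa>' [y] u v)" using p(5,6) w1 xy m by auto
        have sum1: "(\<Sum>z\<in>Cs ! k. g (take k s) z) = 1" if "kern Cs g" for g
          using that k unfolding kern_def by metis
        show ?thesis using \<open>j = Suc i\<close> Suc m k sum1[OF kk(1)] sum1[OF kk(2)] kk unfolding kern_def by (auto simp: G2 As'_def)
      qed
    qed
  qed
  obtain p' where p': "inputs p' = \<mu>" "protocol_dist X Y As' p'"
    "\<And>x y m. pmf p' (x, y, m) = (if x \<in> X \<and> y \<in> Y \<and> m \<in> listset As'
        then pmf \<mu> (x, y) * (\<Prod>j<length As'. G x y (take j m) (m ! j)) else 0)"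
    using protocol_dist_exists[where G = G, OF fin(1,2) finA' lenA'(2) ne G_def ker mu] by blast
  define F where "F = (\<lambda>(x, y, m). pmf \<mu> (x, y) * A [x] (dec m) * B [y] (dec m))"
  have "\<exists>q. \<forall>w. pmf q w = (if w \<in> X \<times> Y \<times> listset As' then F w else 0)"
  proof (rule pmf_finite_exists)
    show "finite (X \<times> Y \<times> listset As')" using fin finL by simp
    show "0 \<le> F w" for w unfolding F_def using AB by (auto split: prod.split)
    have "sum F (X \<times> Y \<times> listset As') = (\<Sum>x\<in>X. \<Sum>y\<in>Y. \<Sum>m\<in>?W. pmf \<mu> (x, y) * A [x] m * B [y] m)"
      unfolding F_def LW sum.cartesian_product'[of _ X] sum.cartesian_product'[of _ Y] sum.reindex[OF injW] by (simp add: de)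
    then show "sum F (X \<times> Y \<times> listset As') = 1" using total unfolding sum_words1 by simp
  qed
  then obtain q where "\<And>w. pmf q w = (if w \<in> X \<times> Y \<times> listset As' then F w else 0)" by blast
  then have q: "pmf q (x, y, m) = (if x \<in> X \<and> y \<in> Y \<and> m \<in> listset As'
      then pmf \<mu> (x, y) * A [x] (dec m) * B [y] (dec m) else 0)" for x y m by (simp add: F_def)
  \<comment> \<open>Rectangularity is demanded at all \<open>x\<close>, \<open>y\<close>,
    \<open>m\<close>, so the factors are set to 0 outside the inputs and transcripts.\<close>
  have rect: "rectangular (inputs p') q" unfolding rectangular_def p'(1)
    by (rule exI[of _ "\<lambda>x m. if x \<in> X \<and> m \<in> listset As' then A [x] (dec m) else 0"],
        rule exI[of _ "\<lambda>y m. if y \<in> Y then B [y] (dec m) else 0"]) (simp add: q)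
  have sub: "set_pmf p' \<subseteq> X \<times> Y \<times> listset As'" "set_pmf q \<subseteq> X \<times> Y \<times> listset As'"
    by (auto simp: set_pmf_iff p'(3) q split: if_splits)
  have "cheap I X Y ?W (\<lambda>x y. pmf \<mu> (x, y)) (\<lambda>x y. xor_power f [x] [y]) (\<lambda>x y w. P [x] [y] (dec (enc w)))
      (\<lambda>x y m. pmf \<mu> (x, y) * A [x] m * B [y] m) t"
    using cheap_words1[OF ch] by (simp add: de)
  then have "cheap I X Y (enc ` ?W) (\<lambda>x y. pmf \<mu> (x, y)) (\<lambda>x y. xor_power f [x] [y]) (\<lambda>x y m. P [x] [y] (dec m))
      (\<lambda>x y m. pmf \<mu> (x, y) * A [x] (dec m) * B [y] (dec m)) t"
    by (intro cheap_relabel[of ?W dec enc]) (simp_all add: de)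
  then have "cheap I X Y (listset As') (\<lambda>x y. pmf (inputs p') (x, y)) f (\<lambda>x y m. pmf p' (x, y, m)) (\<lambda>x y m. pmf q (x, y, m)) t"
    unfolding LW[symmetric] p'(1)
  proof (rule cheap_cong[rotated -1])
    show "xor_power f [x] [y] = f x y" for x y by (simp add: xor_power_def)
    show "P [x] [y] (dec m) = pmf p' (x, y, m)" if xy: "x \<in> X" "y \<in> Y" and m: "m \<in> listset As'" for x y m
    proof -
      obtain u v s where w: "m = enc (u, v, s)" "u \<in> U" "v \<in> V" "s \<in> listset Cs" using m unfolding LW by auto
      have "P [x] [y] (u, v, s) = pmf \<mu> (x, y) * \<rho> u * \<alpha> [x] u v * (parity_prod True (\<kappa> [x] u v) s * parity_prod False (\<kappa>' [y] u v) s)"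
        using p(7)[OF w1[OF xy(1)] w1[OF xy(2)] w(2-4)] by simp
      then show ?thesis using xy m Gprod[OF w(4)] unfolding p'(3) w(1) de by simp
    qed
  qed (simp_all add: q)
  then have "(SUP (x, y, m)\<in>set_pmf q. marginal_cost I p' f q x y m) \<le> ereal t"
    unfolding SUP_marginal_cost_le_iff[OF fin(1,2) finL sub] .
  then have "marginal_info I p' f \<le> ereal t"
    unfolding marginal_info_def using rect by (intro INF_lower2[of q]) auto
  moreover have "length As' = length As" using len lenA' by (simp add: Cs_def)
  moreover have "As' ! j = As ! j" if "1 < j" "j < length As" for j
  proof -
    obtain i where "j = Suc (Suc i)" using \<open>1 < j\<close> by (cases j; cases "j - 1") auto
    then show ?thesis unfolding As'_def Cs_def using len by simp
  qed
  ultimately show ?thesis using p'(1,2) by blast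
qed

text \<open>Conditioning on a null event would give 0 for every letter, which is not normalized,
  hence the point mass.\<close>

definition cond_kernel :: "('x \<times> 'y \<times> 'm list) pmf \<Rightarrow> 'm set list \<Rightarrow> ('x \<times> 'y \<times> 'm list \<Rightarrow> bool) \<Rightarrow> nat \<Rightarrow> 'm \<Rightarrow> real" where
  "cond_kernel p As E j z = (if \<P>(w in p. E w) = 0 then of_bool (z = (SOME z. z \<in> As ! j))
     else \<P>(w in p. snd (snd w) ! j = z \<bar> E w))"

lemma cond_kernel_nonneg: "0 \<le> cond_kernel p As E j z"
  unfolding cond_kernel_def cond_prob_def by simp

lemma cond_kernel_eq:
  fixes p :: "('x \<times> 'y \<times> 'm list) pmf"
  shows "\<P>(w in p. snd (snd w) ! j = z \<bar> E w) \<noteq> 0 \<Longrightarrow> cond_kernel p As E j z = \<P>(w in p. snd (snd w) ! j = z \<bar> E w)"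
  unfolding cond_kernel_def cond_prob_def by auto

lemma sum_entry_prob:
  assumes sub: "set_pmf p \<subseteq> X \<times> Y \<times> listset As" and fin: "\<forall>A\<in>set As. finite A" and j: "j < length As"
  shows "(\<Sum>z\<in>As ! j. \<P>(w in p. snd (snd w) ! j = z \<and> E w)) = \<P>(w in p. E w)"
proof -
  have f: "finite (As ! j)" using fin j by auto
  have "(\<Sum>z\<in>As ! j. \<P>(w in p. snd (snd w) ! j = z \<and> E w)) =
      measure p (\<Union>z\<in>As ! j. {w \<in> space p. snd (snd w) ! j = z \<and> E w})"
    using f by (intro measure_pmf.finite_measure_finite_Union[symmetric]) (auto simp: disjoint_family_on_def)
  also have "\<dots> = measure p ({w \<in> space p. E w} \<inter> set_pmf p)"
  proof -
    have "(\<Union>z\<in>As ! j. {w \<in> space p. snd (snd w) ! j = z \<and> E w}) \<inter> set_pmf p = {w \<in> space p. E w} \<inter> set_pmf p"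
      using sub j by (auto simp: listset_conv)
    from arg_cong[OF this, of "measure p"] show ?thesis by (simp only: measure_Int_set_pmf)
  qed
  finally show ?thesis by (simp only: measure_Int_set_pmf)
qed

lemma sum_cond_kernel:
  assumes sub: "set_pmf p \<subseteq> X \<times> Y \<times> listset As" and fin: "\<forall>A\<in>set As. finite A" and j: "j < length As"
  shows "(\<Sum>z\<in>As ! j. cond_kernel p As E j z) = 1"
proof (cases "\<P>(w in p. E w) = 0")
  case True
  obtain w where "w \<in> set_pmf p" using set_pmf_not_empty[of p] by blast
  then have "snd (snd w) ! j \<in> As ! j" using sub j by (auto simp: listset_conv)
  then have "(SOME z. z \<in> As ! j) \<in> As ! j" by (rule someI)
  moreover have "finite (As ! j)" using fin j by auto
  ultimately show ?thesis unfolding cond_kernel_def using True by simp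
next
  case False
  then show ?thesis unfolding cond_kernel_def cond_prob_def
    using sum_entry_prob[OF sub fin j, of E] by (simp add: sum_divide_distrib[symmetric])
qed

text \<open>A finite bound on the cost confines \<open>q\<close> to the support of \<open>p\<close>.
  There no conditional factor of \<open>p\<close> vanishes, so completing the conditional laws by
  point masses to genuine kernels does not alter \<open>p\<close> at any point that matters for the
  cost.\<close>

lemma achievable_of_rectangular:
  fixes p q :: "('x \<times> 'y \<times> nat list) pmf"
  assumes fin: "finite X" "finite Y" and pr: "protocol_dist X Y As p"
    and rect: "rectangular (inputs p) q"
    and cost: "(SUP (x, y, m)\<in>set_pmf q. marginal_cost I p h q x y m) \<le> ereal t"
    and mu: "\<And>x y. x \<in> X \<Longrightarrow> y \<in> Y \<Longrightarrow> pmf (inputs p) (x, y) = \<mu> x y"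
  shows "achievable I X Y h \<mu> (drop 2 As) t"
proof -
  have finA: "\<forall>A\<in>set As. finite A" and len: "2 \<le> length As" and sub: "set_pmf p \<subseteq> X \<times> Y \<times> listset As"
    using pr unfolding protocol_dist_def by auto
  define L where "L = listset As"
  have finL: "finite L" unfolding L_def using finA by (rule finite_listset)
  have qp: "pmf p (x, y, m) \<noteq> 0" if "(x, y, m) \<in> set_pmf q" for x y m
  proof
    assume "pmf p (x, y, m) = 0"
    then have "marginal_cost I p h q x y m = \<infinity>" by (simp add: marginal_cost_def)
    moreover have "marginal_cost I p h q x y m \<le> ereal t" using cost that unfolding SUP_le_iff by auto
    ultimately show False by simp
  qed
  then have qsub: "set_pmf q \<subseteq> X \<times> Y \<times> listset As" using sub by (force simp: set_pmf_iff)
  have ch: "cheap I X Y L (\<lambda>x y. pmf (inputs p) (x, y)) h (\<lambda>x y m. pmf p (x, y, m)) (\<lambda>x y m. pmf q (x, y, m)) t"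
    using cost unfolding L_def SUP_marginal_cost_le_iff[OF fin finL[unfolded L_def] sub qsub] .
  obtain A0 B0 where q0: "\<And>x y m. pmf q (x, y, m) = pmf (inputs p) (x, y) * A0 x m * B0 y m"
    using rect unfolding rectangular_def by blast
  \<comment> \<open>The two factors of a rectangular \<open>q\<close> may be negative. Their product
    with the prior is not, so absolute values can be taken.\<close>
  have q1: "pmf q (x, y, m) = \<mu> x y * \<bar>A0 x m\<bar> * \<bar>B0 y m\<bar>" if "x \<in> X" "y \<in> Y" for x y m
  proof -
    have "pmf q (x, y, m) = \<bar>pmf q (x, y, m)\<bar>" by simp
    also have "\<dots> = pmf (inputs p) (x, y) * \<bar>A0 x m\<bar> * \<bar>B0 y m\<bar>" unfolding q0 abs_mult by simp
    finally show ?thesis by (simp add: mu that)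
  qed
  define Cs where "Cs = drop 2 As"
  obtain A1 A2 where As: "As = A1 # A2 # Cs"
    unfolding Cs_def using len by (metis One_nat_def Suc_1 Suc_le_length_iff drop_Suc_Cons drop0)
  \<comment> \<open>A number becomes a list with one word of one letter, the form to which the
    splits prepend further words.\<close>
  define U where "U = (\<lambda>z. [[z]]) ` A1"
  define V where "V = (\<lambda>z. [[z]]) ` A2"
  define \<phi> :: "nat list \<Rightarrow> trans" where "\<phi> m = ([[m ! 0]], [[m ! 1]], drop 2 m)" for m
  define \<psi> :: "trans \<Rightarrow> nat list" where "\<psi> = (\<lambda>(u, v, s). hd (hd u) # hd (hd v) # s)"
  have L: "L = (\<lambda>(a, b, s). a # b # s) ` (A1 \<times> A2 \<times> listset Cs)"
    unfolding L_def As by (auto simp: set_Cons_def image_iff)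
  have \<psi>\<phi>: "\<psi> (\<phi> m) = m" if "m \<in> L" for m using that unfolding L \<phi>_def \<psi>_def by auto
  have \<phi>L: "\<phi> ` L = U \<times> V \<times> listset Cs" unfolding L \<phi>_def U_def V_def image_image by (force simp: image_iff)
  define \<rho> where "\<rho> u = cond_kernel p As (\<lambda>_. True) 0 (hd (hd u))" for u :: "nat list list"
  define \<alpha> where "\<alpha> x u v = cond_kernel p As (\<lambda>w. fst w = x \<and> take 1 (snd (snd w)) = [hd (hd u)]) 1 (hd (hd v))"
    for x and u v :: "nat list list"
  define \<kappa> where "\<kappa> x u v pre z = cond_kernel p As (\<lambda>w. fst w = x \<and>
      take (Suc (Suc (length pre))) (snd (snd w)) = hd (hd u) # hd (hd v) # pre) (Suc (Suc (length pre))) z"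
    for x and u v :: "nat list list" and pre z
  define \<kappa>' where "\<kappa>' y u v pre z = cond_kernel p As (\<lambda>w. fst (snd w) = y \<and>
      take (Suc (Suc (length pre))) (snd (snd w)) = hd (hd u) # hd (hd v) # pre) (Suc (Suc (length pre))) z"
    for y and u v :: "nat list list" and pre z
  define P where "P x y = (\<lambda>(u, v, s). \<mu> x y * \<rho> u * \<alpha> x u v * (parity_prod True (\<kappa> x u v) s * parity_prod False (\<kappa>' y u v) s))" for x y
  note sk = sum_cond_kernel[OF sub finA]
  have "prot_by X Y Cs \<mu> U V P \<rho> \<alpha> \<kappa> \<kappa>'"
    unfolding prot_by_def
  proof (intro conjI allI ballI)
    show "(\<Sum>u\<in>U. \<rho> u) = 1" using sk[of 0] by (simp add: U_def \<rho>_def sum.reindex inj_on_def As)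
    show "(\<Sum>v\<in>V. \<alpha> x u v) = 1" for x u using sk[of 1] by (simp add: V_def \<alpha>_def sum.reindex inj_on_def As)
    show "kern Cs (\<kappa> x u v)" "kern Cs (\<kappa>' y u v)" for x y u v
      unfolding kern_def \<kappa>_def \<kappa>'_def using sk[of "Suc (Suc _)"] by (auto simp: cond_kernel_nonneg As)
  qed (auto simp: \<rho>_def \<alpha>_def P_def cond_kernel_nonneg)
  then have "prot X Y Cs \<mu> U V P" unfolding prot_def by blast
  define c where "c x y m j = (if odd j
      then \<P>(w in p. snd (snd w) ! j = m ! j \<bar> fst w = x \<and> take j (snd (snd w)) = take j m)
      else \<P>(w in p. snd (snd w) ! j = m ! j \<bar> fst (snd w) = y \<and> take j (snd (snd w)) = take j m))" for x y m j
  have Pp: "pmf p (x, y, m) = P x y (\<phi> m)" if xy: "x \<in> X" "y \<in> Y" and m: "m \<in> L" and pos: "0 < pmf q (x, y, m)" for x y m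
  proof -
    obtain a b s where ab: "m = a # b # s" "s \<in> listset Cs" using m unfolding L by auto
    have ls: "length s = length Cs" using ab(2) by (simp add: listset_conv)
    have prod: "pmf p (x, y, m) = \<mu> x y * \<P>(w in p. snd (snd w) ! 0 = a) * (c x y m 1 * (\<Prod>i<length Cs. c x y m (Suc (Suc i))))"
    proof -
      have "pmf p (x, y, m) = pmf (inputs p) (x, y) * \<P>(w in p. snd (snd w) ! 0 = m ! 0) * (\<Prod>j = 1..<length As. c x y m j)"
        using pr xy m unfolding protocol_dist_def L_def c_def by blast
      moreover have "(\<Prod>j = 1..<length As. c x y m j) = (\<Prod>i<Suc (length Cs). c x y m (Suc i))"
        unfolding As by (simp only: list.size add_Suc_right add_0_right One_nat_def plus_nat.add_Suc
            prod.atLeast_Suc_lessThan_Suc_shift atLeast0LessThan o_def)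
      ultimately show ?thesis by (simp add: prod.lessThan_Suc_shift mu[OF xy] ab del: prod.lessThan_Suc)
    qed
    have "pmf p (x, y, m) \<noteq> 0" using qp[of x y m] pos by (simp add: pmf_positive_iff)
    then have nz: "\<P>(w in p. snd (snd w) ! 0 = a) \<noteq> 0" "c x y m 1 \<noteq> 0" "\<And>i. i < length Cs \<Longrightarrow> c x y m (Suc (Suc i)) \<noteq> 0"
      unfolding prod by auto
    have r: "\<rho> [[a]] = \<P>(w in p. snd (snd w) ! 0 = a)"
      using cond_kernel_eq[of p 0 a "\<lambda>_. True" As] nz(1) measure_pmf.prob_space[of p] unfolding \<rho>_def cond_prob_def by simp
    have al: "\<alpha> x [[a]] [[b]] = c x y m 1"
      using cond_kernel_eq[of p 1 b "\<lambda>w. fst w = x \<and> take 1 (snd (snd w)) = [a]" As] nz(2)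
      unfolding \<alpha>_def c_def ab by simp
    have ka: "(if odd i then \<kappa> x [[a]] [[b]] else \<kappa>' y [[a]] [[b]]) (take i s) (s ! i) = c x y m (Suc (Suc i))" if i: "i < length Cs" for i
      using cond_kernel_eq[of p "Suc (Suc i)" "s ! i" "\<lambda>w. fst w = x \<and> take (Suc (Suc i)) (snd (snd w)) = a # b # take i s" As]
        cond_kernel_eq[of p "Suc (Suc i)" "s ! i" "\<lambda>w. fst (snd w) = y \<and> take (Suc (Suc i)) (snd (snd w)) = a # b # take i s" As]
        nz(3)[OF i] i ls unfolding \<kappa>_def \<kappa>'_def c_def ab by (simp add: min_absorb2 split: if_splits)
    have "parity_prod True (\<kappa> x [[a]] [[b]]) s * parity_prod False (\<kappa>' y [[a]] [[b]]) s = (\<Prod>i<length Cs. c x y m (Suc (Suc i)))"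
      unfolding parity_prod_mult ls by (intro prod.cong refl) (use ka ls in \<open>simp add: min_absorb2\<close>)
    then show ?thesis unfolding prod P_def \<phi>_def using r al by (simp add: ab mult.assoc)
  qed
  show ?thesis
    unfolding Cs_def[symmetric]
  proof (rule achievableI[OF \<psi>\<phi> \<phi>L])
    show "finite U" "finite V" unfolding U_def V_def using finA by (simp_all add: As)
    show "prot X Y Cs \<mu> U V P" by fact
    show "0 \<le> \<bar>A0 x m\<bar>" "0 \<le> \<bar>B0 y m\<bar>" for x y m by simp_all
    show "\<mu> x y * \<bar>A0 x m\<bar> * \<bar>B0 y m\<bar> = \<mu> x y * \<bar>A0 x m\<bar> * \<bar>B0 y m\<bar>" for x y m ..
    have "sum (pmf q) (X \<times> Y \<times> L) = 1" using fin finL qsub unfolding L_def by (intro sum_pmf_eq_1) auto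
    then show "(\<Sum>x\<in>X. \<Sum>y\<in>Y. \<Sum>m\<in>L. \<mu> x y * \<bar>A0 x m\<bar> * \<bar>B0 y m\<bar>) = 1"
      unfolding sum.cartesian_product' using q1 by simp
    show "cheap I X Y L \<mu> h (\<lambda>x y m. P x y (\<phi> m)) (\<lambda>x y m. \<mu> x y * \<bar>A0 x m\<bar> * \<bar>B0 y m\<bar>) t"
      by (rule cheap_cong[OF mu refl q1 Pp ch])
  qed
qed

text \<open>A fixed transcript is sent whatever the inputs are. This serves the case in which the
  given marginal information is \<open>\<infinity>\<close> and the bound on the cost is
  void.\<close>

lemma trivial_protocol:
  fixes X :: "'x set" and Y :: "'y set" and As :: "'m set list"
  assumes fin: "finite X" "finite Y" and As: "2 \<le> length As" "\<forall>A\<in>set As. finite A" "listset As \<noteq> {}"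
    and mu: "set_pmf \<mu> \<subseteq> X \<times> Y"
  shows "\<exists>p. protocol_dist X Y As p \<and> inputs p = \<mu>"
proof -
  obtain m0 where m0: "m0 \<in> listset As" using As(3) by blast
  define G where "G x y pre z = (if pre = [] then of_bool (z = m0 ! 0) else if odd (length pre) then of_bool (z = m0 ! length pre)
    else of_bool (z = m0 ! length pre) :: real)" for x :: 'x and y :: 'y and pre :: "'m list" and z
  have "kernel_on As (G x y)" for x y unfolding kernel_on_def
  proof (intro ballI allI impI)
    fix m j assume m: "m \<in> listset As" and j: "j < length As"
    have "length (take j m) = j" using m j by (simp add: listset_conv)
    moreover have "finite (As ! j)" "m0 ! j \<in> As ! j" using As(2) m0 j by (auto simp: listset_conv)
    ultimately show "0 \<le> G x y (take j m) (m ! j) \<and> (\<Sum>z\<in>As ! j. G x y (take j m) z) = 1"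
      unfolding G_def by (cases "take j m = []") auto
  qed
  from protocol_dist_exists[where G = G, OF fin As(2,1,3) G_def this mu] show ?thesis by blast
qed

theorem theorem6:
  shows "\<exists>\<Delta>::real.
    \<forall>(I::real) (X::nat set) (Y::nat set) (f::nat \<Rightarrow> nat \<Rightarrow> bool) (n::nat)
      (As::nat set list) (p::(nat list \<times> nat list \<times> nat list) pmf).
      1 \<le> I \<longrightarrow> finite X \<longrightarrow> finite Y \<longrightarrow> 1 \<le> n \<longrightarrow>
      protocol_dist (words n X) (words n Y) As p \<longrightarrow>
      (\<forall>x \<in> words n X. \<forall>y \<in> words n Y.
         pmf (inputs p) (x, y) = (\<Prod>i<n. pmf (coord_inputs i p) (x ! i, y ! i))) \<longrightarrow>
      (\<exists>i<n. \<exists>(As'::nat set list) (p'::(nat \<times> nat \<times> nat list) pmf).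
         protocol_dist X Y As' p' \<and>
         inputs p' = coord_inputs i p \<and>
         length As' = length As \<and>
         (\<forall>j. 1 < j \<and> j < length As \<longrightarrow> As' ! j = As ! j) \<and>
         marginal_info I p' f \<le>
           marginal_info I p (xor_power f) / ereal (real n) +
           ereal (\<Delta> * I * (1 + log2_plus
             (real_of_ereal (marginal_info I p (xor_power f)) / (real n * I)))))"
proof (rule exI[of _ 7000000000], intro allI impI, goal_cases)
  case (1 I X Y f n As p)
  note I = 1(1) and fin = 1(2,3) and n = 1(4) and pr = 1(5) and indep = 1(6)
  define \<mu>c where "\<mu>c i a b = pmf (coord_inputs i p) (a, b)" for i a b
  define M where "M = marginal_info I p (xor_power f)"
  have finA: "\<forall>A\<in>set As. finite A" and len: "2 \<le> length As" and sub: "set_pmf p \<subseteq> words n X \<times> words n Y \<times> listset As"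
    using pr unfolding protocol_dist_def by auto
  have finC: "\<forall>C\<in>set (drop 2 As). finite C" using finA by (auto dest: in_set_dropD)
  have ci: "set_pmf (coord_inputs i p) \<subseteq> X \<times> Y" if "i < n" for i
    unfolding coord_inputs_def using sub that by (force simp: words_def)
  have nn: "0 \<le> \<mu>c i a b" for i a b unfolding \<mu>c_def by simp
  \<comment> \<open>For \<open>i\<close> from \<open>n\<close> on, the entry \<open>x ! i\<close> is
    unspecified and may lie outside \<open>X\<close>, so equality can be expected for
    \<open>i < n\<close> only.\<close>
  have le: "(\<Sum>a\<in>X. \<Sum>b\<in>Y. \<mu>c i a b) \<le> 1" for i
  proof -
    have "(\<Sum>a\<in>X. \<Sum>b\<in>Y. \<mu>c i a b) = measure (coord_inputs i p) (X \<times> Y)"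
      unfolding \<mu>c_def using fin by (simp add: measure_measure_pmf_finite sum.cartesian_product')
    then show ?thesis by simp
  qed
  have ach: "achievable I (words n X) (words n Y) (xor_power f) (product_prior \<mu>c 0 n) (drop 2 As) t" if less: "M < ereal t" for t
  proof -
    obtain q where q: "rectangular (inputs p) q"
      "(SUP (x, y, m)\<in>set_pmf q. marginal_cost I p (xor_power f) q x y m) < ereal t"
      using less unfolding M_def marginal_info_def INF_less_iff by blast
    show ?thesis
      by (rule achievable_of_rectangular[OF finite_words[OF fin(1)] finite_words[OF fin(2)] pr q(1) less_imp_le[OF q(2)]])
         (use indep in \<open>simp add: product_prior_def \<mu>c_def\<close>)
  qed
  have "M \<noteq> -\<infinity>"
  proof
    assume "M = -\<infinity>"
    then have "achievable I (words n X) (words n Y) (xor_power f) (product_prior \<mu>c 0 n) (drop 2 As) (- (13 * I))"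
      by (intro ach) simp
    then have "- (12 * I) \<le> - (13 * I)"
      by (rule achievable_lower_bound[OF I finite_words[OF fin(1)] finite_words[OF fin(2)] finC product_prior_nonneg[OF nn] product_prior_sum[OF fin nn le]])
    then show False using I by simp
  qed
  then consider "M = \<infinity>" | t where "M = ereal t" by (cases M) auto
  then have "\<exists>i<n. \<exists>As' p'. protocol_dist X Y As' p' \<and> inputs p' = coord_inputs i p \<and> length As' = length As \<and>
         (\<forall>j. 1 < j \<and> j < length As \<longrightarrow> As' ! j = As ! j) \<and>
         marginal_info I p' f \<le> M / ereal (real n) +
           ereal (7000000000 * I * (1 + log2_plus (real_of_ereal M / (real n * I))))"
  proof cases
    case 1
    have "listset As \<noteq> {}" using sub set_pmf_not_empty[of p] by auto
    then obtain p' where "protocol_dist X Y As p'" "inputs p' = coord_inputs 0 p"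
      using trivial_protocol[OF fin len finA _ ci[of 0]] n by auto
    moreover have "M / ereal (real n) = \<infinity>" using n by (simp add: 1)
    ultimately show ?thesis
      using n by (intro exI[of _ 0] conjI exI[of _ As] exI[of _ p']) auto
  next
    case (2 t)
    define z where "z = t / (real n * I)"
    \<comment> \<open>The infimum need not be attained, hence the slack \<open>I\<close>. It adds
      \<open>I / n\<close> to the cost per coordinate and at most 4 to the truncated
      logarithm.\<close>
    have "achievable I (words n X) (words n Y) (xor_power f) (product_prior \<mu>c 0 n) (drop 2 As) (t + I)"
      using I by (intro ach) (simp add: 2)
    then obtain i t' where i: "i < n" "achievable I (words 1 X) (words 1 Y) (xor_power f) (product_prior \<mu>c i 1) (drop 2 As) t'"
      "t' \<le> (t + I) / n + I * (const_loss n + log_loss n * log2_plus ((t + I) / (n * I)))"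
      using achievable_coordinate[OF I fin finC nn le n] by force
    have "product_prior \<mu>c i 1 = (\<lambda>x y. pmf (coord_inputs i p) (x ! 0, y ! 0))"
      by (intro ext) (simp add: product_prior_def \<mu>c_def)
    then obtain As' p' where p': "protocol_dist X Y As' p'" "inputs p' = coord_inputs i p" "length As' = length As"
      "\<forall>j. 1 < j \<and> j < length As \<longrightarrow> As' ! j = As ! j" "marginal_info I p' f \<le> ereal t'"
      using protocol_of_achievable[OF fin finA len ci[OF i(1)], of I f t'] i(2) by auto
    have n1: "1 / real n \<le> 1" "0 < real n" using n by auto
    have lz: "log2_plus ((t + I) / (n * I)) \<le> log2_plus z + 4"
    proof -
      have "(t + I) / (n * I) = z + 1 / n * 1" unfolding z_def using I n1 by (simp add: add_divide_distrib)
      also have "\<dots> \<le> z + 1 / n * (1 + log2_plus z)" using log2_plus_nonneg[of z] by (intro add_left_mono mult_left_mono) auto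
      finally have "log2_plus ((t + I) / (n * I)) \<le> log2_plus z + 2 * (1 / n * (1 + 1))" by (intro log2_plus_perturb) auto
      also have "\<dots> \<le> log2_plus z + 2 * (1 * (1 + 1))"
        using n1(1) by (intro add_left_mono mult_left_mono mult_right_mono) auto
      finally show ?thesis by simp
    qed
    have ab: "const_loss n \<le> 6000000000" "log_loss n \<le> 20000" using n1 by (auto simp: const_loss_def log_loss_def)
    have b0: "0 \<le> log_loss n" unfolding log_loss_def using n1 by (intro mult_nonneg_nonneg) auto
    have "I / n \<le> I * 1" using I n1 mult_left_mono[OF n1(1), of I] by simp
    moreover have "log_loss n * log2_plus ((t + I) / (n * I)) \<le> 20000 * (log2_plus z + 4)"
      using ab b0 lz log2_plus_nonneg by (intro mult_mono) auto
    then have "I * (const_loss n + log_loss n * log2_plus ((t + I) / (n * I))) \<le> I * (6000000000 + 20000 * (log2_plus z + 4))"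
      using ab I by (intro mult_left_mono add_mono) auto
    ultimately have "t' \<le> t / n + I * (6000000000 + 20000 * (log2_plus z + 4) + 1)"
      using i(3) by (simp add: add_divide_distrib distrib_left)
    \<comment> \<open>The constant part is \<open>6000000000 + 80000 + 1\<close>, the coefficient of
      the truncated logarithm is 20000; a single constant covers both.\<close>
    also have "\<dots> \<le> t / n + I * (7000000000 * (1 + log2_plus z))"
      using I log2_plus_nonneg[of z] by (intro add_left_mono mult_left_mono) auto
    finally have "ereal t' \<le> M / ereal (real n) + ereal (7000000000 * I * (1 + log2_plus (real_of_ereal M / (real n * I))))"
      using n1 by (simp add: 2 z_def mult_ac)
    then show ?thesis
      using i(1) p' by (intro exI[of _ i] conjI exI[of _ As'] exI[of _ p']) auto
  qed
  then show ?case unfolding M_def .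
qed

end
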